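(* Let $d\ge 1$. (i) The probability measures $\lambda^m$ on $D_0=D_0([0,\infty)\to\mathbb{R}^d)$ converge weakly to $\lambda^0$ as $m\downarrow 0$. (ii) The probability measures $\nu^m$ on $D_0^{(1)}=D_0([0,\infty)\to\mathbb{R})$ converge weakly to $\nu^0$ as $m\downarrow 0$.
   Context: $D_0([0,\infty)\to\mathbb{R}^k)$ is the space of càdlàg paths $\omega:[0,\infty)\to\mathbb{R}^k$ with $\omega(0)=0$, equipped with the Skorohod topology; weak convergence of probability measures is with respect to this topology. For $m\ge 0$, $\lambda^m$ is the probability measure on $D_0$ under which the coordinate process $X$ is the Lévy process with $E^{\lambda^m}[e^{i\xi\cdot X(t)}]=e^{-t[\sqrt{|\xi|^2+m^2}-m]}$ for $\xi\in\mathbb{R}^d$, $t\ge0$. For $m\ge0$, $\nu^m$ is the probability measure on $D_0^{(1)}$ which is the law of the inverse Gaussian subordinator $U^m(t)=\inf\{s>0: B^1(s)+ms=t\}$, $t\ge 0$ (taken in its càdlàg version), where $B^1$ is a one-dimensional standard Brownian motion. Equivalently, under $\nu^m$ the coordinate process $T$ is a subordinator with, for $t>0$, $\nu^m(T(t)\in dr)=\frac{t}{\sqrt{2\pi}}e^{mt}r^{-3/2}\exp\{-\frac12(\frac{t^2}{r}+m^2r)\}\,dr$, $r>0$. *)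

theory Defs
  imports "HOL-Probability.Probability"
begin

definition cadlag :: "(real \<Rightarrow> 'a::topological_space) \<Rightarrow> bool" where
  "cadlag \<omega> \<longleftrightarrow>
     (\<forall>t\<ge>0. (\<omega> \<longlongrightarrow> \<omega> t) (at_right t)) \<and>
     (\<forall>t>0. \<exists>l. (\<omega> \<longlongrightarrow> l) (at_left t))"

text \<open>Paths are indexed by \<open>[0,\<infinity>)\<close>; extensionality pins down the irrelevant values at
  negative times, so that equality in \<open>D0\<close> is equality on \<open>[0,\<infinity>)\<close>.\<close>

definition D0 :: "(real \<Rightarrow> 'a::real_normed_vector) set" where
  "D0 = {\<omega> \<in> extensional {0..}. cadlag \<omega> \<and> \<omega> 0 = 0}"

text \<open>Time changes are automatically continuous and vanish at \<open>0\<close>.\<close>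

definition time_change :: "(real \<Rightarrow> real) \<Rightarrow> bool" where
  "time_change \<mu> \<longleftrightarrow> strict_mono_on {0..} \<mu> \<and> bij_betw \<mu> {0..} {0..}"

definition skorohod_nbhd ::
  "(real \<Rightarrow> 'a::real_normed_vector) \<Rightarrow> real \<Rightarrow> real \<Rightarrow> (real \<Rightarrow> 'a) set" where
  "skorohod_nbhd \<omega> \<epsilon> N =
     {\<eta> \<in> D0. \<exists>\<mu>. time_change \<mu> \<and> (\<forall>s\<ge>0. \<bar>\<mu> s - s\<bar> < \<epsilon>) \<and>
        (\<forall>s\<in>{0..N}. norm (\<eta> (\<mu> s) - \<omega> s) < \<epsilon>)}"

text \<open>The (J1) topology on \<open>[0,\<infinity>)\<close> in the form of Jacod and Shiryaev (Limit Theorems for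
  Stochastic Processes, Theorem VI.1.14): \<open>\<omega>\<^sub>n\<close> converges to \<open>\<omega>\<close> iff there are time changes
  \<open>\<mu>\<^sub>n\<close> with \<open>\<mu>\<^sub>n(s) - s\<close> tending to \<open>0\<close> uniformly on \<open>[0,\<infinity>)\<close> and \<open>\<omega>\<^sub>n \<circ> \<mu>\<^sub>n - \<omega>\<close> tending
  to \<open>0\<close> uniformly on \<open>[0,N]\<close> for each \<open>N\<close>. As the topology is metrizable, it is determined by its
  convergent sequences, and its open sets are those containing, with each of their points
  \<open>\<omega>\<close>, some \<open>skorohod_nbhd \<omega> \<epsilon> N\<close>.\<close>

definition skorohod :: "(real \<Rightarrow> 'a::real_normed_vector) topology" where
  "skorohod = topology (\<lambda>U. U \<subseteq> D0 \<and> (\<forall>\<omega>\<in>U. \<exists>\<epsilon>>0. \<exists>N. skorohod_nbhd \<omega> \<epsilon> N \<subseteq> U))"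

lemma skorohod_nbhd_mono:
  assumes "\<epsilon> \<le> \<epsilon>'" "N' \<le> N"
  shows "skorohod_nbhd \<omega> \<epsilon> N \<subseteq> skorohod_nbhd \<omega> \<epsilon>' N'"
proof
  fix \<eta> assume "\<eta> \<in> skorohod_nbhd \<omega> \<epsilon> N"
  then obtain \<mu> where \<mu>: "\<eta> \<in> D0" "time_change \<mu>"
    and 1: "\<And>s. s \<ge> 0 \<Longrightarrow> \<bar>\<mu> s - s\<bar> < \<epsilon>"
    and 2: "\<And>s. s \<in> {0..N} \<Longrightarrow> norm (\<eta> (\<mu> s) - \<omega> s) < \<epsilon>"
    unfolding skorohod_nbhd_def by blast
  have "\<forall>s\<ge>0. \<bar>\<mu> s - s\<bar> < \<epsilon>'"
    using 1 assms(1) by (meson less_le_trans)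
  moreover have "norm (\<eta> (\<mu> s) - \<omega> s) < \<epsilon>'" if "s \<in> {0..N'}" for s
    using 2[of s] that assms by simp
  ultimately show "\<eta> \<in> skorohod_nbhd \<omega> \<epsilon>' N'"
    using \<mu> unfolding skorohod_nbhd_def by blast
qed

lemma openin_skorohod:
  fixes U :: "(real \<Rightarrow> 'a::real_normed_vector) set"
  shows
  "openin skorohod U \<longleftrightarrow> U \<subseteq> D0 \<and> (\<forall>\<omega>\<in>U. \<exists>\<epsilon>>0. \<exists>N. skorohod_nbhd \<omega> \<epsilon> N \<subseteq> U)"
proof -
  let ?P = "\<lambda>U :: (real \<Rightarrow> 'a) set. U \<subseteq> D0 \<and> (\<forall>\<omega>\<in>U. \<exists>\<epsilon>>0. \<exists>N. skorohod_nbhd \<omega> \<epsilon> N \<subseteq> U)"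
  have "istopology ?P"
    unfolding istopology_def
  proof (intro conjI allI impI ballI)
    fix S T :: "(real \<Rightarrow> 'a) set" and \<omega>
    assume S: "?P S" and T: "?P T" and \<omega>: "\<omega> \<in> S \<inter> T"
    from S \<omega> obtain e1 N1 where 1: "e1 > 0" "skorohod_nbhd \<omega> e1 N1 \<subseteq> S" by blast
    from T \<omega> obtain e2 N2 where 2: "e2 > 0" "skorohod_nbhd \<omega> e2 N2 \<subseteq> T" by blast
    have "skorohod_nbhd \<omega> (min e1 e2) (max N1 N2) \<subseteq> S \<inter> T"
      using 1 2 skorohod_nbhd_mono[of "min e1 e2" e1 N1 "max N1 N2" \<omega>]
        skorohod_nbhd_mono[of "min e1 e2" e2 N2 "max N1 N2" \<omega>] by auto
    moreover have "min e1 e2 > 0" using 1 2 by simp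
    ultimately show "\<exists>\<epsilon>>0. \<exists>N. skorohod_nbhd \<omega> \<epsilon> N \<subseteq> S \<inter> T" by blast
  next
    fix K :: "(real \<Rightarrow> 'a) set set" and \<omega>
    assume K: "\<forall>U\<in>K. ?P U" and \<omega>: "\<omega> \<in> \<Union>K"
    then obtain U where "U \<in> K" "\<omega> \<in> U" by blast
    with K obtain e N where "e > 0" "skorohod_nbhd \<omega> e N \<subseteq> U" by meson
    with \<open>U \<in> K\<close> show "\<exists>\<epsilon>>0. \<exists>N. skorohod_nbhd \<omega> \<epsilon> N \<subseteq> \<Union>K" by blast
  qed blast+
  then show ?thesis
    by (simp add: skorohod_def topology_inverse')
qed

lemma topspace_skorohod: "topspace skorohod = D0"
proof
  show "topspace skorohod \<subseteq> D0"
    using openin_skorohod openin_topspace by blast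
  have "skorohod_nbhd \<omega> 1 0 \<subseteq> D0" for \<omega> :: "real \<Rightarrow> 'a"
    by (auto simp: skorohod_nbhd_def)
  then have "openin skorohod (D0 :: (real \<Rightarrow> 'a) set)"
    unfolding openin_skorohod using zero_less_one by blast
  then show "(D0 :: (real \<Rightarrow> 'a) set) \<subseteq> topspace skorohod"
    by (rule openin_subset)
qed

definition skorohod_borel :: "(real \<Rightarrow> 'a::real_normed_vector) measure" where
  "skorohod_borel = sigma D0 {U. openin skorohod U}"

definition weakly_converges ::
  "'b topology \<Rightarrow> ('i \<Rightarrow> 'b measure) \<Rightarrow> 'b measure \<Rightarrow> 'i filter \<Rightarrow> bool" where
  "weakly_converges T N N' F \<longleftrightarrow>
     (\<forall>f::'b \<Rightarrow> real. continuous_map T euclideanreal f \<and> bounded (f ` topspace T) \<longrightarrow>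
        ((\<lambda>i. \<integral>\<omega>. f \<omega> \<partial>N i) \<longlongrightarrow> (\<integral>\<omega>. f \<omega> \<partial>N')) F)"

definition independent_increments ::
  "'w measure \<Rightarrow> (real \<Rightarrow> 'w \<Rightarrow> 'a::euclidean_space) \<Rightarrow> bool" where
  "independent_increments M X \<longleftrightarrow>
     (\<forall>(n::nat) (t::nat \<Rightarrow> real). 0 \<le> t 0 \<and> (\<forall>i<n. t i \<le> t (Suc i)) \<longrightarrow>
        prob_space.indep_vars M (\<lambda>_. borel)
          (\<lambda>i \<omega>. X (t (Suc i)) \<omega> - X (t i) \<omega>) {..<n})"

definition levy_process ::
  "'w measure \<Rightarrow> (real \<Rightarrow> 'w \<Rightarrow> 'a::euclidean_space) \<Rightarrow> bool" where
  "levy_process M X \<longleftrightarrow>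
     prob_space M \<and>
     (\<forall>t\<ge>0. X t \<in> borel_measurable M) \<and>
     (AE \<omega> in M. X 0 \<omega> = 0) \<and>
     independent_increments M X \<and>
     (\<forall>s\<ge>0. \<forall>t\<ge>0. distr M borel (\<lambda>\<omega>. X (s + t) \<omega> - X s \<omega>) = distr M borel (X t)) \<and>
     (AE \<omega> in M. cadlag (\<lambda>t. X t \<omega>))"

definition brownian_motion :: "'w measure \<Rightarrow> (real \<Rightarrow> 'w \<Rightarrow> real) \<Rightarrow> bool" where
  "brownian_motion M B \<longleftrightarrow>
     prob_space M \<and>
     (\<forall>t\<ge>0. B t \<in> borel_measurable M) \<and>
     (AE \<omega> in M. B 0 \<omega> = 0) \<and>
     independent_increments M B \<and>
     (\<forall>s t. 0 \<le> s \<and> s < t \<longrightarrow>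
        distributed M lborel (\<lambda>\<omega>. B t \<omega> - B s \<omega>) (normal_density 0 (sqrt (t - s)))) \<and>
     (AE \<omega> in M. continuous_on {0..} (\<lambda>t. B t \<omega>))"

definition relativistic_levy_law ::
  "real \<Rightarrow> (real \<Rightarrow> 'a::euclidean_space) measure \<Rightarrow> bool" where
  "relativistic_levy_law m L \<longleftrightarrow>
     sets L = sets skorohod_borel \<and>
     levy_process L (\<lambda>t \<omega>. \<omega> t) \<and>
     (\<forall>\<xi>. \<forall>t\<ge>0. (CLINT \<omega>|L. iexp (\<xi> \<bullet> \<omega> t)) =
        complex_of_real (exp (- t * (sqrt ((norm \<xi>)\<^sup>2 + m\<^sup>2) - m))))"

definition hitting_time ::
  "(real \<Rightarrow> 'w \<Rightarrow> real) \<Rightarrow> real \<Rightarrow> real \<Rightarrow> 'w \<Rightarrow> real" where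
  "hitting_time B m t \<omega> = Inf {s. 0 < s \<and> B s \<omega> + m * s = t}"

text \<open>For \<open>m \<ge> 0\<close> and \<open>t \<ge> 0\<close> the set in \<open>hitting_time\<close> is almost surely nonempty. As a function
  of \<open>t\<close> the hitting time is only left-continuous for \<open>t > 0\<close>, so the law on \<open>D0\<close> is that of a
  modification \<open>V\<close> with paths in \<open>D0\<close>, which is unique up to indistinguishability.\<close>

definition inverse_gaussian_law ::
  "'w measure \<Rightarrow> (real \<Rightarrow> 'w \<Rightarrow> real) \<Rightarrow> real \<Rightarrow> (real \<Rightarrow> real) measure \<Rightarrow> bool" where
  "inverse_gaussian_law M B m N \<longleftrightarrow>
     (\<exists>V. V \<in> measurable M skorohod_borel \<and>
        (\<forall>t\<ge>0. AE \<omega> in M. V \<omega> t = hitting_time B m t \<omega>) \<and>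
        N = distr M skorohod_borel V)"

end

theory Submission
  imports Defs "HOL-Real_Asymp.Real_Asymp"
begin

text \<open>
  Neither part needs tightness.

  (i) Subordination writes the law of an increment of length \<open>t\<close> under \<open>\<lambda>\<^sup>m\<close> as a mixture of
  centred Gaussians whose mixing density is \<open>exp (m t - m\<^sup>2 r / 2) \<le> exp (m t)\<close> times the one for
  \<open>m = 0\<close>. Hence \<open>E\<^sup>m F \<le> exp (m N) E\<^sup>0 F\<close> for every nonnegative \<open>F\<close> that depends on finitely many
  coordinates up to time \<open>N\<close>. A continuous \<open>f\<close> is the decreasing limit, as \<open>N\<close> grows, of its suprema over
  all continuations beyond time \<open>N\<close> of discretized paths, so that \<open>limsup E\<^sup>m f \<le> E\<^sup>0 f\<close>;
  applying this to \<open>C + f\<close> and \<open>C - f\<close> gives convergence.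

  (ii) All \<open>\<nu>\<^sup>m\<close> live on the space of the Brownian motion, and the hitting time processes converge
  almost surely in the Skorohod topology. Almost surely the maxima of \<open>B\<close> over disjoint intervals with rational
  endpoints differ, so each jump of the process for \<open>m = 0\<close> is matched by a single jump of the process for small
  \<open>m\<close>; monotonicity takes care of the rest.
\<close>

section \<open>Time changes and Skorohod neighbourhoods\<close>

text \<open>In (i) the comparison of laws is one-sided and its constant grows with the horizon
  \<open>N\<close>, so it gives nothing on the whole half-line; and cutting a path at time
  \<open>N\<close> is not continuous for the Skorohod topology, since paths may jump at
  \<open>N\<close>. The supremum over continuations bounds \<open>f\<close> by a functional of the
  path up to \<open>N\<close>, from above only, which is all that a one-sided comparison can use.
  The constant \<open>exp (m * N)\<close> does not see the mesh: \<open>K\<close> steps of length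
  \<open>\<delta>\<close> cost \<open>exp (m * \<delta>)\<close> each. So the mesh is refined with
  \<open>N\<close> fixed, and \<open>m\<close> tends to zero last. In (ii) pointwise convergence of
  monotone paths is too weak: one jump of the limit might be approximated by two smaller jumps at
  nearby levels. For hitting times this happens if the Brownian path reaches a level, falls, and
  returns exactly to it before exceeding it, because a small drift then lifts the second peak above
  the first. Distinct maxima exclude this. The inverse Gaussian density enters (i) only, as a mixing
  density; (ii) works with the hitting times themselves.\<close>

lemma time_change_mult: "time_change (\<lambda>s. c * s)" if "c > 0"
proof -
  have "bij_betw (\<lambda>s. c * s) {0..} {0..}"
    by (rule bij_betw_byWitness[where f' = "\<lambda>s. s / c"]) (use that in auto)
  then show ?thesis
    using that by (auto simp: time_change_def strict_mono_on_def)
qed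

lemma time_change_id: "time_change (\<lambda>s. s)"
  using time_change_mult[of 1] by simp

lemma time_change_nonneg: "time_change \<mu> \<Longrightarrow> s \<ge> 0 \<Longrightarrow> \<mu> s \<ge> 0"
  by (auto simp: time_change_def bij_betw_def)

lemma time_change_less: "time_change \<mu> \<Longrightarrow> 0 \<le> s \<Longrightarrow> s < t \<Longrightarrow> \<mu> s < \<mu> t"
  by (auto simp: time_change_def strict_mono_on_def)

lemma time_change_le: "time_change \<mu> \<Longrightarrow> 0 \<le> s \<Longrightarrow> s \<le> t \<Longrightarrow> \<mu> s \<le> \<mu> t"
  using time_change_less[of \<mu> s t] by (cases "s = t") auto

lemma time_change_zero:
  assumes "time_change \<mu>" shows "\<mu> 0 = 0"
proof -
  obtain s where "s \<ge> 0" "\<mu> s = 0"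
    using assms unfolding time_change_def bij_betw_def by (metis atLeast_iff image_iff order_refl)
  then show ?thesis
    using time_change_le[OF assms, of 0 s] time_change_nonneg[OF assms, of 0] by simp
qed

lemma time_change_surj:
  assumes "time_change \<mu>" "y \<ge> 0" obtains s where "s \<ge> 0" "\<mu> s = y"
  using assms unfolding time_change_def bij_betw_def by (metis atLeast_iff image_iff)

text \<open>A time change starts from zero, so \<open>\<rho>\<close> can be attached at the point
  \<open>a\<close>; time changes are assembled this way one interval at a time.\<close>

lemma time_change_glue:
  assumes \<mu>: "time_change \<mu>" and \<rho>: "time_change \<rho>" and a: "a \<ge> 0"
  shows "time_change (\<lambda>s. if s \<le> a then \<mu> s else \<mu> a + \<rho> (s - a))" (is "time_change ?g")
proof -
  have mono: "?g s < ?g t" if "0 \<le> s" "s < t" for s t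
  proof -
    consider "t \<le> a" | "s \<le> a" "a < t" | "a < s" by linarith
    then show ?thesis
    proof cases
      case 2
      have "\<mu> s \<le> \<mu> a" using time_change_le[OF \<mu>] 2 that by auto
      moreover have "0 < \<rho> (t - a)"
        using time_change_less[OF \<rho>, of 0 "t - a"] time_change_zero[OF \<rho>] 2 by simp
      ultimately show ?thesis using 2 by simp
    qed (use that time_change_less[OF \<mu>] time_change_less[OF \<rho>] in auto)
  qed
  have "strict_mono_on {0..} ?g"
    using mono by (auto simp: strict_mono_on_def)
  moreover have "?g ` {0..} = {0..}"
  proof (intro equalityI subsetI)
    fix y assume "y \<in> ?g ` {0..}"
    then show "y \<in> {0..}"
      using time_change_nonneg[OF \<mu>] time_change_nonneg[OF \<rho>] a by (force intro!: add_nonneg_nonneg)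
  next
    fix y :: real assume y: "y \<in> {0..}"
    show "y \<in> ?g ` {0..}"
    proof (cases "y \<le> \<mu> a")
      case True
      obtain s where s: "s \<ge> 0" "\<mu> s = y" using time_change_surj[OF \<mu>, of y] y by auto
      then have "s \<le> a" using True time_change_less[OF \<mu> a, of s] by (meson linorder_not_le)
      then show ?thesis using s by (intro image_eqI[of _ _ s]) auto
    next
      case False
      obtain s where s: "s \<ge> 0" "\<rho> s = y - \<mu> a" using time_change_surj[OF \<rho>, of "y - \<mu> a"] False by auto
      then have "s > 0" using False time_change_zero[OF \<rho>] by (cases "s = 0") auto
      then show ?thesis using s a by (intro image_eqI[of _ _ "s + a"]) auto
    qed
  qed
  ultimately show ?thesis
    by (simp add: time_change_def bij_betw_def strict_mono_on_imp_inj_on)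
qed

section \<open>Partitions of small oscillation and a criterion for Skorohod convergence\<close>

inductive osc_partition :: "(real \<Rightarrow> 'a::metric_space) \<Rightarrow> real \<Rightarrow> real \<Rightarrow> real \<Rightarrow> bool"
  for \<omega> \<delta> a where
  osc_refl: "osc_partition \<omega> \<delta> a a"
| osc_step: "osc_partition \<omega> \<delta> a b \<Longrightarrow> b < c \<Longrightarrow>
    (\<And>u v. u \<in> {b..<c} \<Longrightarrow> v \<in> {b..<c} \<Longrightarrow> dist (\<omega> u) (\<omega> v) < \<delta>) \<Longrightarrow> osc_partition \<omega> \<delta> a c"

lemma osc_partition_le: "osc_partition \<omega> \<delta> a b \<Longrightarrow> a \<le> b"
  by (induction rule: osc_partition.induct) auto

lemma osc_partition_trans:
  assumes "osc_partition \<omega> \<delta> b c" "osc_partition \<omega> \<delta> a b"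
  shows "osc_partition \<omega> \<delta> a c"
  using assms
proof (induction rule: osc_partition.induct)
  case (osc_step b' c)
  show ?case by (rule osc_partition.osc_step[OF osc_step.IH[OF osc_step.prems] osc_step.hyps(2,3)])
qed

lemma osc_partition_single:
  assumes "a \<le> b" "\<And>u. u \<in> {a..<b} \<Longrightarrow> dist (\<omega> u) l < \<delta> / 2"
  shows "osc_partition \<omega> \<delta> a b"
proof (cases "a = b")
  case False
  show ?thesis
  proof (rule osc_partition.osc_step[OF osc_partition.osc_refl])
    fix u v assume "u \<in> {a..<b}" "v \<in> {a..<b}"
    then show "dist (\<omega> u) (\<omega> v) < \<delta>"
      using assms(2)[of u] assms(2)[of v] by (metis \<open>u \<in> _\<close> \<open>v \<in> _\<close> dist_triangle_half_l)
  qed (use False assms in auto)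
qed (auto intro: osc_partition.osc_refl)

text \<open>Near each time the two one-sided limits bound the oscillation on either side, and
  compactness of \<open>{0..M}\<close> patches such intervals together. They are half-open because
  the value at a jump belongs to the interval on its right.\<close>

lemma cadlag_osc_partition:
  fixes \<omega> :: "real \<Rightarrow> 'a::metric_space"
  assumes "cadlag \<omega>" "\<delta> > 0" "M \<ge> 0"
  shows "osc_partition \<omega> \<delta> 0 M"
proof -
  \<comment> \<open>The guard \<open>0 \<le> a\<close> is there because the bisection also looks at
    intervals that reach from 0 into negative times, where \<open>cadlag\<close> says
    nothing.\<close>
  define P where "P a b \<longleftrightarrow> (0 \<le> a \<longrightarrow> osc_partition \<omega> \<delta> a b)" for a b
  have "P 0 M"
    using \<open>M \<ge> 0\<close>
  proof (induction rule: Bolzano)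
    case (trans a b c)
    then show ?case unfolding P_def by (meson order_trans osc_partition_trans)
  next
    case (local x)
    have "((\<omega> \<longlongrightarrow> \<omega> x) (at_right x))" using assms local by (auto simp: cadlag_def)
    then have "eventually (\<lambda>u. dist (\<omega> u) (\<omega> x) < \<delta> / 2) (at_right x)"
      using \<open>\<delta> > 0\<close> by (intro tendstoD) auto
    then obtain b where b: "b > x" "\<And>u. u > x \<Longrightarrow> u < b \<Longrightarrow> dist (\<omega> u) (\<omega> x) < \<delta> / 2"
      by (auto simp: eventually_at_right_field)
    have right: "osc_partition \<omega> \<delta> x v" if "x \<le> v" "v < b" for v
    proof (rule osc_partition_single[where l = "\<omega> x"])
      fix u assume "u \<in> {x..<v}" then show "dist (\<omega> u) (\<omega> x) < \<delta> / 2"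
        using b that \<open>\<delta> > 0\<close> by (cases "u = x") auto
    qed (use that in auto)
    show ?case
    proof (cases "x = 0")
      case True
      then have "\<forall>a b'. a \<le> x \<and> x \<le> b' \<and> b' - a < b - x \<longrightarrow> P a b'"
        using right unfolding P_def by auto
      then show ?thesis using b by (intro exI[of _ "b - x"]) auto
    next
      case False
      then obtain l where "(\<omega> \<longlongrightarrow> l) (at_left x)" using assms local by (force simp: cadlag_def)
      then have "eventually (\<lambda>u. dist (\<omega> u) l < \<delta> / 2) (at_left x)"
        using \<open>\<delta> > 0\<close> by (intro tendstoD) auto
      then obtain c where c: "c < x" "\<And>u. u > c \<Longrightarrow> u < x \<Longrightarrow> dist (\<omega> u) l < \<delta> / 2"
        by (auto simp: eventually_at_left_field)
      have left: "osc_partition \<omega> \<delta> v x" if "v \<le> x" "v > c" for v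
        by (rule osc_partition_single[where l = l]) (use that c in auto)
      have "\<forall>a b'. a \<le> x \<and> x \<le> b' \<and> b' - a < min (b - x) (x - c) \<longrightarrow> P a b'"
        unfolding P_def
      proof (intro allI impI)
        fix a b' assume *: "a \<le> x \<and> x \<le> b' \<and> b' - a < min (b - x) (x - c)" "0 \<le> a"
        show "osc_partition \<omega> \<delta> a b'"
          by (rule osc_partition_trans[OF right left]) (use * in auto)
      qed
      then show ?thesis using b c by (intro exI[of _ "min (b - x) (x - c)"]) auto
    qed
  qed
  then show ?thesis by (simp add: P_def)
qed

text \<open>On a linear piece of a time change the deviation from the identity interpolates between
  its end values \<open>p\<close> and \<open>q\<close>.\<close>

lemma affine_deviation_le:
  fixes p q :: real
  assumes "\<bar>p\<bar> < \<epsilon>" "\<bar>q\<bar> < \<epsilon>" "0 \<le> \<theta>" "\<theta> \<le> 1"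
  shows "\<bar>p + \<theta> * (q - p)\<bar> < \<epsilon>"
proof -
  have "p + \<theta> * (q - p) = (1 - \<theta>) *\<^sub>R p + \<theta> *\<^sub>R q" by (simp add: algebra_simps)
  moreover have "convex (ball (0::real) \<epsilon>)" by simp
  ultimately have "p + \<theta> * (q - p) \<in> ball 0 \<epsilon>"
    using assms by (metis convex_alt dist_0_norm mem_ball real_norm_def)
  then show ?thesis by simp
qed

text \<open>The convergence criterion behind both parts. The map \<open>\<sigma> n\<close> need not
  be a time change: it is evaluated only at the points of a partition on which
  \<open>\<omega>\<close> oscillates little, and interpolated linearly between them, by induction
  along the partition. \<open>near\<close> asks that \<open>\<eta> n\<close>, between the images of
  two consecutive points, stays close to \<open>\<omega>\<close>; the factor 3 leaves room for the
  error terms in the application to hitting times.\<close>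

lemma skorohod_nbhd_eventually:
  fixes \<omega> :: "real \<Rightarrow> 'a::real_normed_vector" and \<sigma> :: "nat \<Rightarrow> real \<Rightarrow> real"
  assumes \<omega>: "\<omega> \<in> D0" and \<eta>: "\<And>n. \<eta> n \<in> D0"
    and \<sigma>0: "\<And>n. \<sigma> n 0 = 0" and \<sigma>: "\<And>t. t \<ge> 0 \<Longrightarrow> (\<lambda>n. \<sigma> n t) \<longlonglongrightarrow> t"
    and near: "\<And>\<delta> s t. \<delta> > 0 \<Longrightarrow> 0 \<le> s \<Longrightarrow> s < t \<Longrightarrow>
      (\<And>u v. u \<in> {s..<t} \<Longrightarrow> v \<in> {s..<t} \<Longrightarrow> dist (\<omega> u) (\<omega> v) < \<delta>) \<Longrightarrow>
      eventually (\<lambda>n. \<forall>u\<in>{\<sigma> n s..<\<sigma> n t}. \<forall>v\<in>{s..<t}. dist (\<eta> n u) (\<omega> v) < 3 * \<delta>) sequentially"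
    and "\<epsilon> > 0"
  shows "eventually (\<lambda>n. \<eta> n \<in> skorohod_nbhd \<omega> \<epsilon> M) sequentially"
proof -
  \<comment> \<open>From \<open>b\<close> on the slope is one, so the deviation from the identity
    keeps its value at \<open>b\<close> and the bound \<open>\<epsilon>\<close> holds at all later
    times. The next interval replaces this tail by a linear piece.\<close>
  define good where "good n b \<longleftrightarrow> (\<exists>\<mu>. time_change \<mu> \<and> \<mu> b = \<sigma> n b \<and>
    (\<forall>s\<ge>0. \<bar>\<mu> s - s\<bar> < \<epsilon>) \<and> (\<forall>s\<in>{0..<b}. dist (\<eta> n (\<mu> s)) (\<omega> s) < \<epsilon>) \<and>
    (\<forall>s\<ge>b. \<mu> s = \<mu> b + (s - b)))" for n b
  have extend: "good n c" if "good n b" "0 \<le> b" "b < c" "\<sigma> n b < \<sigma> n c" "\<bar>\<sigma> n b - b\<bar> < \<epsilon>"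
    "\<bar>\<sigma> n c - c\<bar> < \<epsilon>" and d: "\<forall>u\<in>{\<sigma> n b..<\<sigma> n c}. \<forall>v\<in>{b..<c}. dist (\<eta> n u) (\<omega> v) < 3 * (\<epsilon> / 3)" for n b c
  proof -
    obtain \<mu> where \<mu>: "time_change \<mu>" "\<mu> b = \<sigma> n b" "\<And>s. s \<ge> 0 \<Longrightarrow> \<bar>\<mu> s - s\<bar> < \<epsilon>"
      "\<And>s. s \<in> {0..<b} \<Longrightarrow> dist (\<eta> n (\<mu> s)) (\<omega> s) < \<epsilon>"
      using \<open>good n b\<close> unfolding good_def by blast
    define r where "r = (\<sigma> n c - \<sigma> n b) / (c - b)"
    have "r > 0" using that by (simp add: r_def)
    \<comment> \<open>The slope \<open>r\<close> carries the interval from \<open>b\<close> to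
      \<open>c\<close> onto the one from \<open>\<sigma> n b\<close> to \<open>\<sigma> n c\<close>;
      afterwards the slope is one again.\<close>
    define \<rho> where "\<rho> s = (if s \<le> c - b then r * s else r * (c - b) + (s - (c - b)))" for s
    have \<rho>: "time_change \<rho>"
      unfolding \<rho>_def by (rule time_change_glue[OF time_change_mult time_change_id]) (use that \<open>r > 0\<close> in auto)
    define \<kappa> where "\<kappa> s = (if s \<le> b then \<mu> s else \<mu> b + \<rho> (s - b))" for s
    have \<kappa>: "time_change \<kappa>"
      unfolding \<kappa>_def by (rule time_change_glue[OF \<mu>(1) \<rho>]) (use that in auto)
    have rc: "r * (c - b) = \<sigma> n c - \<sigma> n b" using that by (simp add: r_def)
    have \<kappa>c: "\<kappa> c = \<sigma> n c" using that \<mu>(2) rc by (simp add: \<kappa>_def \<rho>_def)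
    have \<kappa>b: "\<kappa> b = \<sigma> n b" by (simp add: \<kappa>_def \<mu>)
    have after: "\<kappa> s = \<kappa> c + (s - c)" if "s \<ge> c" for s
      using that \<open>b < c\<close> rc \<kappa>c \<mu>(2) by (cases "s = c") (simp_all add: \<kappa>_def \<rho>_def)
    have "\<bar>\<kappa> s - s\<bar> < \<epsilon>" if "s \<ge> 0" for s
    proof -
      consider "s \<le> b" | "b < s" "s \<le> c" | "c < s" by linarith
      then show ?thesis
      proof cases
        case 1 then show ?thesis using \<mu>(3) that by (simp add: \<kappa>_def)
      next
        case 2
        have "\<bar>(\<sigma> n b - b) + ((s - b) / (c - b)) * ((\<sigma> n c - c) - (\<sigma> n b - b))\<bar> < \<epsilon>"
          by (rule affine_deviation_le) (use \<open>\<bar>\<sigma> n b - b\<bar> < \<epsilon>\<close> \<open>\<bar>\<sigma> n c - c\<bar> < \<epsilon>\<close> 2 in auto)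
        also have "(\<sigma> n b - b) + ((s - b) / (c - b)) * ((\<sigma> n c - c) - (\<sigma> n b - b)) = \<kappa> s - s"
          using 2 \<mu>(2) \<open>b < c\<close> by (simp add: \<kappa>_def \<rho>_def r_def field_simps)
        finally show ?thesis .
      next
        case 3 then show ?thesis using after[of s] \<kappa>c \<open>\<bar>\<sigma> n c - c\<bar> < \<epsilon>\<close> by simp
      qed
    qed
    moreover have "dist (\<eta> n (\<kappa> s)) (\<omega> s) < \<epsilon>" if "s \<in> {0..<c}" for s
    proof (cases "s < b")
      case True then show ?thesis using \<mu>(4) that by (simp add: \<kappa>_def)
    next
      case False
      then have "\<kappa> b \<le> \<kappa> s" "\<kappa> s < \<kappa> c"
        using time_change_le[OF \<kappa> \<open>0 \<le> b\<close>] time_change_less[OF \<kappa>] that by auto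
      then have "\<kappa> s \<in> {\<sigma> n b..<\<sigma> n c}" by (simp add: \<kappa>b \<kappa>c)
      then show ?thesis using d False that by auto
    qed
    ultimately show ?thesis
      unfolding good_def using \<kappa> \<kappa>c after by blast
  qed
  have "eventually (\<lambda>n. good n b) sequentially" if "osc_partition \<omega> (\<epsilon> / 3) 0 b" for b
    using that
  proof (induction rule: osc_partition.induct)
    case osc_refl
    have "good n 0" for n
      unfolding good_def using time_change_id \<open>\<epsilon> > 0\<close> \<sigma>0 by (intro exI[of _ "\<lambda>s. s"]) auto
    then show ?case by simp
  next
    case (osc_step b c)
    have "0 \<le> b" using osc_step(1) osc_partition_le by blast
    \<comment> \<open>Errors below half of \<open>c - b\<close> at both ends keep
      \<open>\<sigma> n b < \<sigma> n c\<close>, so that the linear piece is increasing.\<close>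
    have b: "eventually (\<lambda>n. \<bar>\<sigma> n b - b\<bar> < min \<epsilon> ((c - b) / 2)) sequentially"
      using tendstoD[OF \<sigma>[OF \<open>0 \<le> b\<close>], of "min \<epsilon> ((c - b) / 2)"] \<open>\<epsilon> > 0\<close> \<open>b < c\<close>
      by (simp add: dist_real_def)
    have c: "eventually (\<lambda>n. \<bar>\<sigma> n c - c\<bar> < min \<epsilon> ((c - b) / 2)) sequentially"
      using tendstoD[OF \<sigma>[of c], of "min \<epsilon> ((c - b) / 2)"] \<open>\<epsilon> > 0\<close> \<open>b < c\<close> \<open>0 \<le> b\<close>
      by (simp add: dist_real_def)
    have "eventually (\<lambda>n. \<forall>u\<in>{\<sigma> n b..<\<sigma> n c}. \<forall>v\<in>{b..<c}. dist (\<eta> n u) (\<omega> v) < 3 * (\<epsilon> / 3)) sequentially"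
      by (rule near) (use osc_step \<open>0 \<le> b\<close> \<open>\<epsilon> > 0\<close> in auto)
    with osc_step.IH b c show ?case
    proof eventually_elim
      case (elim n)
      have "\<bar>\<sigma> n b - b\<bar> < (c - b) / 2" "\<bar>\<sigma> n c - c\<bar> < (c - b) / 2"
        using elim(2,3) by simp_all
      then have "\<sigma> n b - b < (c - b) / 2" "c - \<sigma> n c < (c - b) / 2"
        by (auto simp only: abs_less_iff minus_diff_eq)
      then have "\<sigma> n b < \<sigma> n c" by (simp add: field_simps)
      then show ?case
        using elim \<open>b < c\<close> \<open>0 \<le> b\<close> by (intro extend[of n b c]) simp_all
    qed
  qed
  \<comment> \<open>\<open>M\<close> may be negative, and the intervals are half-open: the extra
    unit of time brings \<open>M\<close> itself into the range covered.\<close>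
  moreover have "osc_partition \<omega> (\<epsilon> / 3) 0 (max M 0 + 1)"
    using \<omega> \<open>\<epsilon> > 0\<close> by (intro cadlag_osc_partition) (auto simp: D0_def)
  ultimately have "eventually (\<lambda>n. good n (max M 0 + 1)) sequentially" by blast
  then show ?thesis
  proof eventually_elim
    case (elim n)
    then obtain \<mu> where "time_change \<mu>" "\<forall>s\<ge>0. \<bar>\<mu> s - s\<bar> < \<epsilon>"
      "\<forall>s\<in>{0..<max M 0 + 1}. dist (\<eta> n (\<mu> s)) (\<omega> s) < \<epsilon>"
      unfolding good_def by blast
    moreover have "norm (\<eta> n (\<mu> s) - \<omega> s) < \<epsilon>" if "s \<in> {0..M}" for s
      using that calculation(3) by (simp add: dist_norm)
    ultimately show ?case using \<eta>[of n] unfolding skorohod_nbhd_def by blast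
  qed
qed

section \<open>Continuous functionals on Skorohod space\<close>

lemma continuous_map_skorohodD:
  fixes f :: "(real \<Rightarrow> 'a::real_normed_vector) \<Rightarrow> real"
  assumes f: "continuous_map skorohod euclideanreal f" and \<omega>: "\<omega> \<in> D0" and "e > 0"
  obtains \<delta> N where "\<delta> > 0" "\<And>\<eta>. \<eta> \<in> skorohod_nbhd \<omega> \<delta> N \<Longrightarrow> \<bar>f \<eta> - f \<omega>\<bar> < e"
proof -
  have "openin skorohod {\<eta> \<in> topspace skorohod. f \<eta> \<in> ball (f \<omega>) e}"
    by (rule openin_continuous_map_preimage[OF f]) (simp add: open_openin[symmetric])
  moreover have "\<omega> \<in> {\<eta> \<in> topspace skorohod. f \<eta> \<in> ball (f \<omega>) e}"
    using \<omega> \<open>e > 0\<close> by (simp add: topspace_skorohod)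
  ultimately obtain \<delta> N where "\<delta> > 0" "skorohod_nbhd \<omega> \<delta> N \<subseteq> {\<eta> \<in> topspace skorohod. f \<eta> \<in> ball (f \<omega>) e}"
    unfolding openin_skorohod by blast
  then show ?thesis
    by (intro that[of \<delta> N]) (auto simp: dist_real_def abs_minus_commute)
qed

lemma continuous_map_skorohod_tendsto:
  fixes f :: "(real \<Rightarrow> 'a::real_normed_vector) \<Rightarrow> real"
  assumes "continuous_map skorohod euclideanreal f" "\<omega> \<in> D0"
    and "\<And>\<delta> N. \<delta> > 0 \<Longrightarrow> eventually (\<lambda>n. \<eta> n \<in> skorohod_nbhd \<omega> \<delta> N) F"
  shows "((\<lambda>n. f (\<eta> n)) \<longlongrightarrow> f \<omega>) F"
proof (rule tendstoI)
  fix e :: real assume "e > 0"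
  obtain \<delta> N where *: "\<delta> > 0" "\<And>\<eta>. \<eta> \<in> skorohod_nbhd \<omega> \<delta> N \<Longrightarrow> \<bar>f \<eta> - f \<omega>\<bar> < e"
    using continuous_map_skorohodD[OF assms(1,2) \<open>e > 0\<close>] by blast
  show "eventually (\<lambda>n. dist (f (\<eta> n)) (f \<omega>) < e) F"
    using assms(3)[OF *(1), of N] by eventually_elim (simp add: dist_real_def *(2))
qed

lemma space_skorohod_borel [simp]: "space skorohod_borel = D0"
  unfolding skorohod_borel_def
  by (rule space_measure_of) (use openin_skorohod in auto)

lemma borel_measurable_skorohod:
  fixes f :: "(real \<Rightarrow> 'a::real_normed_vector) \<Rightarrow> real"
  assumes f: "continuous_map skorohod euclideanreal f"
  shows "f \<in> borel_measurable skorohod_borel"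
proof (rule borel_measurableI)
  fix S :: "real set" assume "open S"
  then have "openin skorohod {\<eta> \<in> topspace skorohod. f \<eta> \<in> S}"
    by (intro openin_continuous_map_preimage[OF f]) (simp add: open_openin[symmetric])
  moreover have "f -` S \<inter> space skorohod_borel = {\<eta> \<in> topspace skorohod. f \<eta> \<in> S}"
    by (auto simp: topspace_skorohod)
  moreover have "{U :: (real \<Rightarrow> 'a) set. openin skorohod U} \<subseteq> Pow D0"
    using openin_skorohod by auto
  ultimately show "f -` S \<inter> space skorohod_borel \<in> sets skorohod_borel"
    unfolding skorohod_borel_def by (simp add: sets_measure_of)
qed

section \<open>Convergence of hitting time processes along a path\<close>

text \<open>This says that \<open>W t\<close> is the infimum of the times \<open>s \<ge> 0\<close>
  with \<open>x s > t\<close>: the first clause makes it a lower bound, the second the greatest one.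
  The strict inequality gives the right-continuous inverse, while first hitting times give the
  left-continuous one.\<close>

definition right_inverse_path :: "(real \<Rightarrow> real) \<Rightarrow> (real \<Rightarrow> real) \<Rightarrow> bool" where
  "right_inverse_path x W \<longleftrightarrow> (\<forall>t\<ge>0.
     (\<forall>s\<ge>0. x s > t \<longrightarrow> W t \<le> s) \<and>
     (\<forall>s. W t < s \<longrightarrow> (\<exists>s'. 0 \<le> s' \<and> s' < s \<and> x s' > t)))"

lemma right_inverse_pathD1: "right_inverse_path x W \<Longrightarrow> t \<ge> 0 \<Longrightarrow> s \<ge> 0 \<Longrightarrow> x s > t \<Longrightarrow> W t \<le> s"
  by (auto simp: right_inverse_path_def)

lemma right_inverse_pathD2:
  assumes "right_inverse_path x W" "t \<ge> 0" "W t < s"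
  obtains s' where "0 \<le> s'" "s' < s" "x s' > t"
  using assms unfolding right_inverse_path_def by blast

lemma right_inverse_path_mono:
  assumes "right_inverse_path x W" "0 \<le> s" "s \<le> t" shows "W s \<le> W t"
proof (rule ccontr)
  assume "\<not> W s \<le> W t"
  then obtain s' where "0 \<le> s'" "s' < W s" "x s' > t"
    using right_inverse_pathD2[OF assms(1), of t "W s"] assms by auto
  then show False using right_inverse_pathD1[OF assms(1), of s s'] assms by auto
qed

text \<open>Let \<open>a t\<close> be the first time at level \<open>t\<close>. The limit inverse
  jumps at \<open>t\<close> from \<open>a t\<close> to \<open>W t\<close>, and by
  \<open>peaks\<close> the path stays strictly below \<open>t\<close> in between. A small drift does
  not lift it to \<open>t\<close> on compact parts of that gap, so the perturbed inverse crosses the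
  whole gap, up to \<open>\<delta>\<close> at either end, at the single level
  \<open>\<sigma> n t\<close>. Between two such levels monotonicity squeezes it.\<close>

lemma right_inverse_path_drift_tendsto:
  fixes b :: "real \<Rightarrow> real" and m :: "nat \<Rightarrow> real"
  assumes W: "W \<in> D0" "right_inverse_path b W"
    and Wn: "\<And>n. Wn n \<in> D0" "\<And>n. right_inverse_path (\<lambda>s. b s + m n * s) (Wn n)"
    and m: "\<And>n. m n \<ge> 0" "m \<longlonglongrightarrow> 0"
    and cont: "continuous_on {0..} b" and b0: "b 0 = 0"
    and unb: "\<And>K. \<exists>s\<ge>0. b s > K"
    and peaks: "\<And>p q r u. p \<in> \<rat> \<Longrightarrow> q \<in> \<rat> \<Longrightarrow> r \<in> \<rat> \<Longrightarrow> u \<in> \<rat> \<Longrightarrow> 0 \<le> p \<Longrightarrow> p < q \<Longrightarrow> q < r \<Longrightarrow> r < u \<Longrightarrow>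
      Sup (b ` {p..q}) \<noteq> Sup (b ` {r..u})"
    and "\<epsilon> > 0"
  shows "eventually (\<lambda>n. Wn n \<in> skorohod_nbhd W \<epsilon> M) sequentially"
proof -
  have cont_sub: "continuous_on {p..q} b" if "p \<ge> 0" for p q
    using that by (intro continuous_on_subset[OF cont]) auto
  define a where "a t = Inf {s. 0 \<le> s \<and> b s \<ge> t}" for t
  have a: "0 \<le> a t" "b (a t) \<ge> t" for t
  proof -
    have "{s. 0 \<le> s \<and> b s \<ge> t} = {s \<in> {0..}. t \<le> b s}" by auto
    then have "closed {s. 0 \<le> s \<and> b s \<ge> t}"
      using continuous_closed_preimage[OF cont, of "{t..}"] by (simp add: vimage_def Int_def)
    moreover obtain s0 where "0 \<le> s0" "b s0 > t" using unb by blast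
    then have "s0 \<in> {s. 0 \<le> s \<and> b s \<ge> t}" by simp
    moreover have "bdd_below {s. 0 \<le> s \<and> b s \<ge> t}" by (intro bdd_belowI[of _ 0]) auto
    ultimately have "a t \<in> {s. 0 \<le> s \<and> b s \<ge> t}"
      unfolding a_def by (intro closed_contains_Inf) auto
    then show "0 \<le> a t" "b (a t) \<ge> t" by auto
  qed
  have a_le: "a t \<le> s" if "0 \<le> s" "b s \<ge> t" for s t
    unfolding a_def by (rule cInf_lower) (use that in \<open>auto intro!: bdd_belowI[of _ 0]\<close>)
  have W0: "W 0 = 0" using W by (simp add: D0_def)
  have W_ge: "a t \<le> W t" if "t \<ge> 0" for t
  proof (rule ccontr)
    assume "\<not> a t \<le> W t"
    then obtain s' where "0 \<le> s'" "s' < a t" "b s' > t"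
      using right_inverse_pathD2[OF W(2) \<open>t \<ge> 0\<close>, of "a t"] by auto
    then show False using a_le[of s' t] by auto
  qed
  have b_le: "b s \<le> t" if "0 \<le> s" "s < W t" "t \<ge> 0" for s t
    using right_inverse_pathD1[OF W(2), of t s] that by force
  have W_le_a: "W v \<le> a t" if "0 \<le> v" "v < t" for v t
    using right_inverse_pathD1[OF W(2), of v "a t"] a[of t] that by auto
  have ba: "b (a t) = t" if "t \<ge> 0" for t
  proof (rule antisym)
    show "b (a t) \<le> t"
    proof (rule ccontr)
      assume "\<not> b (a t) \<le> t"
      moreover have "a t > 0" using calculation b0 that a(1)[of t] by (cases "a t = 0") auto
      ultimately obtain s where "0 \<le> s" "s \<le> a t" "b s = t"
        using IVT'[of b 0 t "a t"] cont_sub[of 0 "a t"] b0 \<open>t \<ge> 0\<close> by auto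
      then show False using a_le[of s t] \<open>\<not> b (a t) \<le> t\<close> by auto
    qed
  qed (rule a)
  \<comment> \<open>A return to level \<open>t\<close> at \<open>s\<close> would make
    \<open>t\<close> the maximum over two disjoint rational intervals, one around \<open>a t\<close>
    and one around \<open>s\<close>, against \<open>peaks\<close>.\<close>
  have b_less: "b s < t" if ts: "t \<ge> 0" "a t < s" "s < W t" for s t
  proof (rule ccontr)
    assume "\<not> b s < t"
    then have bs: "b s = t" using b_le[of s t] that a(1)[of t] by simp
    \<comment> \<open>A rational interval around \<open>a t\<close> within positive times requires
      this. If \<open>a t = 0\<close> then the level is 0, and \<open>W 0 = 0\<close> leaves no room
      for \<open>s\<close>.\<close>
    have "a t > 0"
    proof (rule ccontr)
      assume "\<not> a t > 0"
      then have "a t = 0" using a(1)[of t] by simp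
      then have "t = 0" using ba[OF that(1)] b0 by simp
      then show False using that W0 \<open>a t = 0\<close> by simp
    qed
    obtain p where p: "p \<in> \<rat>" "0 < p" "p < a t" using Rats_dense_in_real \<open>a t > 0\<close> by blast
    obtain q where q: "q \<in> \<rat>" "a t < q" "q < s" using Rats_dense_in_real ts by blast
    obtain r where r: "r \<in> \<rat>" "q < r" "r < s" using Rats_dense_in_real q by blast
    obtain u where u: "u \<in> \<rat>" "s < u" "u < W t" using Rats_dense_in_real ts by blast
    have "Sup (b ` {p..q}) = t"
      using p q r u that ba[OF that(1)]
      by (intro cSup_eq_maximum) (auto intro!: b_le image_eqI[of _ _ "a t"])
    moreover have "Sup (b ` {r..u}) = t"
      using p q r u that bs by (intro cSup_eq_maximum) (auto intro!: b_le image_eqI[of _ _ s])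
    ultimately show False using peaks[of p q r u] p q r u by auto
  qed
  define mid where "mid t = (a t + W t) / 2" for t
  \<comment> \<open>The inverse of \<open>b\<close> jumps from \<open>a t\<close> to \<open>W t\<close> at level \<open>t\<close>; the level \<open>\<sigma> n t\<close> is the one at which the
    inverse of the perturbed path jumps across the midpoint.\<close>
  define \<sigma> where "\<sigma> n t = Sup ((\<lambda>s. b s + m n * s) ` {0..mid t})" for n t
  have mid: "a t \<le> mid t" "mid t \<le> W t" "0 \<le> mid t" if "t \<ge> 0" for t
    using W_ge[OF that] a(1)[of t] by (auto simp: mid_def)
  have b_mid: "b s \<le> t" if "t \<ge> 0" "0 \<le> s" "s \<le> mid t" for s t
  proof (cases "s < W t")
    case False
    then have "s = a t" using that mid[of t] W_ge[of t] by (simp add: mid_def)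
    then show ?thesis using ba that by simp
  qed (use b_le that in auto)
  have \<sigma>_ge: "\<sigma> n t \<ge> b s + m n * s" if "0 \<le> s" "s \<le> mid t" for n s t
  proof -
    have "compact ((\<lambda>s. b s + m n * s) ` {0..mid t})"
      by (intro compact_continuous_image continuous_intros cont_sub) auto
    then show ?thesis unfolding \<sigma>_def using that
      by (intro cSup_upper bounded_imp_bdd_above compact_imp_bounded) auto
  qed
  have \<sigma>_le: "\<sigma> n t \<le> y" if "t \<ge> 0" "\<And>s. 0 \<le> s \<Longrightarrow> s \<le> mid t \<Longrightarrow> b s + m n * s \<le> y" for n t y
    unfolding \<sigma>_def by (rule cSup_least) (use that mid(3)[of t] in auto)
  have \<sigma>_less: "\<exists>s. 0 \<le> s \<and> s \<le> mid t \<and> u < b s + m n * s" if "t \<ge> 0" "u < \<sigma> n t" for n t u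
    using that \<sigma>_le[of t n u] by (meson not_le)
  have \<sigma>_lower: "\<sigma> n t \<ge> b (a t) + m n * a t" "\<sigma> n t \<ge> t" if "t \<ge> 0" for n t
  proof -
    show "\<sigma> n t \<ge> b (a t) + m n * a t"
      by (intro \<sigma>_ge a mid that)
    moreover have "m n * a t \<ge> 0" using m(1) a(1) by simp
    ultimately show "\<sigma> n t \<ge> t" using ba[OF that] by simp
  qed
  have \<sigma>_upper: "\<sigma> n t \<le> t + m n * mid t" if "t \<ge> 0" for n t
    by (intro \<sigma>_le that add_mono b_mid mult_left_mono m) auto
  have \<sigma>_lim: "(\<lambda>n. \<sigma> n t) \<longlonglongrightarrow> t" if "t \<ge> 0" for t
  proof (rule tendsto_sandwich)
    show "(\<lambda>_::nat. t) \<longlonglongrightarrow> t" by simp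
    show "(\<lambda>n. t + m n * mid t) \<longlonglongrightarrow> t"
      using tendsto_add[OF tendsto_const[of t] tendsto_mult_left_zero[OF m(2), of "mid t"]] by simp
  qed (use \<sigma>_lower \<sigma>_upper that in auto)
  \<comment> \<open>On a compact part of the gap the path has a maximum below \<open>t\<close>, and
    the drift adds at most \<open>m n * q\<close>, which tends to zero.\<close>
  have gap: "eventually (\<lambda>n. \<forall>s\<in>{p..q}. b s + m n * s < t) sequentially"
    if "t \<ge> 0" "a t < p" "q < W t" for p q t
  proof (cases "p \<le> q")
    case True
    have "p \<ge> 0" using that a(1)[of t] by simp
    then obtain z where z: "z \<in> {p..q}" "\<And>s. s \<in> {p..q} \<Longrightarrow> b s \<le> b z"
      using continuous_attains_sup[of "{p..q}" b] cont_sub[of p q] True by auto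
    have "b z < t" using b_less[of t z] z(1) that by auto
    moreover have "(\<lambda>n. b z + m n * q) \<longlonglongrightarrow> b z"
      using tendsto_add[OF tendsto_const[of "b z"] tendsto_mult_left_zero[OF m(2), of q]] by simp
    ultimately have "eventually (\<lambda>n. b z + m n * q < t) sequentially"
      by (metis order_tendstoD(2))
    then show ?thesis
    proof eventually_elim
      case (elim n)
      have "b s + m n * s \<le> b z + m n * q" if "s \<in> {p..q}" for s
        using z(2)[OF that] that m(1)[of n] by (intro add_mono mult_left_mono) auto
      then show ?case using elim by force
    qed
  qed auto
  \<comment> \<open>A level \<open>u\<close> below \<open>\<sigma> n t\<close> is exceeded by the
    perturbed path at some time up to \<open>mid t\<close>. If that time lies beyond
    \<open>a t + \<delta>\<close>, the value there is below \<open>t\<close>, so the value at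
    \<open>a t\<close>, which is at least \<open>t\<close>, exceeds \<open>u\<close> already.
    Without a gap, \<open>mid t\<close> is \<open>a t\<close> itself.\<close>
  have upper: "eventually (\<lambda>n. \<forall>u. 0 \<le> u \<and> u < \<sigma> n t \<longrightarrow> Wn n u \<le> a t + \<delta>) sequentially"
    if "\<delta> > 0" "t \<ge> 0" for \<delta> t
  proof (cases "mid t < W t")
    case True
    have "eventually (\<lambda>n. \<forall>s\<in>{a t + \<delta>..mid t}. b s + m n * s < t) sequentially"
      by (rule gap) (use that True in auto)
    then show ?thesis
    proof eventually_elim
      case (elim n)
      have "Wn n u \<le> a t + \<delta>" if u: "0 \<le> u" "u < \<sigma> n t" for u
      proof -
        obtain s where s: "0 \<le> s" "s \<le> mid t" "u < b s + m n * s" using \<sigma>_less[OF \<open>t \<ge> 0\<close> u(2)] by blast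
        show ?thesis
        proof (cases "s \<le> a t + \<delta>")
          case True
          then show ?thesis using right_inverse_pathD1[OF Wn(2) u(1) s(1,3)] by simp
        next
          case False
          then have "b s + m n * s < t" using elim s by auto
          moreover have "t \<le> b (a t) + m n * a t" using ba[OF \<open>t \<ge> 0\<close>] a(1)[of t] m(1)[of n] by simp
          ultimately have "u < b (a t) + m n * a t" using s by simp
          then show ?thesis using right_inverse_pathD1[OF Wn(2) u(1) a(1)[of t]] \<open>\<delta> > 0\<close> by force
        qed
      qed
      then show ?case by blast
    qed
  next
    case False
    then have "mid t = a t" using W_ge[OF \<open>t \<ge> 0\<close>] by (simp add: mid_def)
    have "Wn n u \<le> a t + \<delta>" if u: "0 \<le> u" "u < \<sigma> n t" for n u
    proof -
      obtain s where s: "0 \<le> s" "s \<le> mid t" "u < b s + m n * s" using \<sigma>_less[OF \<open>t \<ge> 0\<close> u(2)] by blast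
      then show ?thesis using right_inverse_pathD1[OF Wn(2) u(1) s(1,3)] \<open>\<delta> > 0\<close> \<open>mid t = a t\<close> by simp
    qed
    then show ?thesis by simp
  qed
  \<comment> \<open>To exceed \<open>\<sigma> n t\<close> the perturbed path must go beyond
    \<open>mid t\<close>, and from there until \<open>W t - \<delta>\<close> it stays below
    \<open>t \<le> \<sigma> n t\<close>.\<close>
  have lower: "eventually (\<lambda>n. Wn n (\<sigma> n t) \<ge> W t - \<delta>) sequentially" if "\<delta> > 0" "t \<ge> 0" for \<delta> t
  proof -
    have *: "Wn n (\<sigma> n t) \<ge> W t - \<delta>" if g: "mid t < W t \<Longrightarrow> \<forall>s\<in>{mid t..W t - \<delta>}. b s + m n * s < t" for n
    proof (rule ccontr)
      assume "\<not> Wn n (\<sigma> n t) \<ge> W t - \<delta>"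
      moreover have "\<sigma> n t \<ge> 0" using \<sigma>_lower(2)[OF \<open>t \<ge> 0\<close>, of n] \<open>t \<ge> 0\<close> by simp
      ultimately obtain s where s: "0 \<le> s" "s < W t - \<delta>" "b s + m n * s > \<sigma> n t"
        using right_inverse_pathD2[OF Wn(2), of "\<sigma> n t" n "W t - \<delta>"] by auto
      then have "mid t < s" using \<sigma>_ge[of s t n] by force
      then have "b s + m n * s < t" using g s \<open>\<delta> > 0\<close> by auto
      then show False using \<sigma>_lower(2)[OF \<open>t \<ge> 0\<close>, of n] s by simp
    qed
    show ?thesis
    proof (cases "mid t < W t")
      case True
      then have "a t < mid t" by (simp add: mid_def)
      have "eventually (\<lambda>n. \<forall>s\<in>{mid t..W t - \<delta>}. b s + m n * s < t) sequentially"
        by (rule gap) (use that \<open>a t < mid t\<close> in auto)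
      then show ?thesis by eventually_elim (rule *)
    next
      case False then show ?thesis using * by simp
    qed
  qed
  show ?thesis
  proof (rule skorohod_nbhd_eventually[OF W(1) Wn(1) _ \<sigma>_lim _ \<open>\<epsilon> > 0\<close>])
    have "a 0 = 0" using a_le[of 0 0] a(1)[of 0] b0 by simp
    then show "\<sigma> n 0 = 0" for n
      using b0 W0 by (simp add: \<sigma>_def mid_def)
  next
    fix \<delta> s t :: real
    assume \<delta>: "\<delta> > 0" and st: "0 \<le> s" "s < t"
      and osc: "\<And>u v. u \<in> {s..<t} \<Longrightarrow> v \<in> {s..<t} \<Longrightarrow> dist (W u) (W v) < \<delta>"
    \<comment> \<open>\<open>a t\<close> is the left limit of \<open>W\<close> at \<open>t\<close>,
      so it is close to \<open>W s\<close>. Concretely, the maximum of \<open>b\<close> up to time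
      \<open>W s + \<delta>\<close> is at least every level \<open>v < t\<close>, hence at least
      \<open>t\<close>.\<close>
    have "a t \<le> W s + \<delta>"
    proof -
      have nonneg: "0 \<le> W s" using right_inverse_path_mono[OF W(2), of 0 s] st W0 by simp
      obtain z where z: "z \<in> {0..W s + \<delta>}" "\<And>y. y \<in> {0..W s + \<delta>} \<Longrightarrow> b y \<le> b z"
        using continuous_attains_sup[of "{0..W s + \<delta>}" b] cont_sub[of 0 "W s + \<delta>"] nonneg \<delta> by auto
      have "t \<le> b z"
      proof (rule dense_le_bounded[OF \<open>s < t\<close>])
        fix v assume v: "s < v" "v < t"
        have "W v < W s + \<delta>" using osc[of s v] v st by (auto simp: dist_real_def)
        then obtain y where "0 \<le> y" "y < W s + \<delta>" "b y > v"
          using right_inverse_pathD2[OF W(2), of v "W s + \<delta>"] v st by auto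
        then show "v \<le> b z" using z(2)[of y] by auto
      qed
      then show ?thesis using a_le[of z t] z(1) by auto
    qed
    have "0 \<le> t" using st by simp
    show "eventually (\<lambda>n. \<forall>u\<in>{\<sigma> n s..<\<sigma> n t}. \<forall>v\<in>{s..<t}. dist (Wn n u) (W v) < 3 * \<delta>) sequentially"
      using upper[OF \<delta> \<open>0 \<le> t\<close>] lower[OF \<delta> \<open>0 \<le> s\<close>]
    proof eventually_elim
      case (elim n)
      show ?case
      proof (intro ballI)
        fix u v assume uv: "u \<in> {\<sigma> n s..<\<sigma> n t}" "v \<in> {s..<t}"
        have \<sigma>s: "0 \<le> \<sigma> n s" using \<sigma>_lower(2)[OF \<open>0 \<le> s\<close>, of n] st by simp
        have "Wn n u \<le> a t + \<delta>" using elim(1) uv \<sigma>s by auto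
        moreover have "W s - \<delta> \<le> Wn n u"
          using elim(2) right_inverse_path_mono[OF Wn(2) \<sigma>s, of u n] uv by auto
        moreover have "W s \<le> W v" using right_inverse_path_mono[OF W(2) st(1), of v] uv by auto
        moreover have "W v \<le> a t" using W_le_a[of v t] uv st by auto
        \<comment> \<open>\<open>Wn n u\<close> lies between \<open>W s - \<delta>\<close> and
          \<open>W s + 2 * \<delta>\<close>, and \<open>W v\<close> between \<open>W s\<close> and
          \<open>W s + \<delta>\<close>, so they differ by at most
          \<open>2 * \<delta>\<close>.\<close>
        ultimately show "dist (Wn n u) (W v) < 3 * \<delta>"
          using \<open>a t \<le> W s + \<delta>\<close> \<delta> by (auto simp: dist_real_def abs_less_iff)
      qed
    qed
  qed
qed

text \<open>Almost sure equality with the hitting times is available for countably many levels at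
  once, hence for rational ones; right-continuity of \<open>W\<close> extends it to all levels.
  Approaching \<open>t\<close> through rational \<open>q > t\<close> turns first hitting into first
  exceedance, because a continuous path that exceeds \<open>t\<close> passes through such a
  \<open>q\<close>.\<close>

lemma hitting_right_inverse_path:
  fixes x :: "real \<Rightarrow> real"
  assumes W: "W \<in> D0" and cont: "continuous_on {0..} x" and x0: "x 0 = 0"
    and unb: "\<And>K. \<exists>s\<ge>0. x s > K"
    and hit: "\<And>q. q \<in> \<rat> \<Longrightarrow> q \<ge> 0 \<Longrightarrow> W q = Inf {s. 0 < s \<and> x s = q}"
  shows "right_inverse_path x W"
  unfolding right_inverse_path_def
proof (intro allI impI conjI)
  fix t :: real assume t: "t \<ge> 0"
  have right: "(W \<longlongrightarrow> W t) (at_right t)"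
    using W t by (auto simp: D0_def cadlag_def)
  have reach: "\<exists>s'. 0 < s' \<and> s' \<le> s \<and> x s' = q" if "0 < q" "0 \<le> s" "x s > q" for q s
  proof -
    have "continuous_on {0..s} x" by (rule continuous_on_subset[OF cont]) auto
    then obtain s' where "0 \<le> s'" "s' \<le> s" "x s' = q"
      using IVT'[of x 0 q s] x0 \<open>0 < q\<close> \<open>0 \<le> s\<close> \<open>x s > q\<close> by auto
    moreover have "s' \<noteq> 0" using calculation x0 \<open>0 < q\<close> by auto
    ultimately show ?thesis by (intro exI[of _ s']) auto
  qed
  {
    fix s assume s: "s \<ge> 0" "t < x s"
    show "W t \<le> s"
    proof (rule ccontr)
      assume "\<not> W t \<le> s"
      then have "eventually (\<lambda>q. W q > s) (at_right t)"
        using order_tendstoD(1)[OF right, of s] by simp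
      then obtain c where c: "c > t" "\<And>q. t < q \<Longrightarrow> q < c \<Longrightarrow> W q > s"
        by (auto simp: eventually_at_right_field)
      obtain q where q: "q \<in> \<rat>" "t < q" "q < min c (x s)"
        using Rats_dense_in_real[of t "min c (x s)"] c s by auto
      obtain s' where "0 < s'" "s' \<le> s" "x s' = q" using reach[of q s] q s t by auto
      then have "W q \<le> s'"
        using hit[of q] q t by (auto intro!: cInf_lower bdd_belowI[of _ 0])
      then show False using c(2)[of q] q \<open>s' \<le> s\<close> by simp
    qed
  next
    fix s assume s: "W t < s"
    then have "eventually (\<lambda>q. W q < s) (at_right t)"
      using order_tendstoD(2)[OF right, of s] by simp
    then obtain c where c: "c > t" "\<And>q. t < q \<Longrightarrow> q < c \<Longrightarrow> W q < s"
      by (auto simp: eventually_at_right_field)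
    obtain q where q: "q \<in> \<rat>" "t < q" "q < c"
      using Rats_dense_in_real[of t c] c by auto
    obtain s1 where "s1 \<ge> 0" "x s1 > q" using unb by blast
    then have "{s. 0 < s \<and> x s = q} \<noteq> {}" using reach[of q s1] q t by auto
    moreover have "Inf {s. 0 < s \<and> x s = q} < s" using hit[of q] c(2)[of q] q t by simp
    ultimately obtain s' where "0 < s'" "x s' = q" "s' < s"
      using cInf_lessD[of "{s. 0 < s \<and> x s = q}" s] by auto
    then show "\<exists>s'\<ge>0. s' < s \<and> t < x s'" using q by (intro exI[of _ s']) auto
  }
qed

section \<open>Brownian paths\<close>

lemma grid_Max_tendsto:
  fixes b :: "real \<Rightarrow> real"
  assumes cont: "continuous_on {p..q} b" and "p < q"
  shows "(\<lambda>N. Max ((\<lambda>i. b (p + (q - p) * real i / real N)) ` {..N})) \<longlonglongrightarrow> Sup (b ` {p..q})"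
proof -
  let ?Mx = "\<lambda>N. Max ((\<lambda>i. b (p + (q - p) * real i / real N)) ` {..N})"
  obtain z where z: "z \<in> {p..q}" "\<And>y. y \<in> {p..q} \<Longrightarrow> b y \<le> b z"
    using continuous_attains_sup[OF _ _ cont] \<open>p < q\<close> by auto
  have Sup: "Sup (b ` {p..q}) = b z"
    by (rule cSup_eq_maximum) (use z in auto)
  have grid: "p + (q - p) * real i / real N \<in> {p..q}" if "i \<le> N" for i N
  \<comment> \<open>At \<open>N = 0\<close> division by zero yields 0 and the grid degenerates to
    the point \<open>p\<close>.\<close>
  proof (cases "N = 0")
    case False
    then have "(q - p) * (real i / real N) \<le> (q - p) * 1"
      using that \<open>p < q\<close> by (intro mult_left_mono) auto
    then show ?thesis using \<open>p < q\<close> by simp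
  qed (use \<open>p < q\<close> in auto)
  define \<theta> where "\<theta> = (z - p) / (q - p)"
  have \<theta>: "0 \<le> \<theta>" "\<theta> \<le> 1" "p + (q - p) * \<theta> = z" using z(1) \<open>p < q\<close> by (auto simp: \<theta>_def)
  \<comment> \<open>\<open>j N\<close> is the last grid index at or before the maximiser
    \<open>z\<close>. These grid points converge to \<open>z\<close>, which squeezes the grid
    maximum against \<open>b z\<close>.\<close>
  define j where "j N = nat \<lfloor>\<theta> * real N\<rfloor>" for N
  have j: "real (j N) = of_int \<lfloor>\<theta> * real N\<rfloor>" for N using \<theta> by (simp add: j_def)
  have "j N \<le> N" for N
  proof -
    have "\<theta> * real N \<le> 1 * real N" using \<theta> by (intro mult_right_mono) auto
    then show ?thesis unfolding j_def by linarith
  qed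
  have "(\<lambda>N. real (j N) / real N) \<longlonglongrightarrow> \<theta>"
  proof (rule tendsto_sandwich)
    show "eventually (\<lambda>N. \<theta> - 1 / real N \<le> real (j N) / real N) sequentially"
      using eventually_gt_at_top[of 0]
    proof eventually_elim
      case (elim N)
      have "\<theta> * real N - 1 \<le> real (j N)" unfolding j by linarith
      then have "(\<theta> * real N - 1) / real N \<le> real (j N) / real N" by (rule divide_right_mono) simp
      then show ?case using elim by (simp add: diff_divide_distrib)
    qed
    show "eventually (\<lambda>N. real (j N) / real N \<le> \<theta>) sequentially"
      using eventually_gt_at_top[of 0]
    proof eventually_elim
      case (elim N)
      have "real (j N) \<le> \<theta> * real N" unfolding j by linarith
      then show ?case using elim by (simp add: field_simps)
    qed
    show "(\<lambda>N. \<theta> - 1 / real N) \<longlonglongrightarrow> \<theta>"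
      using tendsto_diff[OF tendsto_const lim_1_over_n, of \<theta>] by simp
  qed simp
  then have "(\<lambda>N. p + (q - p) * (real (j N) / real N)) \<longlonglongrightarrow> p + (q - p) * \<theta>"
    by (intro tendsto_intros)
  then have lim: "(\<lambda>N. p + (q - p) * real (j N) / real N) \<longlonglongrightarrow> z" using \<theta> by simp
  have "(\<lambda>N. b (p + (q - p) * real (j N) / real N)) \<longlonglongrightarrow> b z"
    by (rule continuous_on_tendsto_compose[OF cont lim z(1)]) (use grid \<open>\<And>N. j N \<le> N\<close> in auto)
  then show ?thesis unfolding Sup
  proof (rule tendsto_sandwich[rotated 2])
    show "(\<lambda>_::nat. b z) \<longlonglongrightarrow> b z" by simp
    show "eventually (\<lambda>N. b (p + (q - p) * real (j N) / real N) \<le> ?Mx N) sequentially"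
      using \<open>\<And>N. j N \<le> N\<close> by (intro always_eventually allI Max_ge) auto
    show "eventually (\<lambda>N. ?Mx N \<le> b z) sequentially"
      using z(2) grid by (intro always_eventually allI Max.boundedI) auto
  qed
qed

lemma (in prob_space) AE_ex_not_mem:
  assumes A: "\<And>k. A k \<in> events" and le: "\<And>k::nat. prob (A k) \<le> c k" and c: "c \<longlonglongrightarrow> 0"
  shows "AE \<omega> in M. \<exists>k. \<omega> \<notin> A k"
proof -
  have "prob (\<Inter>k. A k) \<le> c k" for k
    using finite_measure_mono[of "\<Inter>k. A k" "A k"] A le[of k] by (meson INF_lower UNIV_I order_trans)
  then have "prob (\<Inter>k. A k) \<le> 0"
    using LIMSEQ_le_const[OF c] by blast
  then have "prob (\<Inter>k. A k) = 0" using measure_nonneg[of M "\<Inter>k. A k"] by linarith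
  then have "AE \<omega> in M. \<omega> \<notin> (\<Inter>k. A k)"
    using A by (intro AE_not_in) (auto simp: null_sets_def emeasure_eq_measure)
  then show ?thesis by eventually_elim auto
qed

text \<open>The normal density is at most \<open>1 / (sqrt (2 * pi) * \<sigma>)\<close>, hence at
  most \<open>1 / \<sigma>\<close>.\<close>

lemma (in prob_space) normal_interval_prob:
  assumes X: "distributed M lborel X (normal_density 0 \<sigma>)" and "\<sigma> > 0" "a \<le> b"
  shows "emeasure (distr M borel X) {a..b} \<le> ennreal ((b - a) / \<sigma>)"
proof -
  have XM: "X \<in> borel_measurable M" using X by (simp add: distributed_def)
  have "emeasure (distr M borel X) {a..b} = emeasure M (X -` {a..b} \<inter> space M)"
    using XM by (intro emeasure_distr) auto
  also have "\<dots> = (\<integral>\<^sup>+x. ennreal (normal_density 0 \<sigma> x) * indicator {a..b} x \<partial>lborel)"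
    using distributed_emeasure[OF X, of "{a..b}"] by simp
  also have "\<dots> \<le> (\<integral>\<^sup>+x. ennreal (1 / \<sigma>) * indicator {a..b} x \<partial>lborel)"
  proof (intro nn_integral_mono mult_right_mono ennreal_leI)
    fix x
    have "1 * \<sigma> \<le> sqrt (2 * pi) * \<sigma>"
    proof (rule mult_right_mono)
      have "1 \<le> 2 * pi" using pi_gt3 by simp
      then show "1 \<le> sqrt (2 * pi)" by (simp add: real_le_rsqrt)
    qed (use \<open>\<sigma> > 0\<close> in simp)
    also have "sqrt (2 * pi) * \<sigma> = sqrt (2 * pi * \<sigma>\<^sup>2)" using \<open>\<sigma> > 0\<close> by (simp add: real_sqrt_mult)
    finally have *: "\<sigma> \<le> sqrt (2 * pi * \<sigma>\<^sup>2)" by simp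
    have "normal_density 0 \<sigma> x \<le> 1 / sqrt (2 * pi * \<sigma>\<^sup>2) * 1"
      unfolding normal_density_def by (intro mult_left_mono) auto
    also have "\<dots> \<le> 1 / \<sigma>" using * \<open>\<sigma> > 0\<close> by (simp add: frac_le)
    finally show "normal_density 0 \<sigma> x \<le> 1 / \<sigma>" .
  qed simp
  also have "\<dots> = ennreal ((b - a) / \<sigma>)"
    using assms by (simp add: nn_integral_cmult_indicator ennreal_mult[symmetric])
  finally show ?thesis .
qed

text \<open>Given \<open>Y\<close>, the event confines \<open>X\<close> to an interval of length
  \<open>2 * \<epsilon>\<close>, whatever the law of \<open>Y\<close> is.\<close>

lemma (in prob_space) normal_anticoncentration:
  assumes X: "distributed M lborel X (normal_density 0 \<sigma>)" and "\<sigma> > 0" "\<epsilon> \<ge> 0"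
    and ind: "indep_var borel X borel Y"
  shows "prob {\<omega> \<in> space M. \<bar>Y \<omega> - X \<omega>\<bar> \<le> \<epsilon>} \<le> 2 * \<epsilon> / \<sigma>"
proof -
  have [measurable]: "X \<in> borel_measurable M" "Y \<in> borel_measurable M"
    using ind by (auto dest: indep_var_rv1 indep_var_rv2)
  interpret X: prob_space "distr M borel X" by (rule prob_space_distr) simp
  interpret Y: prob_space "distr M borel Y" by (rule prob_space_distr) simp
  interpret XY: pair_prob_space "distr M borel X" "distr M borel Y" ..
  let ?A = "{z :: real \<times> real. \<bar>snd z - fst z\<bar> \<le> \<epsilon>}"
  have A_eq: "?A = {z \<in> space (borel \<Otimes>\<^sub>M borel). \<bar>snd z - fst z\<bar> \<le> \<epsilon>}"
    by (auto simp: space_pair_measure)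
  have A: "?A \<in> sets (borel \<Otimes>\<^sub>M borel)"
    unfolding A_eq by measurable
  have "emeasure M {\<omega> \<in> space M. \<bar>Y \<omega> - X \<omega>\<bar> \<le> \<epsilon>}
      = emeasure (distr M (borel \<Otimes>\<^sub>M borel) (\<lambda>\<omega>. (X \<omega>, Y \<omega>))) ?A"
    using A by (subst emeasure_distr) (auto intro!: arg_cong[where f = "emeasure M"])
  also have "\<dots> = emeasure (distr M borel X \<Otimes>\<^sub>M distr M borel Y) ?A"
    using ind by (simp add: indep_var_distribution_eq)
  also have "\<dots> = (\<integral>\<^sup>+y. emeasure (distr M borel X) ((\<lambda>x. (x, y)) -` ?A) \<partial>distr M borel Y)"
    by (rule XY.emeasure_pair_measure_alt2) (use A in \<open>simp cong: sets_pair_measure_cong\<close>)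
  also have "\<dots> \<le> (\<integral>\<^sup>+y. ennreal (2 * \<epsilon> / \<sigma>) \<partial>distr M borel Y)"
  proof (rule nn_integral_mono)
    fix y
    have "(\<lambda>x. (x, y)) -` ?A = {y - \<epsilon>..y + \<epsilon>}" by (auto simp: abs_le_iff)
    then show "emeasure (distr M borel X) ((\<lambda>x. (x, y)) -` ?A) \<le> ennreal (2 * \<epsilon> / \<sigma>)"
      using normal_interval_prob[OF X \<open>\<sigma> > 0\<close>, of "y - \<epsilon>" "y + \<epsilon>"] \<open>\<epsilon> \<ge> 0\<close> by simp
  qed
  also have "\<dots> = ennreal (2 * \<epsilon> / \<sigma>)" by (simp add: Y.emeasure_space_1[simplified])
  finally show ?thesis
    using assms by (simp add: emeasure_eq_measure)
qed

text \<open>By symmetry \<open>X > L\<close> and \<open>X < - L\<close> are equally likely, and the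
  interval between takes at most \<open>2 * L / \<sigma> \<le> 1 / 2\<close> of the mass. So
  \<open>X > L\<close> has probability at least 1/4.\<close>

lemma (in prob_space) normal_prob_le:
  assumes X: "distributed M lborel X (normal_density 0 \<sigma>)" and "\<sigma> > 0" "L \<ge> 0" "4 * L \<le> \<sigma>"
  shows "prob {\<omega> \<in> space M. X \<omega> \<le> L} \<le> 3 / 4"
proof -
  have [measurable]: "X \<in> borel_measurable M" using X by (simp add: distributed_def)
  have "distributed M lborel (\<lambda>\<omega>. 0 + (-1) * X \<omega>) (normal_density (0 + (-1) * 0) (\<bar>-1\<bar> * \<sigma>))"
    by (rule normal_density_affine[OF X]) (use assms in auto)
  then have "distr M lborel (\<lambda>\<omega>. - X \<omega>) = distr M lborel X"
    using X by (simp add: distributed_def)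
  then have "measure (distr M lborel (\<lambda>\<omega>. - X \<omega>)) {L<..} = measure (distr M lborel X) {L<..}" by simp
  moreover have "measure (distr M lborel (\<lambda>\<omega>. - X \<omega>)) {L<..} = prob {\<omega> \<in> space M. - X \<omega> > L}"
    by (subst measure_distr) (auto intro!: arg_cong[where f = prob])
  moreover have "measure (distr M lborel X) {L<..} = prob {\<omega> \<in> space M. X \<omega> > L}"
    by (subst measure_distr) (auto intro!: arg_cong[where f = prob])
  ultimately have sym: "prob {\<omega> \<in> space M. - X \<omega> > L} = prob {\<omega> \<in> space M. X \<omega> > L}" by simp
  have "prob {\<omega> \<in> space M. X \<omega> \<in> {-L..L}} \<le> 2 * L / \<sigma>"
  proof -
    have "{\<omega> \<in> space M. X \<omega> \<in> {-L..L}} = X -` {-L..L} \<inter> space M" by auto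
    then have "ennreal (prob {\<omega> \<in> space M. X \<omega> \<in> {-L..L}}) = emeasure (distr M borel X) {-L..L}"
      by (subst emeasure_distr) (auto simp: emeasure_eq_measure)
    also have "\<dots> \<le> ennreal (2 * L / \<sigma>)"
      using normal_interval_prob[OF X \<open>\<sigma> > 0\<close>, of "-L" L] \<open>L \<ge> 0\<close> by simp
    finally show ?thesis using assms by simp
  qed
  also have "\<dots> \<le> 1 / 2" using assms by (simp add: field_simps)
  finally have mid: "prob {\<omega> \<in> space M. X \<omega> \<in> {-L..L}} \<le> 1 / 2" .
  have "prob (space M) \<le> prob ({\<omega> \<in> space M. - X \<omega> > L} \<union> {\<omega> \<in> space M. X \<omega> > L} \<union> {\<omega> \<in> space M. X \<omega> \<in> {-L..L}})"
    by (rule finite_measure_mono) auto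
  also have "\<dots> \<le> prob ({\<omega> \<in> space M. - X \<omega> > L} \<union> {\<omega> \<in> space M. X \<omega> > L}) + prob {\<omega> \<in> space M. X \<omega> \<in> {-L..L}}"
    by (rule measure_Un_le) auto
  also have "prob ({\<omega> \<in> space M. - X \<omega> > L} \<union> {\<omega> \<in> space M. X \<omega> > L})
      \<le> prob {\<omega> \<in> space M. - X \<omega> > L} + prob {\<omega> \<in> space M. X \<omega> > L}"
    by (rule measure_Un_le) auto
  finally have "prob {\<omega> \<in> space M. X \<omega> > L} \<ge> 1 / 4" using sym mid prob_space by simp
  moreover have "prob {\<omega> \<in> space M. X \<omega> \<le> L} = 1 - prob {\<omega> \<in> space M. X \<omega> > L}"
    by (subst prob_compl[symmetric]) (auto intro!: arg_cong[where f = prob])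
  ultimately show ?thesis by simp
qed

section \<open>Brownian motion on finite grids\<close>

lemma brownian_motion_prob_space: "brownian_motion M B \<Longrightarrow> prob_space M"
  by (simp add: brownian_motion_def)

lemma brownian_motion_measurable: "brownian_motion M B \<Longrightarrow> t \<ge> 0 \<Longrightarrow> B t \<in> borel_measurable M"
  by (simp add: brownian_motion_def)

lemma brownian_motion_increment:
  "brownian_motion M B \<Longrightarrow> 0 \<le> s \<Longrightarrow> s < t \<Longrightarrow>
    distributed M lborel (\<lambda>\<omega>. B t \<omega> - B s \<omega>) (normal_density 0 (sqrt (t - s)))"
  by (simp add: brownian_motion_def)

text \<open>The other increments enter through an arbitrary measurable \<open>h\<close>; this is how
  maxima over grids become independent of the increment singled out.\<close>

lemma brownian_motion_indep_increment:
  assumes bm: "brownian_motion M B" and t: "0 \<le> t 0" "\<And>i. i < n \<Longrightarrow> t i \<le> t (Suc i)" and "j < n"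
    and h: "h \<in> borel_measurable (PiM ({..<n} - {j}) (\<lambda>_. borel))"
  shows "prob_space.indep_var M borel (\<lambda>\<omega>. B (t (Suc j)) \<omega> - B (t j) \<omega>)
    borel (\<lambda>\<omega>. h (\<lambda>i\<in>{..<n} - {j}. B (t (Suc i)) \<omega> - B (t i) \<omega>))"
proof -
  interpret prob_space M by (rule brownian_motion_prob_space[OF bm])
  have "indep_vars (\<lambda>_. borel) (\<lambda>i \<omega>. B (t (Suc i)) \<omega> - B (t i) \<omega>) {..<n}"
    using bm t by (auto simp: brownian_motion_def independent_increments_def)
  then have "indep_var (PiM {j} (\<lambda>_. borel)) (\<lambda>\<omega>. \<lambda>i\<in>{j}. B (t (Suc i)) \<omega> - B (t i) \<omega>)
      (PiM ({..<n} - {j}) (\<lambda>_. borel)) (\<lambda>\<omega>. \<lambda>i\<in>{..<n} - {j}. B (t (Suc i)) \<omega> - B (t i) \<omega>)"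
    by (rule indep_var_restrict) (use \<open>j < n\<close> in auto)
  from indep_var_compose[OF this, of "\<lambda>x. x j" borel h borel] h show ?thesis
    by (simp add: comp_def)
qed

lemma grid_nonneg:
  fixes t :: "nat \<Rightarrow> real"
  assumes "0 \<le> t 0" "\<And>i. i < n \<Longrightarrow> t i \<le> t (Suc i)" "i \<le> n"
  shows "0 \<le> t i"
  using \<open>i \<le> n\<close>
proof (induction i)
  case (Suc i)
  then show ?case using assms(2)[of i] by simp
qed (use assms in simp)

text \<open>Appending one late time to a grid multiplies the probability by at most \<open>3 / 4\<close>, up to the small
  probability that the path is very negative at the end of the grid.\<close>

lemma brownian_motion_grid_bounded_above:
  fixes K :: real
  assumes bm: "brownian_motion M B" and "K \<ge> 0"
  shows "\<exists>n t. t 0 = (0::real) \<and> (\<forall>i<n. t i \<le> t (Suc i)) \<and>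
    measure M {\<omega> \<in> space M. \<forall>i\<le>n. B (t i) \<omega> - B (t 0) \<omega> \<le> K} \<le> (7 / 8) ^ k"
proof (induction k)
  interpret prob_space M by (rule brownian_motion_prob_space[OF bm])
  case 0
  show ?case by (intro exI[of _ 0] exI[of _ "\<lambda>_. 0"]) auto
next
  interpret prob_space M by (rule brownian_motion_prob_space[OF bm])
  case (Suc k)
  then obtain n t where t: "t 0 = (0::real)" "\<And>i. i < n \<Longrightarrow> t i \<le> t (Suc i)"
    and le: "prob {\<omega> \<in> space M. \<forall>i\<le>n. B (t i) \<omega> - B (t 0) \<omega> \<le> K} \<le> (7 / 8) ^ k" by blast
  have t_nonneg: "0 \<le> t i" if "i \<le> n" for i
    using grid_nonneg[of t n i] t that by simp
  define Z where "Z \<omega> = B (t n) \<omega> - B (t 0) \<omega>" for \<omega>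
  have Bm: "B s \<in> borel_measurable M" if "s \<ge> 0" for s by (rule brownian_motion_measurable[OF bm that])
  have [measurable]: "Z \<in> borel_measurable M"
    unfolding Z_def using t_nonneg[of n] t(1) by (auto intro!: borel_measurable_diff Bm)
  interpret Z: real_distribution "distr M borel Z" by (rule real_distribution_distr) simp
  \<comment> \<open>Chosen so that 3/4 of \<open>(7 / 8) ^ k\<close> plus \<open>\<epsilon>\<close>
    is exactly \<open>(7 / 8) ^ Suc k\<close>.\<close>
  define \<epsilon> where "\<epsilon> = (7 / 8 :: real) ^ k / 8"
  have "eventually (\<lambda>x. cdf (distr M borel Z) x < \<epsilon> \<and> x \<le> 0) at_bot"
    by (intro eventually_conj order_tendstoD(2)[OF Z.cdf_lim_at_bot] eventually_le_at_bot) (simp add: \<epsilon>_def)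
  then obtain x where x: "cdf (distr M borel Z) x < \<epsilon>" "x \<le> 0"
    by (metis (mono_tags, lifting) eventually_at_bot_linorder order_refl)
  have Zx: "prob {\<omega> \<in> space M. Z \<omega> \<le> x} < \<epsilon>"
  proof -
    have "cdf (distr M borel Z) x = prob {\<omega> \<in> space M. Z \<omega> \<le> x}"
      unfolding cdf_def by (subst measure_distr) (auto intro!: arg_cong[where f = prob])
    then show ?thesis using x by simp
  qed
  \<comment> \<open>If the path is above \<open>x\<close> at the end of the grid and then gains more
    than \<open>L\<close>, it exceeds \<open>K\<close>.\<close>
  define L where "L = K - x"
  have L: "L \<ge> 0" using \<open>K \<ge> 0\<close> x by (simp add: L_def)
  \<comment> \<open>The new increment has standard deviation \<open>4 * L + 1\<close>, which is
    positive and at least \<open>4 * L\<close>, as the bound 3/4 requires.\<close>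
  define t' where "t' i = (if i \<le> n then t i else t n + (4 * L + 1)\<^sup>2)" for i
  have t': "t' 0 = 0" "\<And>i. i < Suc n \<Longrightarrow> t' i \<le> t' (Suc i)"
    using t by (auto simp: t'_def le_Suc_eq less_Suc_eq not_less_eq_eq)
  define D where "D i \<omega> = B (t' (Suc i)) \<omega> - B (t' i) \<omega>" for i \<omega>
  \<comment> \<open>Partial sums turn the old increments back into grid values, so the old event
    depends only on increments independent of the new one.\<close>
  define h where "h x = Max ((\<lambda>i. \<Sum>j<i. x j) ` {..n})" for x :: "nat \<Rightarrow> real"
  define Y where "Y \<omega> = h (\<lambda>i\<in>{..<Suc n} - {n}. D i \<omega>)" for \<omega>
  have h: "h \<in> borel_measurable (PiM ({..<Suc n} - {n}) (\<lambda>_. borel))"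
    unfolding h_def by (intro borel_measurable_Max borel_measurable_sum measurable_component_singleton) auto
  have ind: "indep_var borel (D n) borel Y"
    unfolding D_def Y_def
    by (rule brownian_motion_indep_increment[OF bm, of t' "Suc n" n h]) (use t' h in auto)
  then have [measurable]: "D n \<in> borel_measurable M" "Y \<in> borel_measurable M"
    by (auto dest: indep_var_rv1 indep_var_rv2)
  have Y: "Y \<omega> = Max ((\<lambda>i. B (t i) \<omega> - B (t 0) \<omega>) ` {..n})" for \<omega>
  proof -
    have "(\<Sum>j<i. (\<lambda>i\<in>{..<Suc n} - {n}. D i \<omega>) j) = B (t i) \<omega> - B (t 0) \<omega>" if "i \<le> n" for i
    proof -
      have "(\<Sum>j<i. (\<lambda>i\<in>{..<Suc n} - {n}. D i \<omega>) j) = (\<Sum>j<i. B (t (Suc j)) \<omega> - B (t j) \<omega>)"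
        using that by (intro sum.cong) (auto simp: D_def t'_def)
      then show ?thesis by (simp only: sum_lessThan_telescope[of "\<lambda>i. B (t i) \<omega>"])
    qed
    then show ?thesis unfolding Y_def h_def by (intro arg_cong[where f = Max] image_cong) auto
  qed
  have Y_le: "Y \<omega> \<le> K \<longleftrightarrow> (\<forall>i\<le>n. B (t i) \<omega> - B (t 0) \<omega> \<le> K)" for \<omega>
    unfolding Y by (subst Max_le_iff) auto
  have "prob {\<omega> \<in> space M. \<forall>i\<le>Suc n. B (t' i) \<omega> - B (t' 0) \<omega> \<le> K}
      \<le> prob ({\<omega> \<in> space M. D n \<omega> \<le> L \<and> Y \<omega> \<le> K} \<union> {\<omega> \<in> space M. Z \<omega> \<le> x})"
  proof (rule finite_measure_mono)
    show "{\<omega> \<in> space M. \<forall>i\<le>Suc n. B (t' i) \<omega> - B (t' 0) \<omega> \<le> K}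
      \<subseteq> {\<omega> \<in> space M. D n \<omega> \<le> L \<and> Y \<omega> \<le> K} \<union> {\<omega> \<in> space M. Z \<omega> \<le> x}"
    proof
      fix \<omega> assume *: "\<omega> \<in> {\<omega> \<in> space M. \<forall>i\<le>Suc n. B (t' i) \<omega> - B (t' 0) \<omega> \<le> K}"
      then have **: "B (t' i) \<omega> - B (t' 0) \<omega> \<le> K" if "i \<le> Suc n" for i using that by blast
      have "B (t i) \<omega> - B (t 0) \<omega> \<le> K" if "i \<le> n" for i
        using **[of i] that by (simp add: t'_def)
      with **[of "Suc n"] show "\<omega> \<in> {\<omega> \<in> space M. D n \<omega> \<le> L \<and> Y \<omega> \<le> K} \<union> {\<omega> \<in> space M. Z \<omega> \<le> x}"
        using * by (auto simp: Y_le D_def Z_def L_def t'_def)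
    qed
  qed measurable
  also have "\<dots> \<le> prob {\<omega> \<in> space M. D n \<omega> \<le> L \<and> Y \<omega> \<le> K} + prob {\<omega> \<in> space M. Z \<omega> \<le> x}"
    by (rule measure_Un_le) auto
  also have "{\<omega> \<in> space M. D n \<omega> \<le> L \<and> Y \<omega> \<le> K} = (\<lambda>\<omega>. (D n \<omega>, Y \<omega>)) -` ({..L} \<times> {..K}) \<inter> space M" by auto
  also have "prob \<dots> = prob (D n -` {..L} \<inter> space M) * prob (Y -` {..K} \<inter> space M)"
    by (rule indep_varD[OF ind]) auto
  also have "D n -` {..L} \<inter> space M = {\<omega> \<in> space M. D n \<omega> \<le> L}" by auto
  also have "Y -` {..K} \<inter> space M = {\<omega> \<in> space M. \<forall>i\<le>n. B (t i) \<omega> - B (t 0) \<omega> \<le> K}" by (auto simp: Y_le)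
  also have "prob {\<omega> \<in> space M. D n \<omega> \<le> L} * prob {\<omega> \<in> space M. \<forall>i\<le>n. B (t i) \<omega> - B (t 0) \<omega> \<le> K} \<le> (3 / 4) * (7 / 8) ^ k"
  proof (rule mult_mono[OF _ le])
    have "distributed M lborel (\<lambda>\<omega>. B (t' (Suc n)) \<omega> - B (t' n) \<omega>) (normal_density 0 (sqrt (t' (Suc n) - t' n)))"
      by (rule brownian_motion_increment[OF bm]) (use t_nonneg[of n] L in \<open>auto simp: t'_def\<close>)
    then have "distributed M lborel (D n) (normal_density 0 (4 * L + 1))"
      using L by (simp add: t'_def D_def[abs_def])
    then show "prob {\<omega> \<in> space M. D n \<omega> \<le> L} \<le> 3 / 4"
      by (rule normal_prob_le) (use L in auto)
  qed auto
  finally have "prob {\<omega> \<in> space M. \<forall>i\<le>Suc n. B (t' i) \<omega> - B (t' 0) \<omega> \<le> K} \<le> (7 / 8) ^ Suc k"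
    using Zx by (simp add: \<epsilon>_def)
  then show ?case using t' by (intro exI[of _ "Suc n"] exI[of _ t']) auto
qed

text \<open>For each \<open>k\<close> some finite grid is spent below the level with probability at
  most \<open>(7 / 8) ^ k\<close>. These events involve finitely many coordinates, so they are
  measurable, and treating integer levels first keeps the exceptional sets countable in
  number.\<close>

lemma brownian_motion_unbounded_above:
  assumes bm: "brownian_motion M B"
  shows "AE \<omega> in M. \<forall>K. \<exists>s\<ge>0. B s \<omega> > K"
proof -
  interpret prob_space M by (rule brownian_motion_prob_space[OF bm])
  have *: "AE \<omega> in M. \<exists>s\<ge>0. B s \<omega> > real K" for K :: nat
  proof -
    define P where "P k n t \<longleftrightarrow> t 0 = (0::real) \<and> (\<forall>i<n. t i \<le> t (Suc i)) \<and>
      prob {\<omega> \<in> space M. \<forall>i\<le>n. B (t i) \<omega> - B (t 0) \<omega> \<le> real K} \<le> (7 / 8) ^ k" for k n t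
    have "\<forall>k. \<exists>n t. P k n t"
      unfolding P_def using brownian_motion_grid_bounded_above[OF bm, of "real K"] by simp
    then obtain n t where "\<And>k. P k (n k) (t k)" by metis
    then have t: "\<And>k. t k 0 = (0::real)" "\<And>k i. i < n k \<Longrightarrow> t k i \<le> t k (Suc i)"
      and le: "\<And>k. prob {\<omega> \<in> space M. \<forall>i\<le>n k. B (t k i) \<omega> - B (t k 0) \<omega> \<le> real K} \<le> (7 / 8) ^ k"
      unfolding P_def by blast+
    have t_nonneg: "0 \<le> t k i" if "i \<le> n k" for i k
      using grid_nonneg[of "t k" "n k" i] t that by simp
    have "{\<omega> \<in> space M. \<forall>i\<le>n k. B (t k i) \<omega> - B (t k 0) \<omega> \<le> real K} \<in> events" for k
    proof -
      have "B (t k i) \<in> borel_measurable M" if "i \<le> n k" for i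
        by (rule brownian_motion_measurable[OF bm t_nonneg[OF that]])
      then have "{\<omega> \<in> space M. B (t k i) \<omega> - B (t k 0) \<omega> \<le> real K} \<in> events" if "i \<in> {..n k}" for i
        using that by (intro borel_measurable_le borel_measurable_diff) auto
      then have "{\<omega> \<in> space M. \<forall>i\<in>{..n k}. B (t k i) \<omega> - B (t k 0) \<omega> \<le> real K} \<in> events"
        by (intro sets.sets_Collect_finite_All) auto
      then show ?thesis by (simp only: Ball_def atMost_iff)
    qed
    then have "AE \<omega> in M. \<exists>k. \<omega> \<notin> {\<omega> \<in> space M. \<forall>i\<le>n k. B (t k i) \<omega> - B (t k 0) \<omega> \<le> real K}"
      by (rule AE_ex_not_mem[OF _ le LIMSEQ_power_zero]) auto
    moreover have "AE \<omega> in M. B 0 \<omega> = 0" using bm by (simp add: brownian_motion_def)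
    ultimately show ?thesis using AE_space
    proof eventually_elim
      case (elim \<omega>)
      then obtain k i where "i \<le> n k" "B (t k i) \<omega> - B (t k 0) \<omega> > real K" by (auto simp: not_le)
      then show ?case using t_nonneg[of i k] t(1)[of k] elim by (intro exI[of _ "t k i"]) auto
    qed
  qed
  then have "AE \<omega> in M. \<forall>K::nat. \<exists>s\<ge>0. B s \<omega> > real K" by (simp add: AE_all_countable)
  then show ?thesis
  proof eventually_elim
    case (elim \<omega>)
    show ?case
    proof
      fix K :: real
      obtain k :: nat where "K \<le> real k" using real_arch_simple by blast
      then show "\<exists>s\<ge>0. B s \<omega> > K" using elim by (meson le_less_trans)
    qed
  qed
qed

text \<open>The difference of the maxima is the increment over \<open>[q, r]\<close>, which has a bounded density, plus an
  independent random variable.\<close>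

lemma brownian_motion_grid_Max_diff:
  fixes p q r u \<epsilon> :: real and N :: nat
  assumes bm: "brownian_motion M B" and pqru: "0 \<le> p" "p < q" "q < r" "r < u" and "N > 0" "\<epsilon> \<ge> 0"
  defines "mx \<equiv> \<lambda>a b \<omega>. Max ((\<lambda>i. B (a + (b - a) * real i / real N) \<omega>) ` {..N})"
  shows "measure M {\<omega> \<in> space M. \<bar>mx p q \<omega> - mx r u \<omega>\<bar> \<le> \<epsilon>} \<le> 2 * \<epsilon> / sqrt (r - q)"
proof -
  interpret prob_space M by (rule brownian_motion_prob_space[OF bm])
  \<comment> \<open>Index \<open>N\<close> is the time \<open>q\<close> and index
    \<open>Suc N\<close> the time \<open>r\<close>, so the increment number \<open>N\<close> spans
    the gap between the two intervals.\<close>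
  define t where "t i = (if i \<le> N then p + (q - p) * real i / real N
    else r + (u - r) * real (i - Suc N) / real N)" for i
  have t_lo: "t i = p + (q - p) * real i / real N" if "i \<le> N" for i using that by (simp add: t_def)
  have t_hi: "t (Suc N + i) = r + (u - r) * real i / real N" for i by (simp add: t_def)
  have tN: "t N = q" "t (Suc N) = r" using \<open>N > 0\<close> by (simp_all add: t_def)
  have t0: "0 \<le> t 0" using pqru by (simp add: t_def)
  have mono: "t i \<le> t (Suc i)" if "i < Suc (2 * N)" for i
  proof -
    consider "i < N" | "i = N" | "N < i" by linarith
    then show ?thesis
    proof cases
      case 1
      then show ?thesis using pqru
        by (simp add: t_lo del: of_nat_Suc) (intro divide_right_mono mult_left_mono; simp)
    next
      case 2 then show ?thesis using tN pqru by simp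
    next
      case 3
      define j where "j = i - Suc N"
      have "i = Suc N + j" "Suc i = Suc N + Suc j" using 3 by (simp_all add: j_def)
      then have "t i = r + (u - r) * real j / real N" "t (Suc i) = r + (u - r) * real (Suc j) / real N"
        using t_hi[of j] t_hi[of "Suc j"] by simp_all
      then show ?thesis using pqru
        by (simp del: of_nat_Suc) (intro divide_right_mono mult_left_mono; simp)
    qed
  qed
  define D where "D i \<omega> = B (t (Suc i)) \<omega> - B (t i) \<omega>" for i \<omega>
  \<comment> \<open>The first maximum is taken relative to the end value at \<open>q\<close>, the
    second relative to the starting value at \<open>r\<close>. Both are functions of increments
    other than number \<open>N\<close>.\<close>
  define h where "h x = Max ((\<lambda>i. - (\<Sum>j\<in>{i..<N}. x j)) ` {..N}) -
    Max ((\<lambda>i. \<Sum>j\<in>{Suc N..<Suc N + i}. x j) ` {..N})" for x :: "nat \<Rightarrow> real"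
  define I where "I = {..<Suc (2 * N)} - {N}"
  define Y where "Y \<omega> = h (\<lambda>i\<in>I. D i \<omega>)" for \<omega>
  have h: "h \<in> borel_measurable (PiM I (\<lambda>_. borel))"
    unfolding h_def I_def
    by (intro borel_measurable_diff borel_measurable_Max borel_measurable_uminus
        borel_measurable_sum measurable_component_singleton) auto
  have ind: "indep_var borel (D N) borel Y"
    unfolding D_def Y_def I_def
    by (rule brownian_motion_indep_increment[OF bm, of t "Suc (2 * N)" N h])
      (use t0 mono h in \<open>auto simp: I_def\<close>)
  have diff: "mx p q \<omega> - mx r u \<omega> = Y \<omega> - D N \<omega>" for \<omega>
  proof -
    have telescope: "(\<Sum>j\<in>{i..<k}. D j \<omega>) = B (t k) \<omega> - B (t i) \<omega>" if "i \<le> k" for i k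
      unfolding D_def using sum_Suc_diff'[OF that, of "\<lambda>i. B (t i) \<omega>"] .
    have lo: "B (p + (q - p) * real i / real N) \<omega> = - (\<Sum>j\<in>{i..<N}. (\<lambda>i\<in>I. D i \<omega>) j) + B q \<omega>"
      if "i \<in> {..N}" for i
    proof -
      have "(\<Sum>j\<in>{i..<N}. (\<lambda>i\<in>I. D i \<omega>) j) = (\<Sum>j\<in>{i..<N}. D j \<omega>)"
        by (rule sum.cong) (auto simp: I_def)
      then show ?thesis using that by (simp add: telescope tN t_lo)
    qed
    have hi: "B (r + (u - r) * real i / real N) \<omega> = (\<Sum>j\<in>{Suc N..<Suc N + i}. (\<lambda>i\<in>I. D i \<omega>) j) + B r \<omega>"
      if "i \<in> {..N}" for i
    proof -
      have "(\<Sum>j\<in>{Suc N..<Suc N + i}. (\<lambda>i\<in>I. D i \<omega>) j) = (\<Sum>j\<in>{Suc N..<Suc N + i}. D j \<omega>)"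
        by (rule sum.cong) (use that in \<open>auto simp: I_def\<close>)
      also have "\<dots> = B (t (Suc N + i)) \<omega> - B (t (Suc N)) \<omega>" by (rule telescope) simp
      finally show ?thesis unfolding t_hi tN by simp
    qed
    have "mx p q \<omega> = Max ((\<lambda>i::nat. - (\<Sum>j\<in>{i..<N}. (\<lambda>i\<in>I. D i \<omega>) j) + B q \<omega>) ` {..N})"
      unfolding mx_def by (rule arg_cong[where f = Max], rule image_cong) (simp, rule lo)
    also have "\<dots> = Max ((\<lambda>i. - (\<Sum>j\<in>{i..<N}. (\<lambda>i\<in>I. D i \<omega>) j)) ` {..N}) + B q \<omega>"
      by (rule Max_add_commute) auto
    finally have mx_lo: "mx p q \<omega> = \<dots>" .
    have "mx r u \<omega> = Max ((\<lambda>i. (\<Sum>j\<in>{Suc N..<Suc N + i}. (\<lambda>i\<in>I. D i \<omega>) j) + B r \<omega>) ` {..N})"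
      unfolding mx_def by (rule arg_cong[where f = Max], rule image_cong) (simp, rule hi)
    also have "\<dots> = Max ((\<lambda>i. \<Sum>j\<in>{Suc N..<Suc N + i}. (\<lambda>i\<in>I. D i \<omega>) j) ` {..N}) + B r \<omega>"
      by (rule Max_add_commute) auto
    finally show ?thesis unfolding mx_lo Y_def h_def by (simp add: D_def tN)
  qed
  have "distributed M lborel (D N) (normal_density 0 (sqrt (r - q)))"
    using brownian_motion_increment[OF bm, of q r] pqru by (simp add: D_def[abs_def] tN)
  from normal_anticoncentration[OF this _ \<open>\<epsilon> \<ge> 0\<close> ind] pqru show ?thesis
    unfolding diff by simp
qed

text \<open>If the suprema agreed, then for every \<open>k\<close> the grid maxima would eventually
  differ by at most \<open>1 / Suc k\<close>, an event whose probability is of order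
  \<open>1 / k\<close>.\<close>

lemma brownian_motion_distinct_peaks:
  fixes p q r u :: real
  assumes bm: "brownian_motion M B" and pqru: "0 \<le> p" "p < q" "q < r" "r < u"
  shows "AE \<omega> in M. Sup ((\<lambda>s. B s \<omega>) ` {p..q}) \<noteq> Sup ((\<lambda>s. B s \<omega>) ` {r..u})"
proof -
  interpret prob_space M by (rule brownian_motion_prob_space[OF bm])
  define mx where "mx N a b \<omega> = Max ((\<lambda>i. B (a + (b - a) * real i / real N) \<omega>) ` {..N})" for N a b \<omega>
  have mx: "mx N a b \<in> borel_measurable M" if "0 \<le> a" "a \<le> b" for N a b
    unfolding mx_def using that
    by (intro borel_measurable_Max brownian_motion_measurable[OF bm]) auto
  have [measurable]: "mx N p q \<in> borel_measurable M" "mx N r u \<in> borel_measurable M" for N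
    by (rule mx; use pqru in simp)+
  \<comment> \<open>\<open>C k N\<close> increases with \<open>N\<close>, so the bound for a single
    grid passes to the union. Grids are indexed by \<open>Suc n\<close> because the estimate
    requires at least one step.\<close>
  define C where "C k N = {\<omega> \<in> space M. \<forall>n\<ge>N. \<bar>mx (Suc n) p q \<omega> - mx (Suc n) r u \<omega>\<bar> \<le> 1 / real (Suc k)}" for k N
  have C[measurable]: "C k N \<in> events" for k N unfolding C_def by measurable
  have "prob (\<Union>N. C k N) \<le> 2 / sqrt (r - q) * (1 / real (Suc k))" for k
  proof (rule LIMSEQ_le_const2)
    show "(\<lambda>N. prob (C k N)) \<longlonglongrightarrow> prob (\<Union>N. C k N)"
      by (rule finite_Lim_measure_incseq) (auto simp: C_def incseq_def)
    have "prob (C k N) \<le> 2 / sqrt (r - q) * (1 / real (Suc k))" for N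
    proof -
      have "prob (C k N) \<le> prob {\<omega> \<in> space M. \<bar>mx (Suc N) p q \<omega> - mx (Suc N) r u \<omega>\<bar> \<le> 1 / real (Suc k)}"
        by (rule finite_measure_mono) (auto simp: C_def)
      also have "\<dots> \<le> 2 * (1 / real (Suc k)) / sqrt (r - q)"
        unfolding mx_def by (rule brownian_motion_grid_Max_diff[OF bm pqru]) auto
      finally show ?thesis by (simp add: mult.commute)
    qed
    then show "\<exists>N0. \<forall>N\<ge>N0. prob (C k N) \<le> 2 / sqrt (r - q) * (1 / real (Suc k))" by blast
  qed
  moreover have "(\<lambda>k. 2 / sqrt (r - q) * (1 / real (Suc k))) \<longlonglongrightarrow> 0"
    by (rule tendsto_mult_right_zero) (rule LIMSEQ_Suc[OF lim_1_over_n])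
  ultimately have "AE \<omega> in M. \<exists>k. \<omega> \<notin> (\<Union>N. C k N)"
    by (intro AE_ex_not_mem[of "\<lambda>k. \<Union>N. C k N"]) auto
  moreover have "AE \<omega> in M. continuous_on {0..} (\<lambda>s. B s \<omega>)" using bm by (simp add: brownian_motion_def)
  ultimately show ?thesis using AE_space
  proof eventually_elim
    case (elim \<omega>)
    then obtain k where k: "\<And>N. \<omega> \<notin> C k N" by blast
    show ?case
    proof
      assume eq: "Sup ((\<lambda>s. B s \<omega>) ` {p..q}) = Sup ((\<lambda>s. B s \<omega>) ` {r..u})"
      have lim: "(\<lambda>N. mx N a b \<omega>) \<longlonglongrightarrow> Sup ((\<lambda>s. B s \<omega>) ` {a..b})" if "0 \<le> a" "a < b" for a b
        unfolding mx_def
        by (rule grid_Max_tendsto[OF continuous_on_subset[OF elim(2)]]) (use that in auto)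
      have "(\<lambda>N. mx N p q \<omega> - mx N r u \<omega>) \<longlonglongrightarrow> 0"
        using tendsto_diff[OF lim[of p q] lim[of r u]] pqru eq by simp
      then have lim0: "(\<lambda>N. mx (Suc N) p q \<omega> - mx (Suc N) r u \<omega>) \<longlonglongrightarrow> 0" by (rule LIMSEQ_Suc)
      have "eventually (\<lambda>N. \<bar>mx (Suc N) p q \<omega> - mx (Suc N) r u \<omega>\<bar> < 1 / real (Suc k)) sequentially"
        using tendstoD[OF lim0, of "1 / real (Suc k)"] by (simp add: dist_real_def)
      then obtain N where "\<And>n. n \<ge> N \<Longrightarrow> \<bar>mx (Suc n) p q \<omega> - mx (Suc n) r u \<omega>\<bar> < 1 / real (Suc k)"
        by (auto simp: eventually_sequentially)
      then have "\<omega> \<in> C k N" unfolding C_def using elim(3) by (auto intro: less_imp_le)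
      then show False using k by blast
    qed
  qed
qed

text \<open>All processes are built from one Brownian motion, so bounded convergence on its
  probability space turns almost sure convergence of paths into weak convergence of laws.\<close>

lemma inverse_gaussian_weakly_converges:
  assumes bm: "brownian_motion M B" and ig: "\<And>m. m \<ge> 0 \<Longrightarrow> inverse_gaussian_law M B m (nu m)"
  shows "weakly_converges skorohod nu (nu 0) (at_right 0)"
  unfolding weakly_converges_def
proof (intro allI impI)
  interpret prob_space M by (rule brownian_motion_prob_space[OF bm])
  fix f :: "(real \<Rightarrow> real) \<Rightarrow> real"
  assume "continuous_map skorohod euclideanreal f \<and> bounded (f ` topspace skorohod)"
  then have f: "continuous_map skorohod euclideanreal f" and "bounded (f ` D0)"
    by (auto simp: topspace_skorohod)
  then obtain C where C: "\<And>\<omega>. \<omega> \<in> D0 \<Longrightarrow> norm (f \<omega>) \<le> C" by (auto simp: bounded_iff)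
  have [measurable]: "f \<in> borel_measurable skorohod_borel" by (rule borel_measurable_skorohod[OF f])
  have "\<forall>m. \<exists>V. m \<ge> 0 \<longrightarrow> V \<in> measurable M skorohod_borel \<and>
      (\<forall>t\<ge>0. AE \<omega> in M. V \<omega> t = hitting_time B m t \<omega>) \<and> nu m = distr M skorohod_borel V"
    using ig unfolding inverse_gaussian_law_def by blast
  then obtain V where V: "\<And>m. m \<ge> 0 \<Longrightarrow> V m \<in> measurable M skorohod_borel"
    "\<And>m t. m \<ge> 0 \<Longrightarrow> t \<ge> 0 \<Longrightarrow> AE \<omega> in M. V m \<omega> t = hitting_time B m t \<omega>"
    "\<And>m. m \<ge> 0 \<Longrightarrow> nu m = distr M skorohod_borel (V m)"
    by metis
  have int: "(\<integral>\<omega>. f \<omega> \<partial>nu m) = (\<integral>\<omega>. f (V m \<omega>) \<partial>M)" if "m \<ge> 0" for m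
    using V[OF that] by (simp add: integral_distr)
  have V_D0: "V m \<omega> \<in> D0" if "m \<ge> 0" "\<omega> \<in> space M" for m \<omega>
    using measurable_space[OF V(1)[OF that(1)] that(2)] by simp
  have "AE \<omega> in M. \<forall>p\<in>\<rat>. \<forall>q\<in>\<rat>. \<forall>r\<in>\<rat>. \<forall>u\<in>\<rat>. 0 \<le> p \<longrightarrow> p < q \<longrightarrow> q < r \<longrightarrow> r < u \<longrightarrow>
      Sup ((\<lambda>s. B s \<omega>) ` {p..q}) \<noteq> Sup ((\<lambda>s. B s \<omega>) ` {r..u})"
    by (intro AE_ball_countable[THEN iffD2] countable_rat ballI AE_impI
        brownian_motion_distinct_peaks[OF bm])
  moreover have "AE \<omega> in M. continuous_on {0..} (\<lambda>s. B s \<omega>)" "AE \<omega> in M. B 0 \<omega> = 0"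
    using bm by (simp_all add: brownian_motion_def)
  moreover note brownian_motion_unbounded_above[OF bm]
  ultimately have good: "AE \<omega> in M. \<omega> \<in> space M \<and> continuous_on {0..} (\<lambda>s. B s \<omega>) \<and> B 0 \<omega> = 0 \<and> (\<forall>K. \<exists>s\<ge>0. B s \<omega> > K) \<and>
     (\<forall>p\<in>\<rat>. \<forall>q\<in>\<rat>. \<forall>r\<in>\<rat>. \<forall>u\<in>\<rat>. 0 \<le> p \<longrightarrow> p < q \<longrightarrow> q < r \<longrightarrow> r < u \<longrightarrow>
      Sup ((\<lambda>s. B s \<omega>) ` {p..q}) \<noteq> Sup ((\<lambda>s. B s \<omega>) ` {r..u}))"
    using AE_space by eventually_elim blast
  have hit: "AE \<omega> in M. \<forall>q\<in>\<rat>. q \<ge> 0 \<longrightarrow> V m \<omega> q = hitting_time B m q \<omega>" if "m \<ge> 0" for m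
    by (intro AE_ball_countable[THEN iffD2] countable_rat ballI AE_impI V(2) that)
  \<comment> \<open>The limit is taken along sequences, since the identification with hitting times
    can hold almost surely for only countably many drifts at once.\<close>
  show "((\<lambda>m. \<integral>\<omega>. f \<omega> \<partial>nu m) \<longlongrightarrow> (\<integral>\<omega>. f \<omega> \<partial>nu 0)) (at_right 0)"
    unfolding tendsto_at_iff_sequentially comp_def
  proof (intro allI impI)
    fix m :: "nat \<Rightarrow> real"
    assume "\<forall>i. m i \<in> {0<..} - {0}" and m_lim: "m \<longlonglongrightarrow> 0"
    then have m: "m n \<ge> 0" for n by (simp add: less_imp_le)
    have "AE \<omega> in M. \<forall>n. \<forall>q\<in>\<rat>. q \<ge> 0 \<longrightarrow> V (m n) \<omega> q = hitting_time B (m n) q \<omega>"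
      using hit[OF m] by (simp add: AE_all_countable)
    with good hit[OF order_refl] have conv: "AE \<omega> in M. (\<lambda>n. f (V (m n) \<omega>)) \<longlonglongrightarrow> f (V 0 \<omega>)"
    proof eventually_elim
      case (elim \<omega>)
      let ?b = "\<lambda>s. B s \<omega>"
      have cont: "continuous_on {0..} ?b" and b0: "?b 0 = 0" and unb: "\<And>K. \<exists>s\<ge>0. ?b s > K" and \<omega>: "\<omega> \<in> space M"
        using elim by auto
      have rip: "right_inverse_path (\<lambda>s. ?b s + c * s) (V c \<omega>)"
        if "c \<ge> 0" "\<And>q. q \<in> \<rat> \<Longrightarrow> q \<ge> 0 \<Longrightarrow> V c \<omega> q = hitting_time B c q \<omega>" for c
      proof (rule hitting_right_inverse_path[OF V_D0[OF that(1) \<omega>]])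
        show "continuous_on {0..} (\<lambda>s. ?b s + c * s)" by (intro continuous_intros cont)
        show "\<exists>s\<ge>0. K < ?b s + c * s" for K
        proof -
          obtain s where "s \<ge> 0" "?b s > K" using unb by blast
          moreover have "c * s \<ge> 0" using calculation that by simp
          ultimately show ?thesis by (intro exI[of _ s]) auto
        qed
      qed (use b0 that in \<open>auto simp: hitting_time_def\<close>)
      show ?case
      proof (rule continuous_map_skorohod_tendsto[OF f V_D0[OF order_refl \<omega>]])
        fix \<delta> N :: real assume "\<delta> > 0"
        show "eventually (\<lambda>n. V (m n) \<omega> \<in> skorohod_nbhd (V 0 \<omega>) \<delta> N) sequentially"
        proof (rule right_inverse_path_drift_tendsto[where b = ?b and m = m])
          show "right_inverse_path ?b (V 0 \<omega>)" using rip[of 0] elim by simp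
          show "right_inverse_path (\<lambda>s. ?b s + m n * s) (V (m n) \<omega>)" for n
            using rip[OF m, of n] elim by simp
          show "Sup (?b ` {p..q}) \<noteq> Sup (?b ` {r..u})"
            if "p \<in> \<rat>" "q \<in> \<rat>" "r \<in> \<rat>" "u \<in> \<rat>" "0 \<le> p" "p < q" "q < r" "r < u" for p q r u
            using elim that by blast
        qed (use V_D0 \<omega> m m_lim cont b0 unb \<open>\<delta> > 0\<close> in auto)
      qed
    qed
    have "(\<lambda>n. \<integral>\<omega>. f (V (m n) \<omega>) \<partial>M) \<longlonglongrightarrow> (\<integral>\<omega>. f (V 0 \<omega>) \<partial>M)"
    proof (rule integral_dominated_convergence[where w = "\<lambda>_. C"])
      show "AE \<omega> in M. norm (f (V (m n) \<omega>)) \<le> C" for n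
        using C V_D0[OF m] by (intro AE_I2) auto
    qed (use conv V(1) m in \<open>auto intro!: measurable_compose[OF V(1)]\<close>)
    then show "(\<lambda>n. \<integral>\<omega>. f \<omega> \<partial>nu (m n)) \<longlonglongrightarrow> (\<integral>\<omega>. f \<omega> \<partial>nu 0)"
      using m by (simp add: int)
  qed
qed

section \<open>The inverse Gaussian density\<close>

lemma DERIV_cdf_std_normal:
  "DERIV (cdf std_normal_distribution) x :> std_normal_density x"
proof -
  let ?\<Phi> = "cdf std_normal_distribution"
  interpret N: real_distribution std_normal_distribution by (rule real_dist_normal_dist)
  have cont: "continuous_on A std_normal_density" for A
    unfolding std_normal_density_def by (intro continuous_intros) auto
  have diff: "?\<Phi> u = ?\<Phi> (x - 1) + (LBINT y=x-1..u. std_normal_density y)" if "x - 1 \<le> u" for u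
  proof (cases "x - 1 = u")
    case False
    then have "x - 1 < u" using that by simp
    then have "?\<Phi> u - ?\<Phi> (x - 1) = measure std_normal_distribution {x-1<..u}"
      by (rule N.cdf_diff_eq)
    also have "\<dots> = (\<integral>y. indicator {x-1<..u} y \<partial>std_normal_distribution)" by simp
    also have "\<dots> = (\<integral>y. std_normal_density y *\<^sub>R indicator {x-1<..u} y \<partial>lborel)"
      by (rule integral_density) auto
    also have "\<dots> = (LBINT y=x-1..u. std_normal_density y)"
      using that by (simp add: interval_integral_Ioc set_lebesgue_integral_def mult.commute)
    finally show ?thesis by simp
  qed simp
  have "((\<lambda>u. LBINT y=x-1..u. std_normal_density y) has_vector_derivative std_normal_density x) (at x within {x-1..x+1})"
    by (rule interval_integral_FTC2) (use cont in auto)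
  then have "((\<lambda>u. ?\<Phi> (x - 1) + (LBINT y=x-1..u. std_normal_density y)) has_real_derivative std_normal_density x) (at x within {x-1..x+1})"
    by (intro derivative_eq_intros) (auto simp: has_real_derivative_iff_has_vector_derivative)
  then have "(?\<Phi> has_real_derivative std_normal_density x) (at x within {x-1..x+1})"
    by (rule has_field_derivative_transform_within[where d = 1]) (simp_all only: diff[symmetric] atLeastAtMost_iff, simp_all)
  then show ?thesis by (simp add: at_within_Icc_at)
qed

text \<open>The density of the time at which driftless Brownian motion first reaches level
  \<open>t\<close>, a one-sided stable law of index 1/2; \<open>r * sqrt r\<close> is the power 3/2
  of \<open>r\<close>.\<close>

definition ig_density :: "real \<Rightarrow> real \<Rightarrow> real" where
  "ig_density t r = (if r > 0 then t / sqrt (2 * pi) * exp (- (t\<^sup>2) / (2 * r)) / (r * sqrt r) else 0)"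

lemma ig_density_nonneg: "t \<ge> 0 \<Longrightarrow> ig_density t r \<ge> 0"
  by (simp add: ig_density_def)

lemma ig_density_measurable [measurable]: "ig_density t \<in> borel_measurable borel"
  unfolding ig_density_def[abs_def] by measurable

text \<open>The Laplace transform of \<open>ig_density t\<close> at \<open>k\<^sup>2 / 2\<close>.
  The integrand is the derivative of an explicit \<open>F\<close>, and since it is nonnegative, the
  boundary limits of \<open>F\<close> give integrability together with the value.\<close>

lemma nn_integral_ig_density:
  assumes "t > 0" "k \<ge> 0"
  shows "(\<integral>\<^sup>+r. ennreal (ig_density t r * exp (- (k\<^sup>2) * r / 2)) \<partial>lborel) = ennreal (exp (- t * k))"
proof -
  let ?\<Phi> = "cdf std_normal_distribution"
  interpret N: real_distribution std_normal_distribution by (rule real_dist_normal_dist)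
  define p where "p r = k * sqrt r - t / sqrt r" for r
  define q where "q r = - k * sqrt r - t / sqrt r" for r
  \<comment> \<open>Up to the factor \<open>exp (- t * k)\<close>, this is the inverse Gaussian distribution function.\<close>
  define F where "F r = exp (- t * k) * ?\<Phi> (p r) + exp (t * k) * ?\<Phi> (q r)" for r
  define f where "f r = ig_density t r * exp (- (k\<^sup>2) * r / 2)" for r
  have f_nonneg: "f r \<ge> 0" for r using assms by (simp add: f_def ig_density_nonneg)
  have deriv: "DERIV F r :> f r" if "r > 0" for r
  proof -
    \<comment> \<open>The common factor of both derivatives: completing the squares produces
      \<open>exp (t * k)\<close> and \<open>exp (- t * k)\<close>, which cancel against the
      coefficients in \<open>F\<close>. In \<open>p' + q'\<close> the terms with \<open>k\<close>
      cancel, leaving \<open>t / (r * sqrt r)\<close>.\<close>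
    define E where "E = exp (- (k\<^sup>2) * r / 2) * exp (- (t\<^sup>2) / (2 * r)) / sqrt (2 * pi)"
    have sq: "(p r)\<^sup>2 = k\<^sup>2 * r - 2 * k * t + t\<^sup>2 / r" "(q r)\<^sup>2 = k\<^sup>2 * r + 2 * k * t + t\<^sup>2 / r"
      using that by (simp_all add: p_def q_def power2_diff power_mult_distrib power_divide)
    have P: "std_normal_density (p r) = exp (t * k) * E"
    proof -
      have "- (p r)\<^sup>2 / 2 = t * k + (- (k\<^sup>2) * r / 2 + - (t\<^sup>2) / (2 * r))"
        unfolding sq using that by (simp add: field_simps)
      then have *: "exp (- (p r)\<^sup>2 / 2) = exp (t * k) * (exp (- (k\<^sup>2) * r / 2) * exp (- (t\<^sup>2) / (2 * r)))"
        by (simp only: exp_add)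
      show ?thesis unfolding std_normal_density_def E_def * by simp
    qed
    have Q: "std_normal_density (q r) = exp (- t * k) * E"
    proof -
      have "- (q r)\<^sup>2 / 2 = - t * k + (- (k\<^sup>2) * r / 2 + - (t\<^sup>2) / (2 * r))"
        unfolding sq using that by (simp add: field_simps)
      then have *: "exp (- (q r)\<^sup>2 / 2) = exp (- t * k) * (exp (- (k\<^sup>2) * r / 2) * exp (- (t\<^sup>2) / (2 * r)))"
        by (simp only: exp_add)
      show ?thesis unfolding std_normal_density_def E_def * by simp
    qed
    define p' where "p' = k / (2 * sqrt r) + t / (2 * (r * sqrt r))"
    define q' where "q' = - k / (2 * sqrt r) + t / (2 * (r * sqrt r))"
    have ds: "DERIV sqrt r :> inverse (sqrt r) / 2" by (rule DERIV_real_sqrt[OF that])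
    have di: "DERIV (\<lambda>r. t / sqrt r) r :> (0 * sqrt r - t * (inverse (sqrt r) / 2)) / (sqrt r * sqrt r)"
      by (intro DERIV_divide DERIV_const ds) (use that in simp)
    have dp: "DERIV p r :> p'" unfolding p_def[abs_def] p'_def
      by (rule DERIV_cong[OF DERIV_diff[OF DERIV_cmult[OF ds] di]]) (use that in \<open>simp add: field_simps\<close>)
    have dq: "DERIV q r :> q'" unfolding q_def[abs_def] q'_def
      by (rule DERIV_cong[OF DERIV_diff[OF DERIV_cmult[OF ds] di]]) (use that in \<open>simp add: field_simps\<close>)
    have "DERIV F r :> exp (- t * k) * (std_normal_density (p r) * p') + exp (t * k) * (std_normal_density (q r) * q')"
      unfolding F_def[abs_def]
      by (intro DERIV_add DERIV_cmult DERIV_chain2[OF DERIV_cdf_std_normal] dp dq)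
    also have "exp (- t * k) * (std_normal_density (p r) * p') + exp (t * k) * (std_normal_density (q r) * q')
      = (exp (- t * k) * exp (t * k)) * E * (p' + q')"
      unfolding P Q by (simp add: algebra_simps)
    also have "\<dots> = E * (p' + q')" by (simp add: exp_add[symmetric])
    also have "\<dots> = f r"
      using that by (simp add: p'_def q'_def E_def f_def ig_density_def field_simps)
    finally show ?thesis .
  qed
  have cont: "isCont f r" if "r > 0" for r
  proof -
    let ?g = "\<lambda>r. t / sqrt (2 * pi) * exp (- (t\<^sup>2) / (2 * r)) / (r * sqrt r) * exp (- (k\<^sup>2) * r / 2)"
    have "isCont ?g r" using that by (intro continuous_intros) auto
    moreover have "eventually (\<lambda>s. s \<in> {0<..}) (nhds r)" using that by (intro eventually_nhds_in_open) auto
    then have "eventually (\<lambda>s. ?g s = f s) (nhds r)" by eventually_elim (simp add: f_def ig_density_def)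
    ultimately show ?thesis by (simp add: isCont_cong)
  qed
  have top: "(?\<Phi> \<longlongrightarrow> 1) at_top" and bot: "(?\<Phi> \<longlongrightarrow> 0) at_bot"
    by (rule N.cdf_lim_at_top_prob N.cdf_lim_at_bot)+
  have A: "(F \<longlongrightarrow> 0) (at_right 0)"
  proof -
    have "filterlim p at_bot (at_right 0)" "filterlim q at_bot (at_right 0)"
      unfolding p_def q_def using \<open>t > 0\<close> by real_asymp+
    then have "((\<lambda>r. ?\<Phi> (p r)) \<longlongrightarrow> 0) (at_right 0)" "((\<lambda>r. ?\<Phi> (q r)) \<longlongrightarrow> 0) (at_right 0)"
      by (auto intro: filterlim_compose[OF bot])
    then have "(F \<longlongrightarrow> exp (- t * k) * 0 + exp (t * k) * 0) (at_right 0)"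
      unfolding F_def by (intro tendsto_intros)
    then show ?thesis by simp
  qed
  have B: "(F \<longlongrightarrow> exp (- t * k)) at_top"
  \<comment> \<open>For \<open>k = 0\<close> both arguments tend to 0 rather than to opposite
    infinities, and the limit is twice \<open>?\<Phi> 0\<close>, known from the symmetry of the
    normal law.\<close>
  proof (cases "k = 0")
    case True
    have "isCont ?\<Phi> 0" by (rule DERIV_isCont[OF DERIV_cdf_std_normal])
    moreover have "(p \<longlongrightarrow> 0) at_top" "(q \<longlongrightarrow> 0) at_top"
      unfolding p_def q_def True by real_asymp+
    ultimately have "((\<lambda>r. ?\<Phi> (p r)) \<longlongrightarrow> ?\<Phi> 0) at_top" "((\<lambda>r. ?\<Phi> (q r)) \<longlongrightarrow> ?\<Phi> 0) at_top"
      by (auto intro: isCont_tendsto_compose)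
    then have "(F \<longlongrightarrow> exp (- t * k) * ?\<Phi> 0 + exp (t * k) * ?\<Phi> 0) at_top"
      unfolding F_def by (intro tendsto_intros)
    moreover have "?\<Phi> 0 = 1 / 2"
    proof -
      have "((\<lambda>x. ?\<Phi> x + ?\<Phi> (- x)) \<longlongrightarrow> 1 + 0) at_top"
        by (intro tendsto_add top filterlim_compose[OF bot filterlim_uminus_at_bot_at_top])
      moreover have "?\<Phi> x + ?\<Phi> (- x) = ?\<Phi> 0 + ?\<Phi> (- 0)" for x
      proof (rule DERIV_isconst_all[of "\<lambda>x. ?\<Phi> x + ?\<Phi> (- x)"], intro allI)
        fix x :: real
        have "DERIV (\<lambda>x. ?\<Phi> x + ?\<Phi> (- x)) x :> std_normal_density x + std_normal_density (- x) * (- 1)"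
          by (intro DERIV_add DERIV_cdf_std_normal DERIV_chain2[OF DERIV_cdf_std_normal]) (auto intro!: derivative_eq_intros)
        then show "DERIV (\<lambda>x. ?\<Phi> x + ?\<Phi> (- x)) x :> 0" by (simp add: std_normal_density_def)
      qed
      ultimately have "((\<lambda>x::real. ?\<Phi> 0 + ?\<Phi> 0) \<longlongrightarrow> 1) at_top" by simp
      then have "?\<Phi> 0 + ?\<Phi> 0 = 1" by (rule tendsto_unique[OF trivial_limit_at_top_linorder tendsto_const])
      then show ?thesis by simp
    qed
    ultimately show ?thesis using True by simp
  next
    case False
    then have "k > 0" using assms by simp
    then have "filterlim p at_top at_top" "filterlim q at_bot at_top"
      unfolding p_def q_def by real_asymp+
    then have "((\<lambda>r. ?\<Phi> (p r)) \<longlongrightarrow> 1) at_top" "((\<lambda>r. ?\<Phi> (q r)) \<longlongrightarrow> 0) at_top"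
      by (auto intro: filterlim_compose[OF top] filterlim_compose[OF bot])
    then have "(F \<longlongrightarrow> exp (- t * k) * 1 + exp (t * k) * 0) at_top"
      unfolding F_def by (intro tendsto_intros)
    then show ?thesis by simp
  qed
  have A': "((F \<circ> real_of_ereal) \<longlongrightarrow> 0) (at_right (ereal 0))"
    using A by (simp add: ereal_tendsto_simps1)
  have B': "((F \<circ> real_of_ereal) \<longlongrightarrow> exp (- t * k)) (at_left \<infinity>)"
    using B by (simp add: ereal_tendsto_simps1)
  have int: "set_integrable lborel (einterval 0 \<infinity>) f" "(LBINT r=0..\<infinity>. f r) = exp (- t * k) - 0"
    by (rule interval_integral_FTC_nonneg[of 0 \<infinity> F f];
      use deriv cont f_nonneg A' B' in \<open>auto simp: zero_ereal_def\<close>)+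
  have eint: "einterval 0 \<infinity> = {0<..}" by (auto simp: einterval_def zero_ereal_def)
  have f_ind: "f = (\<lambda>r. indicator {0<..} r *\<^sub>R f r)"
    by (auto simp: f_def ig_density_def fun_eq_iff indicator_def)
  have "integrable lborel f" using int(1) unfolding set_integrable_def eint f_ind[symmetric] .
  moreover have "(\<integral>r. f r \<partial>lborel) = exp (- t * k)"
    using int(2) arg_cong[OF f_ind, of "integral\<^sup>L lborel"]
    unfolding interval_lebesgue_integral_def set_lebesgue_integral_def eint by simp
  ultimately show ?thesis
    using nn_integral_eq_integral[of lborel f] f_nonneg unfolding f_def by simp
qed

section \<open>Gaussian measures and uniqueness of characteristic functions\<close>

definition std_gaussian :: "'a::euclidean_space measure" where
  "std_gaussian = distr (PiM Basis (\<lambda>_. std_normal_distribution)) borel (\<lambda>x. \<Sum>b\<in>Basis. x b *\<^sub>R b)"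

lemma std_gaussian_combination_measurable:
  "(\<lambda>x. \<Sum>b\<in>Basis. x b *\<^sub>R b) \<in> measurable (PiM Basis (\<lambda>_. std_normal_distribution)) (borel :: 'a::euclidean_space measure)"
proof (intro borel_measurable_sum borel_measurable_scaleR)
  fix b :: 'a assume "b \<in> Basis"
  then have "(\<lambda>x. x b) \<in> measurable (PiM Basis (\<lambda>_. std_normal_distribution)) std_normal_distribution"
    by (rule measurable_component_singleton)
  then show "(\<lambda>x. x b) \<in> borel_measurable (PiM Basis (\<lambda>_. std_normal_distribution))"
    by (simp cong: measurable_cong_sets)
qed auto

lemma sets_std_gaussian [simp, measurable_cong]: "sets std_gaussian = sets borel"
  by (simp add: std_gaussian_def)

lemma space_std_gaussian [simp]: "space std_gaussian = UNIV"
  by (simp add: std_gaussian_def)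

lemma prob_space_std_gaussian: "prob_space (std_gaussian :: 'a::euclidean_space measure)"
proof -
  interpret N: prob_space std_normal_distribution by (rule prob_space_normal_density) simp
  interpret product_prob_space "\<lambda>_::'a. std_normal_distribution" Basis ..
  show ?thesis
    unfolding std_gaussian_def by (rule prob_space_distr[OF std_gaussian_combination_measurable])
qed

lemma char_std_gaussian:
  fixes \<xi> :: "'a::euclidean_space"
  shows "(CLINT z|std_gaussian. iexp (\<xi> \<bullet> z)) = complex_of_real (exp (- (norm \<xi>)\<^sup>2 / 2))"
proof -
  interpret N: real_distribution std_normal_distribution by (rule real_dist_normal_dist)
  interpret P: product_sigma_finite "\<lambda>_::'a. std_normal_distribution" ..
  have "(CLINT z|std_gaussian. iexp (\<xi> \<bullet> z))
      = (CLINT x|PiM Basis (\<lambda>_. std_normal_distribution). iexp (\<xi> \<bullet> (\<Sum>b\<in>Basis. x b *\<^sub>R b)))"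
    unfolding std_gaussian_def by (rule integral_distr[OF std_gaussian_combination_measurable]) measurable
  also have "\<dots> = (CLINT x|PiM Basis (\<lambda>_. std_normal_distribution). (\<Prod>b\<in>Basis. iexp ((\<xi> \<bullet> b) * x b)))"
    by (intro Bochner_Integration.integral_cong refl)
      (simp add: inner_sum_right exp_sum[symmetric] sum_distrib_left mult.commute)
  also have "\<dots> = (\<Prod>b\<in>Basis. (CLINT y|std_normal_distribution. iexp ((\<xi> \<bullet> b) * y)))"
    by (rule P.product_integral_prod) (auto intro: N.integrable_iexp)
  also have "\<dots> = (\<Prod>b\<in>Basis. complex_of_real (exp (- (\<xi> \<bullet> b)\<^sup>2 / 2)))"
    using char_std_normal_distribution by (simp add: char_def fun_eq_iff)
  also have "\<dots> = complex_of_real (exp (\<Sum>b\<in>Basis. - (\<xi> \<bullet> b)\<^sup>2 / 2))"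
    by (simp add: exp_sum)
  also have "(\<Sum>b\<in>Basis. - (\<xi> \<bullet> b)\<^sup>2 / 2) = - (norm \<xi>)\<^sup>2 / 2"
    unfolding power2_norm_eq_inner euclidean_inner[of \<xi> \<xi>]
    by (simp add: sum_divide_distrib sum_negf power2_eq_square)
  finally show ?thesis .
qed

section \<open>Gaussian smoothing and the uniqueness theorem\<close>

lemma integrable_iexp_finite_measure:
  fixes g :: "'b \<Rightarrow> real"
  assumes "finite_measure M" "g \<in> borel_measurable M"
  shows "integrable M (\<lambda>x. iexp (g x))"
proof -
  interpret finite_measure M by fact
  show ?thesis
    by (rule integrable_const_bound[where B = 1]) (use assms(2) in auto)
qed

text \<open>The Gaussian bump is itself a characteristic function. Writing it as a Gaussian average
  of \<open>iexp\<close> and exchanging the integrals leaves only the characteristic function of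
  \<open>\<mu>\<close>.\<close>

lemma gaussian_bump_eq_char:
  fixes \<mu> :: "'a::euclidean_space measure"
  assumes "prob_space \<mu>" and sets: "sets \<mu> = sets borel"
  shows "complex_of_real (\<integral>x. exp (- (norm (s *\<^sub>R (y - x)))\<^sup>2 / 2) \<partial>\<mu>)
    = (CLINT z|std_gaussian. iexp (- s * (z \<bullet> y)) * (CLINT x|\<mu>. iexp ((s *\<^sub>R z) \<bullet> x)))"
proof -
  interpret \<mu>: prob_space \<mu> by fact
  interpret G: prob_space "std_gaussian :: 'a measure" by (rule prob_space_std_gaussian)
  interpret P: pair_prob_space "std_gaussian :: 'a measure" \<mu> ..
  note [measurable_cong] = sets
  have "complex_of_real (\<integral>x. exp (- (norm (s *\<^sub>R (y - x)))\<^sup>2 / 2) \<partial>\<mu>)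
      = (CLINT x|\<mu>. complex_of_real (exp (- (norm (s *\<^sub>R (x - y)))\<^sup>2 / 2)))"
    by (simp add: norm_minus_commute)
  also have "\<dots> = (CLINT x|\<mu>. (CLINT z|std_gaussian. iexp ((s *\<^sub>R (x - y)) \<bullet> z)))"
    unfolding char_std_gaussian ..
  also have "\<dots> = (CLINT z|std_gaussian. (CLINT x|\<mu>. iexp ((s *\<^sub>R (x - y)) \<bullet> z)))"
    by (rule P.Fubini_integral, unfold case_prod_beta',
        rule integrable_iexp_finite_measure[OF P.finite_measure_axioms]) measurable
  also have "\<dots> = (CLINT z|std_gaussian. (CLINT x|\<mu>. iexp (- s * (z \<bullet> y)) * iexp ((s *\<^sub>R z) \<bullet> x)))"
    by (intro Bochner_Integration.integral_cong refl)
      (simp add: exp_add[symmetric] inner_diff_left inner_commute algebra_simps)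
  finally show ?thesis by simp
qed

text \<open>Finiteness provides the dominating function; together with non-vanishing it lets the
  kernel mass be cancelled in \<open>ennreal\<close>.\<close>

lemma gaussian_kernel_nn_integral:
  defines "E \<equiv> \<lambda>x::'a::euclidean_space. exp (- (norm x)\<^sup>2 / 2)"
  shows "(\<integral>\<^sup>+x. ennreal (E x) \<partial>lborel) \<noteq> \<infinity>" "(\<integral>\<^sup>+x. ennreal (E x) \<partial>lborel) \<noteq> 0"
proof -
  have E: "ennreal (E x) = (\<Prod>b\<in>Basis. ennreal (exp (- (x \<bullet> b)\<^sup>2 / 2)))" for x
  proof -
    have "- (norm x)\<^sup>2 / 2 = (\<Sum>b\<in>Basis. - (x \<bullet> b)\<^sup>2 / 2)"
      unfolding power2_norm_eq_inner euclidean_inner[of x x]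
      by (simp add: sum_divide_distrib sum_negf power2_eq_square)
    then show ?thesis unfolding E_def by (simp add: exp_sum prod_ennreal)
  qed
  have "(\<integral>\<^sup>+x. ennreal (E x) \<partial>(lborel::'a measure)) = (\<Prod>b\<in>(Basis :: 'a set). (\<integral>\<^sup>+y. ennreal (exp (- y\<^sup>2 / 2)) \<partial>lborel))"
    unfolding E by (rule nn_integral_lborel_prod) auto
  moreover have "(\<integral>\<^sup>+y. ennreal (exp (- y\<^sup>2 / 2)) \<partial>lborel) = ennreal (sqrt (2 * pi))"
  proof -
    interpret N: prob_space std_normal_distribution by (rule prob_space_normal_density) simp
    have "1 = emeasure std_normal_distribution UNIV" using N.emeasure_space_1 by simp
    also have "\<dots> = (\<integral>\<^sup>+y. ennreal (std_normal_density y) \<partial>lborel)" by (simp add: emeasure_density)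
    finally have "1 = (\<integral>\<^sup>+y. ennreal (std_normal_density y) \<partial>lborel)" .
    moreover have "(\<integral>\<^sup>+y. ennreal (exp (- y\<^sup>2 / 2)) \<partial>lborel) = (\<integral>\<^sup>+y. ennreal (sqrt (2 * pi)) * ennreal (std_normal_density y) \<partial>lborel)"
      by (intro nn_integral_cong) (simp add: std_normal_density_def ennreal_mult[symmetric])
    ultimately show ?thesis by (simp add: nn_integral_cmult)
  qed
  ultimately have *: "(\<integral>\<^sup>+x. ennreal (E x) \<partial>(lborel::'a measure)) = ennreal (sqrt (2 * pi) ^ DIM('a))"
    by (simp add: ennreal_power)
  show "(\<integral>\<^sup>+x. ennreal (E x) \<partial>lborel) \<noteq> \<infinity>" "(\<integral>\<^sup>+x. ennreal (E x) \<partial>lborel) \<noteq> 0"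
    unfolding * by (simp_all add: ennreal_eq_0_iff not_le)
qed

text \<open>Substituting \<open>y = x + (1 / s) *\<^sub>R z\<close> moves the dependence on
  \<open>\<mu>\<close> into the averaged bump, the quantity that the characteristic function
  determines.\<close>

lemma gaussian_smoothing_integral:
  fixes \<mu> :: "'a::euclidean_space measure" and h :: "'a \<Rightarrow> real"
  assumes "prob_space \<mu>" and sets: "sets \<mu> = sets borel" and [measurable]: "h \<in> borel_measurable borel"
    and "s > 0"
  defines "E \<equiv> \<lambda>x::'a. exp (- (norm x)\<^sup>2 / 2)"
  shows "(\<integral>\<^sup>+x. (\<integral>\<^sup>+z. ennreal (h (x + (1 / s) *\<^sub>R z)) * ennreal (E z) \<partial>lborel) \<partial>\<mu>)
    = ennreal (s ^ DIM('a)) * (\<integral>\<^sup>+y. ennreal (h y) * ennreal (\<integral>x. E (s *\<^sub>R (y - x)) \<partial>\<mu>) \<partial>lborel)"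
proof -
  interpret \<mu>: prob_space \<mu> by fact
  interpret P: pair_sigma_finite \<mu> "lborel :: 'a measure"
    by (intro pair_sigma_finite.intro \<mu>.sigma_finite_measure_axioms sigma_finite_lborel)
  note [measurable_cong] = sets
  have [measurable]: "E \<in> borel_measurable borel" unfolding E_def by measurable
  have subst: "(\<integral>\<^sup>+z. ennreal (h (x + (1 / s) *\<^sub>R z)) * ennreal (E z) \<partial>lborel)
      = ennreal (s ^ DIM('a)) * (\<integral>\<^sup>+y. ennreal (h y) * ennreal (E (s *\<^sub>R (y - x))) \<partial>lborel)" for x
  proof -
    have "(\<integral>\<^sup>+y. ennreal (h y) * ennreal (E (s *\<^sub>R (y - x))) \<partial>lborel)
      = (\<integral>\<^sup>+y. ennreal (h y) * ennreal (E (s *\<^sub>R (y - x)))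
          \<partial>density (distr lborel borel (\<lambda>z. x + (1 / s) *\<^sub>R z)) (\<lambda>_. \<bar>1 / s\<bar> ^ DIM('a)))"
      using lborel_affine[of "1 / s" x] \<open>s > 0\<close> by simp
    also have "\<dots> = (\<integral>\<^sup>+z. ennreal (\<bar>1 / s\<bar> ^ DIM('a)) * (ennreal (h (x + (1 / s) *\<^sub>R z)) * ennreal (E z)) \<partial>lborel)"
      using \<open>s > 0\<close> by (simp add: nn_integral_density nn_integral_distr)
    also have "\<dots> = ennreal (\<bar>1 / s\<bar> ^ DIM('a)) * (\<integral>\<^sup>+z. ennreal (h (x + (1 / s) *\<^sub>R z)) * ennreal (E z) \<partial>lborel)"
      by (rule nn_integral_cmult) measurable
    finally have "ennreal (s ^ DIM('a)) * (\<integral>\<^sup>+y. ennreal (h y) * ennreal (E (s *\<^sub>R (y - x))) \<partial>lborel)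
      = (ennreal (s ^ DIM('a)) * ennreal (\<bar>1 / s\<bar> ^ DIM('a))) * (\<integral>\<^sup>+z. ennreal (h (x + (1 / s) *\<^sub>R z)) * ennreal (E z) \<partial>lborel)"
      by (simp add: mult.assoc)
    also have "ennreal (s ^ DIM('a)) * ennreal (\<bar>1 / s\<bar> ^ DIM('a)) = 1"
      using \<open>s > 0\<close> by (simp add: ennreal_mult[symmetric] power_mult_distrib[symmetric])
    finally show ?thesis by simp
  qed
  have "(\<integral>\<^sup>+x. (\<integral>\<^sup>+y. ennreal (h y) * ennreal (E (s *\<^sub>R (y - x))) \<partial>lborel) \<partial>\<mu>)
      = (\<integral>\<^sup>+y. (\<integral>\<^sup>+x. ennreal (h y) * ennreal (E (s *\<^sub>R (y - x))) \<partial>\<mu>) \<partial>lborel)"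
    by (rule P.Fubini'[symmetric]) measurable
  also have "\<dots> = (\<integral>\<^sup>+y. ennreal (h y) * ennreal (\<integral>x. E (s *\<^sub>R (y - x)) \<partial>\<mu>) \<partial>lborel)"
  proof (intro nn_integral_cong)
    fix y
    have "integrable \<mu> (\<lambda>x. E (s *\<^sub>R (y - x)))"
      by (rule \<mu>.integrable_const_bound[where B = 1]) (auto simp: E_def)
    then have "(\<integral>\<^sup>+x. ennreal (E (s *\<^sub>R (y - x))) \<partial>\<mu>) = ennreal (\<integral>x. E (s *\<^sub>R (y - x)) \<partial>\<mu>)"
      by (rule nn_integral_eq_integral) (simp add: E_def)
    moreover have "(\<integral>\<^sup>+x. ennreal (h y) * ennreal (E (s *\<^sub>R (y - x))) \<partial>\<mu>)
      = ennreal (h y) * (\<integral>\<^sup>+x. ennreal (E (s *\<^sub>R (y - x))) \<partial>\<mu>)"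
      by (rule nn_integral_cmult) measurable
    ultimately show "(\<integral>\<^sup>+x. ennreal (h y) * ennreal (E (s *\<^sub>R (y - x))) \<partial>\<mu>)
      = ennreal (h y) * ennreal (\<integral>x. E (s *\<^sub>R (y - x)) \<partial>\<mu>)" by simp
  qed
  finally have eq: "(\<integral>\<^sup>+x. (\<integral>\<^sup>+y. ennreal (h y) * ennreal (E (s *\<^sub>R (y - x))) \<partial>lborel) \<partial>\<mu>) = \<dots>" .
  show ?thesis unfolding subst eq[symmetric] by (rule nn_integral_cmult) measurable
qed

text \<open>The noise has scale \<open>1 / Suc n\<close>. On the product measure one dominated
  convergence with bound \<open>E\<close> handles both integrals.\<close>

lemma gaussian_smoothing_tendsto:
  fixes \<mu> :: "'a::euclidean_space measure" and h :: "'a \<Rightarrow> real"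
  assumes "prob_space \<mu>" and sets: "sets \<mu> = sets borel"
    and h: "continuous_on UNIV h" "\<And>x. h x \<in> {0..1}"
  defines "E \<equiv> \<lambda>x::'a. exp (- (norm x)\<^sup>2 / 2)"
  shows "(\<lambda>n. \<integral>\<^sup>+x. (\<integral>\<^sup>+z. ennreal (h (x + (1 / real (Suc n)) *\<^sub>R z)) * ennreal (E z) \<partial>lborel) \<partial>\<mu>)
    \<longlonglongrightarrow> (\<integral>\<^sup>+x. ennreal (h x) \<partial>\<mu>) * (\<integral>\<^sup>+z. ennreal (E z) \<partial>lborel)"
proof -
  interpret \<mu>: prob_space \<mu> by fact
  interpret P: pair_sigma_finite \<mu> "lborel :: 'a measure"
    by (intro pair_sigma_finite.intro \<mu>.sigma_finite_measure_axioms sigma_finite_lborel)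
  note [measurable_cong] = sets
  have [measurable]: "E \<in> borel_measurable borel" unfolding E_def by measurable
  have [measurable]: "h \<in> borel_measurable borel" by (rule borel_measurable_continuous_onI[OF h(1)])
  have "(\<lambda>n. \<integral>\<^sup>+p. ennreal (h (fst p + (1 / real (Suc n)) *\<^sub>R snd p)) * ennreal (E (snd p)) \<partial>(\<mu> \<Otimes>\<^sub>M lborel))
    \<longlonglongrightarrow> (\<integral>\<^sup>+p. ennreal (h (fst p)) * ennreal (E (snd p)) \<partial>(\<mu> \<Otimes>\<^sub>M lborel))"
  proof (rule nn_integral_dominated_convergence[where w = "\<lambda>p. ennreal (E (snd p))"])
    show "AE p in \<mu> \<Otimes>\<^sub>M lborel. ennreal (h (fst p + (1 / real (Suc n)) *\<^sub>R snd p)) * ennreal (E (snd p)) \<le> ennreal (E (snd p))" for n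
    proof (rule AE_I2)
      fix p :: "'a \<times> 'a"
      have "ennreal (h (fst p + (1 / real (Suc n)) *\<^sub>R snd p)) \<le> 1" using h(2) by (simp add: ennreal_le_1)
      then show "ennreal (h (fst p + (1 / real (Suc n)) *\<^sub>R snd p)) * ennreal (E (snd p)) \<le> ennreal (E (snd p))"
        using mult_right_mono[of "ennreal (h (fst p + (1 / real (Suc n)) *\<^sub>R snd p))" 1 "ennreal (E (snd p))"] by simp
    qed
    have "(\<integral>\<^sup>+p. ennreal (E (snd p)) \<partial>(\<mu> \<Otimes>\<^sub>M lborel)) = (\<integral>\<^sup>+x. (\<integral>\<^sup>+z. ennreal (E z) \<partial>lborel) \<partial>\<mu>)"
      by (subst lborel.nn_integral_fst[symmetric]) auto
    also have "\<dots> = (\<integral>\<^sup>+z. ennreal (E z) \<partial>lborel)" by (simp add: \<mu>.emeasure_space_1)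
    also have "\<dots> < \<infinity>" using gaussian_kernel_nn_integral(1)[where 'a = 'a] by (simp add: E_def less_top)
    finally show "(\<integral>\<^sup>+p. ennreal (E (snd p)) \<partial>(\<mu> \<Otimes>\<^sub>M lborel)) < \<infinity>" .
    show "AE p in \<mu> \<Otimes>\<^sub>M lborel. (\<lambda>n. ennreal (h (fst p + (1 / real (Suc n)) *\<^sub>R snd p)) * ennreal (E (snd p)))
      \<longlonglongrightarrow> ennreal (h (fst p)) * ennreal (E (snd p))"
    proof (rule AE_I2)
      fix p :: "'a \<times> 'a"
      have "(\<lambda>n. fst p + (1 / real (Suc n)) *\<^sub>R snd p) \<longlonglongrightarrow> fst p + 0 *\<^sub>R snd p"
        by (intro tendsto_intros LIMSEQ_Suc[OF lim_1_over_n])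
      then have "(\<lambda>n. h (fst p + (1 / real (Suc n)) *\<^sub>R snd p)) \<longlonglongrightarrow> h (fst p)"
        by (intro continuous_on_tendsto_compose[OF h(1)]) auto
      then have "(\<lambda>n. ennreal (h (fst p + (1 / real (Suc n)) *\<^sub>R snd p) * E (snd p))) \<longlonglongrightarrow> ennreal (h (fst p) * E (snd p))"
        by (intro tendsto_ennrealI tendsto_mult tendsto_const)
      moreover have "ennreal (h x * E (snd p)) = ennreal (h x) * ennreal (E (snd p))" for x
        using h(2)[of x] by (intro ennreal_mult) (auto simp: E_def)
      ultimately show "(\<lambda>n. ennreal (h (fst p + (1 / real (Suc n)) *\<^sub>R snd p)) * ennreal (E (snd p)))
        \<longlonglongrightarrow> ennreal (h (fst p)) * ennreal (E (snd p))" by simp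
    qed
  qed measurable
  moreover have "(\<integral>\<^sup>+p. ennreal (h (fst p + c *\<^sub>R snd p)) * ennreal (E (snd p)) \<partial>(\<mu> \<Otimes>\<^sub>M lborel))
      = (\<integral>\<^sup>+x. (\<integral>\<^sup>+z. ennreal (h (x + c *\<^sub>R z)) * ennreal (E z) \<partial>lborel) \<partial>\<mu>)" for c
    by (subst lborel.nn_integral_fst[symmetric]) auto
  moreover from this[of 0] have "(\<integral>\<^sup>+p. ennreal (h (fst p)) * ennreal (E (snd p)) \<partial>(\<mu> \<Otimes>\<^sub>M lborel))
      = (\<integral>\<^sup>+x. (\<integral>\<^sup>+z. ennreal (h x) * ennreal (E z) \<partial>lborel) \<partial>\<mu>)" by simp
  moreover have "(\<integral>\<^sup>+x. (\<integral>\<^sup>+z. ennreal (h x) * ennreal (E z) \<partial>lborel) \<partial>\<mu>) = (\<integral>\<^sup>+x. ennreal (h x) \<partial>\<mu>) * (\<integral>\<^sup>+z. ennreal (E z) \<partial>lborel)"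
    by (simp add: nn_integral_cmult nn_integral_multc)
  ultimately show ?thesis by (simp only:)
qed

text \<open>Indicators of closed sets are limits of continuous functions, and closed sets are a
  generator stable under intersection.\<close>

lemma borel_measure_eqI_continuous:
  fixes \<mu> \<nu> :: "'a::euclidean_space measure"
  assumes "prob_space \<mu>" "prob_space \<nu>" and sets: "sets \<mu> = sets borel" "sets \<nu> = sets borel"
    and eq: "\<And>h :: 'a \<Rightarrow> real. continuous_on UNIV h \<Longrightarrow> (\<And>x. h x \<in> {0..1}) \<Longrightarrow>
      (\<integral>\<^sup>+x. ennreal (h x) \<partial>\<mu>) = (\<integral>\<^sup>+x. ennreal (h x) \<partial>\<nu>)"
  shows "\<mu> = \<nu>"
proof -
  interpret \<mu>: prob_space \<mu> by fact
  interpret \<nu>: prob_space \<nu> by fact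
  have space: "space \<mu> = UNIV" "space \<nu> = UNIV" using sets by (auto dest: sets_eq_imp_space_eq)
  have closed: "emeasure \<mu> C = emeasure \<nu> C" if "closed C" for C
  \<comment> \<open>The empty set is separate: \<open>infdist\<close> to it is 0, so every
    \<open>h k\<close> would be 1.\<close>
  proof (cases "C = {}")
    case False
    define h where "h k x = max 0 (1 - real k * infdist x C)" for k x
    have h: "continuous_on UNIV (h k)" "h k x \<in> {0..1}" for k x
      by (auto simp: h_def infdist_nonneg intro!: continuous_intros)
    have lim: "(\<lambda>k. \<integral>\<^sup>+x. ennreal (h k x) \<partial>M) \<longlonglongrightarrow> (\<integral>\<^sup>+x. indicator C x \<partial>M)"
      if "prob_space M" "sets M = sets borel" for M
    proof (rule nn_integral_dominated_convergence[where w = "\<lambda>_. 1"])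
      interpret prob_space M by fact
      note [measurable_cong] = that(2)
      have [measurable]: "h k \<in> borel_measurable borel" for k by (rule borel_measurable_continuous_onI[OF h(1)])
      have [measurable]: "C \<in> sets borel" using \<open>closed C\<close> by (rule borel_closed)
      show "(\<lambda>x. ennreal (h k x)) \<in> borel_measurable M" for k by measurable
      show "(\<lambda>x. indicator C x) \<in> borel_measurable M" by measurable
      show "(\<integral>\<^sup>+x. 1 \<partial>M) < \<infinity>" by (simp add: emeasure_space_1)
      show "AE x in M. ennreal (h k x) \<le> 1" for k using h(2) by (intro AE_I2) (simp add: ennreal_le_1)
      show "AE x in M. (\<lambda>k. ennreal (h k x)) \<longlonglongrightarrow> indicator C x"
      proof (rule AE_I2)
        fix x
        show "(\<lambda>k. ennreal (h k x)) \<longlonglongrightarrow> indicator C x"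
        proof (cases "x \<in> C")
          case True then show ?thesis by (simp add: h_def)
        next
          case False
          then have "infdist x C > 0"
            using \<open>closed C\<close> \<open>C \<noteq> {}\<close> infdist_nonneg[of x C] in_closed_iff_infdist_zero[of C x] by force
          moreover obtain k0 where "1 < real k0 * infdist x C"
            using reals_Archimedean3[OF \<open>infdist x C > 0\<close>] by blast
          ultimately have "h k x = 0" if "k \<ge> k0" for k
          proof -
            have "real k0 * infdist x C \<le> real k * infdist x C"
              using that infdist_nonneg by (intro mult_right_mono) auto
            then show ?thesis using \<open>1 < real k0 * infdist x C\<close> by (simp add: h_def)
          qed
          then have "eventually (\<lambda>k. ennreal (h k x) = 0) sequentially"
            unfolding eventually_sequentially by (intro exI[of _ k0]) simp
          then show ?thesis using False by (simp add: tendsto_eventually)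
        qed
      qed
    qed (simp)
    have "(\<lambda>k. \<integral>\<^sup>+x. ennreal (h k x) \<partial>\<nu>) \<longlonglongrightarrow> (\<integral>\<^sup>+x. indicator C x \<partial>\<mu>)"
      using lim[OF assms(1) sets(1)] eq[OF h] by simp
    then have "(\<integral>\<^sup>+x. indicator C x \<partial>\<mu>) = (\<integral>\<^sup>+x. indicator C x \<partial>\<nu>)"
      by (rule LIMSEQ_unique[OF _ lim[OF assms(2) sets(2)]])
    then show ?thesis using sets borel_closed[OF that] by simp
  qed simp
  show ?thesis
  proof (rule measure_eqI_generator_eq[where E = "{C. closed C}" and \<Omega> = UNIV and A = "\<lambda>_. UNIV"])
    show "Int_stable {C::'a set. closed C}" by (auto simp: Int_stable_def)
    show "sets \<mu> = sigma_sets UNIV {C. closed C}" "sets \<nu> = sigma_sets UNIV {C. closed C}"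
      unfolding sets by (simp_all add: borel_eq_closed)
  qed (use closed \<mu>.emeasure_space_1 space in auto)
qed

text \<open>Equal characteristic functions give equal Gaussian smoothings at every scale; as the
  scale tends to zero the integrals of continuous functions agree.\<close>

theorem char_uniqueness_euclidean:
  fixes \<mu> \<nu> :: "'a::euclidean_space measure"
  assumes "prob_space \<mu>" "prob_space \<nu>" and sets: "sets \<mu> = sets borel" "sets \<nu> = sets borel"
    and eq: "\<And>\<xi>. (CLINT x|\<mu>. iexp (\<xi> \<bullet> x)) = (CLINT x|\<nu>. iexp (\<xi> \<bullet> x))"
  shows "\<mu> = \<nu>"
proof (rule borel_measure_eqI_continuous[OF assms(1-4)])
  fix h :: "'a \<Rightarrow> real" assume h: "continuous_on UNIV h" "\<And>x. h x \<in> {0..1}"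
  have [measurable]: "h \<in> borel_measurable borel" by (rule borel_measurable_continuous_onI[OF h(1)])
  define E where "E = (\<lambda>x::'a. exp (- (norm x)\<^sup>2 / 2))"
  have bump: "(\<integral>x. E (s *\<^sub>R (y - x)) \<partial>\<mu>) = (\<integral>x. E (s *\<^sub>R (y - x)) \<partial>\<nu>)" for s y
  proof -
    have "complex_of_real (\<integral>x. E (s *\<^sub>R (y - x)) \<partial>\<mu>) = complex_of_real (\<integral>x. E (s *\<^sub>R (y - x)) \<partial>\<nu>)"
      unfolding E_def gaussian_bump_eq_char[OF assms(1) sets(1)] gaussian_bump_eq_char[OF assms(2) sets(2)] eq ..
    then show ?thesis by (simp only: of_real_eq_iff)
  qed
  have smooth: "(\<integral>\<^sup>+x. (\<integral>\<^sup>+z. ennreal (h (x + (1 / real (Suc n)) *\<^sub>R z)) * ennreal (E z) \<partial>lborel) \<partial>\<rho>)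
      = ennreal (real (Suc n) ^ DIM('a)) * (\<integral>\<^sup>+y. ennreal (h y) * ennreal (\<integral>x. E (real (Suc n) *\<^sub>R (y - x)) \<partial>\<rho>) \<partial>lborel)"
    if "prob_space \<rho>" "sets \<rho> = sets borel" for \<rho> n
    unfolding E_def by (rule gaussian_smoothing_integral) (use that in auto)
  have "(\<integral>\<^sup>+x. (\<integral>\<^sup>+z. ennreal (h (x + (1 / real (Suc n)) *\<^sub>R z)) * ennreal (E z) \<partial>lborel) \<partial>\<mu>)
    = (\<integral>\<^sup>+x. (\<integral>\<^sup>+z. ennreal (h (x + (1 / real (Suc n)) *\<^sub>R z)) * ennreal (E z) \<partial>lborel) \<partial>\<nu>)" for n
    unfolding smooth[OF assms(1) sets(1)] smooth[OF assms(2) sets(2)] bump ..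
  then have eq: "(\<integral>\<^sup>+x. ennreal (h x) \<partial>\<mu>) * (\<integral>\<^sup>+z. ennreal (E z) \<partial>lborel)
      = (\<integral>\<^sup>+x. ennreal (h x) \<partial>\<nu>) * (\<integral>\<^sup>+z. ennreal (E z) \<partial>lborel)"
    using gaussian_smoothing_tendsto[OF assms(1) sets(1) h] gaussian_smoothing_tendsto[OF assms(2) sets(2) h]
    unfolding E_def by (simp add: LIMSEQ_unique)
  have "(\<integral>\<^sup>+z. ennreal (E z) \<partial>lborel) * (\<integral>\<^sup>+x. ennreal (h x) \<partial>\<mu>)
      = (\<integral>\<^sup>+z. ennreal (E z) \<partial>lborel) * (\<integral>\<^sup>+x. ennreal (h x) \<partial>\<nu>)"
    using eq by (subst (1 2) mult.commute)
  then show "(\<integral>\<^sup>+x. ennreal (h x) \<partial>\<mu>) = (\<integral>\<^sup>+x. ennreal (h x) \<partial>\<nu>)"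
    using gaussian_kernel_nn_integral[where 'a = 'a]
    unfolding ennreal_mult_cancel_left infinity_ennreal_def E_def by blast
qed

section \<open>Domination of the relativistic laws\<close>

text \<open>The inverse Gaussian law with drift \<open>m\<close>, written as an exponential tilt of
  the driftless law with normalising factor \<open>exp (m * t)\<close>, so that its density relative
  to \<open>m = 0\<close> can be read off.\<close>

definition relativistic_time :: "real \<Rightarrow> real \<Rightarrow> real measure" where
  "relativistic_time m t = density lborel (\<lambda>r. ennreal (exp (m * t) * (ig_density t r * exp (- (m\<^sup>2) * r / 2))))"

text \<open>By Gaussian scaling, the law of Brownian motion at an independent inverse Gaussian
  time.\<close>

definition relativistic_marginal :: "real \<Rightarrow> real \<Rightarrow> 'a::euclidean_space measure" where
  "relativistic_marginal m t =
    distr (relativistic_time m t \<Otimes>\<^sub>M std_gaussian) borel (\<lambda>p. sqrt (fst p) *\<^sub>R snd p)"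

lemma sets_relativistic_time [simp, measurable_cong]: "sets (relativistic_time m t) = sets borel"
  by (simp add: relativistic_time_def)

lemma sets_relativistic_marginal [simp, measurable_cong]: "sets (relativistic_marginal m t) = sets borel"
  by (simp add: relativistic_marginal_def)

text \<open>With \<open>k\<^sup>2 = v + m\<^sup>2\<close> the two exponentials merge into one
  Laplace transform. \<open>v = 0\<close> yields total mass one,
  \<open>v = (norm \<xi>)\<^sup>2\<close> the relativistic exponent.\<close>

lemma relativistic_time_integral:
  assumes "t > 0" "m \<ge> 0" "v \<ge> 0"
  shows "(\<integral>\<^sup>+r. ennreal (exp (m * t) * (ig_density t r * exp (- (m\<^sup>2) * r / 2)) * exp (- v * r / 2)) \<partial>lborel)
    = ennreal (exp (- t * (sqrt (v + m\<^sup>2) - m)))"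
proof -
  define k where "k = sqrt (v + m\<^sup>2)"
  have k: "k \<ge> 0" "k\<^sup>2 = v + m\<^sup>2" using assms by (simp_all add: k_def)
  have "exp (m * t) * (ig_density t r * exp (- (m\<^sup>2) * r / 2)) * exp (- v * r / 2)
    = exp (m * t) * (ig_density t r * exp (- (k\<^sup>2) * r / 2))" for r
  proof -
    have "exp (- (m\<^sup>2) * r / 2) * exp (- v * r / 2) = exp (- (k\<^sup>2) * r / 2)"
      unfolding k exp_add[symmetric] by (simp add: field_simps)
    then show ?thesis by (simp add: mult.assoc)
  qed
  then have "(\<integral>\<^sup>+r. ennreal (exp (m * t) * (ig_density t r * exp (- (m\<^sup>2) * r / 2)) * exp (- v * r / 2)) \<partial>lborel)
    = (\<integral>\<^sup>+r. ennreal (exp (m * t) * (ig_density t r * exp (- (k\<^sup>2) * r / 2))) \<partial>lborel)"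
    by (simp only:)
  also have "\<dots> = (\<integral>\<^sup>+r. ennreal (exp (m * t)) * ennreal (ig_density t r * exp (- (k\<^sup>2) * r / 2)) \<partial>lborel)"
    using \<open>t > 0\<close> by (intro nn_integral_cong ennreal_mult mult_nonneg_nonneg ig_density_nonneg) auto
  also have "\<dots> = ennreal (exp (m * t)) * ennreal (exp (- t * k))"
    unfolding nn_integral_ig_density[OF \<open>t > 0\<close> k(1), symmetric] by (rule nn_integral_cmult) measurable
  also have "\<dots> = ennreal (exp (- t * (k - m)))"
    by (simp add: ennreal_mult[symmetric] exp_add[symmetric] algebra_simps)
  finally show ?thesis unfolding k_def .
qed

lemma prob_space_relativistic_time:
  assumes "t > 0" "m \<ge> 0" shows "prob_space (relativistic_time m t)"
proof (rule prob_spaceI)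
  have "(\<integral>\<^sup>+r. ennreal (exp (m * t) * (ig_density t r * exp (- (m\<^sup>2) * r / 2))) \<partial>lborel) = 1"
    using relativistic_time_integral[OF assms, of 0] assms by simp
  then show "emeasure (relativistic_time m t) (space (relativistic_time m t)) = 1"
    by (simp add: relativistic_time_def emeasure_density)
qed

lemma prob_space_relativistic_marginal:
  assumes "t > 0" "m \<ge> 0" shows "prob_space (relativistic_marginal m t :: 'a::euclidean_space measure)"
proof -
  interpret T: prob_space "relativistic_time m t" by (rule prob_space_relativistic_time[OF assms])
  interpret G: prob_space "std_gaussian :: 'a measure" by (rule prob_space_std_gaussian)
  interpret P: pair_prob_space "relativistic_time m t" "std_gaussian :: 'a measure" ..
  show ?thesis unfolding relativistic_marginal_def by (rule P.prob_space_distr) measurable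
qed

lemma char_relativistic_marginal:
  fixes \<xi> :: "'a::euclidean_space"
  assumes "t > 0" "m \<ge> 0"
  shows "(CLINT x|relativistic_marginal m t. iexp (\<xi> \<bullet> x)) =
    complex_of_real (exp (- t * (sqrt ((norm \<xi>)\<^sup>2 + m\<^sup>2) - m)))"
proof -
  interpret T: prob_space "relativistic_time m t" by (rule prob_space_relativistic_time[OF assms])
  interpret G: prob_space "std_gaussian :: 'a measure" by (rule prob_space_std_gaussian)
  interpret P: pair_prob_space "relativistic_time m t" "std_gaussian :: 'a measure" ..
  let ?w = "\<lambda>r. exp (m * t) * (ig_density t r * exp (- (m\<^sup>2) * r / 2))"
  have int: "integrable (relativistic_time m t \<Otimes>\<^sub>M std_gaussian) (\<lambda>p. iexp (\<xi> \<bullet> (sqrt (fst p) *\<^sub>R snd p)))"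
    by (rule integrable_iexp_finite_measure[OF P.finite_measure_axioms]) measurable
  have "(CLINT x|relativistic_marginal m t. iexp (\<xi> \<bullet> x))
      = (CLINT p|relativistic_time m t \<Otimes>\<^sub>M std_gaussian. iexp (\<xi> \<bullet> (sqrt (fst p) *\<^sub>R snd p)))"
    unfolding relativistic_marginal_def by (rule integral_distr) measurable
  also have "\<dots> = (CLINT r|relativistic_time m t. (CLINT z|std_gaussian. iexp (\<xi> \<bullet> (sqrt r *\<^sub>R z))))"
    using P.integral_fst'[OF int] by simp
  also have "\<dots> = (CLINT r|relativistic_time m t. complex_of_real (exp (- (norm (sqrt r *\<^sub>R \<xi>))\<^sup>2 / 2)))"
    unfolding char_std_gaussian[symmetric] by simp
  also have "\<dots> = complex_of_real (\<integral>r. exp (- (norm (sqrt r *\<^sub>R \<xi>))\<^sup>2 / 2) \<partial>relativistic_time m t)"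
    by simp
  also have "(\<integral>r. exp (- (norm (sqrt r *\<^sub>R \<xi>))\<^sup>2 / 2) \<partial>relativistic_time m t)
      = (\<integral>r. ?w r *\<^sub>R exp (- (norm (sqrt r *\<^sub>R \<xi>))\<^sup>2 / 2) \<partial>lborel)"
    unfolding relativistic_time_def
    by (rule integral_density) (use \<open>t > 0\<close> in \<open>auto simp: ig_density_nonneg\<close>)
  also have "\<dots> = (\<integral>r. ?w r * exp (- ((norm \<xi>)\<^sup>2) * r / 2) \<partial>lborel)"
  proof (intro Bochner_Integration.integral_cong refl)
    fix r
    show "?w r *\<^sub>R exp (- (norm (sqrt r *\<^sub>R \<xi>))\<^sup>2 / 2) = ?w r * exp (- ((norm \<xi>)\<^sup>2) * r / 2)"
    \<comment> \<open>For negative \<open>r\<close> the two exponents differ, as \<open>sqrt\<close>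
      is odd and its square is then \<open>- r\<close>; but there the density vanishes.\<close>
    proof (cases "r > 0")
      case True
      then show ?thesis by (simp add: power_mult_distrib mult.commute)
    qed (simp add: ig_density_def)
  qed
  also have "\<dots> = enn2real (\<integral>\<^sup>+r. ennreal (?w r * exp (- ((norm \<xi>)\<^sup>2) * r / 2)) \<partial>lborel)"
    by (rule integral_eq_nn_integral) (use \<open>t > 0\<close> in \<open>auto simp: ig_density_nonneg\<close>)
  also have "\<dots> = exp (- t * (sqrt ((norm \<xi>)\<^sup>2 + m\<^sup>2) - m))"
    using relativistic_time_integral[OF assms, of "(norm \<xi>)\<^sup>2"] by simp
  finally show ?thesis .
qed

text \<open>Given the mixing time \<open>r\<close> the Gaussian is the same for all
  \<open>m\<close>, so the bound between the mixing densities passes to the mixtures.\<close>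

lemma relativistic_marginal_domination:
  fixes g :: "'a::euclidean_space \<Rightarrow> ennreal"
  assumes "t > 0" "m \<ge> 0" and [measurable]: "g \<in> borel_measurable borel"
  shows "(\<integral>\<^sup>+x. g x \<partial>relativistic_marginal m t)
    \<le> ennreal (exp (m * t)) * (\<integral>\<^sup>+x. g x \<partial>relativistic_marginal 0 t)"
proof -
  interpret G: prob_space "std_gaussian :: 'a measure" by (rule prob_space_std_gaussian)
  have eq: "(\<integral>\<^sup>+x. g x \<partial>relativistic_marginal m' t)
    = (\<integral>\<^sup>+r. ennreal (exp (m' * t) * (ig_density t r * exp (- (m'\<^sup>2) * r / 2))) *
        (\<integral>\<^sup>+z. g (sqrt r *\<^sub>R z) \<partial>std_gaussian) \<partial>lborel)" if "m' \<ge> 0" for m'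
  proof -
    have "(\<integral>\<^sup>+x. g x \<partial>relativistic_marginal m' t)
      = (\<integral>\<^sup>+p. g (sqrt (fst p) *\<^sub>R snd p) \<partial>(relativistic_time m' t \<Otimes>\<^sub>M std_gaussian))"
      unfolding relativistic_marginal_def by (rule nn_integral_distr) measurable
    also have "\<dots> = (\<integral>\<^sup>+r. (\<integral>\<^sup>+z. g (sqrt r *\<^sub>R z) \<partial>std_gaussian) \<partial>relativistic_time m' t)"
      by (subst G.nn_integral_fst[symmetric]) auto
    also have "\<dots> = (\<integral>\<^sup>+r. ennreal (exp (m' * t) * (ig_density t r * exp (- (m'\<^sup>2) * r / 2))) *
        (\<integral>\<^sup>+z. g (sqrt r *\<^sub>R z) \<partial>std_gaussian) \<partial>lborel)"
      unfolding relativistic_time_def by (rule nn_integral_density) measurable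
    finally show ?thesis .
  qed
  have "(\<integral>\<^sup>+x. g x \<partial>relativistic_marginal m t)
    \<le> (\<integral>\<^sup>+r. ennreal (exp (m * t)) * (ennreal (ig_density t r) *
        (\<integral>\<^sup>+z. g (sqrt r *\<^sub>R z) \<partial>std_gaussian)) \<partial>lborel)"
    unfolding eq[OF \<open>m \<ge> 0\<close>]
  proof (rule nn_integral_mono)
    fix r
    have nn: "ig_density t r \<ge> 0" using \<open>t > 0\<close> by (simp add: ig_density_nonneg)
    have "ig_density t r * exp (- (m\<^sup>2) * r / 2) \<le> ig_density t r"
    proof (cases "r > 0")
      case True
      then show ?thesis using nn by (intro mult_left_le) auto
    qed (simp add: ig_density_def)
    then have "exp (m * t) * (ig_density t r * exp (- (m\<^sup>2) * r / 2)) \<le> exp (m * t) * ig_density t r"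
      by (intro mult_left_mono) auto
    then have "ennreal (exp (m * t) * (ig_density t r * exp (- (m\<^sup>2) * r / 2)))
        \<le> ennreal (exp (m * t)) * ennreal (ig_density t r)"
      using nn by (simp add: ennreal_mult[symmetric] ennreal_leI)
    then show "ennreal (exp (m * t) * (ig_density t r * exp (- (m\<^sup>2) * r / 2))) *
        (\<integral>\<^sup>+z. g (sqrt r *\<^sub>R z) \<partial>std_gaussian)
      \<le> ennreal (exp (m * t)) * (ennreal (ig_density t r) * (\<integral>\<^sup>+z. g (sqrt r *\<^sub>R z) \<partial>std_gaussian))"
      unfolding mult.assoc[symmetric] by (rule mult_right_mono) simp
  qed
  also have "\<dots> = ennreal (exp (m * t)) * (\<integral>\<^sup>+r. ennreal (ig_density t r) *
        (\<integral>\<^sup>+z. g (sqrt r *\<^sub>R z) \<partial>std_gaussian) \<partial>lborel)"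
    by (rule nn_integral_cmult) measurable
  also have "(\<integral>\<^sup>+r. ennreal (ig_density t r) * (\<integral>\<^sup>+z. g (sqrt r *\<^sub>R z) \<partial>std_gaussian) \<partial>lborel)
    = (\<integral>\<^sup>+x. g x \<partial>relativistic_marginal 0 t)"
    using eq[of 0] by simp
  finally show ?thesis .
qed

section \<open>From one increment to a time grid\<close>

lemma relativistic_levy_increment:
  fixes L :: "(real \<Rightarrow> 'a::euclidean_space) measure"
  assumes L: "relativistic_levy_law m L" and "m \<ge> 0" "s \<ge> 0" "t > 0"
  shows "distr L borel (\<lambda>\<omega>. \<omega> (s + t) - \<omega> s) = relativistic_marginal m t"
proof -
  have levy: "levy_process L (\<lambda>t \<omega>. \<omega> t)" using L by (simp add: relativistic_levy_law_def)
  then interpret prob_space L by (simp add: levy_process_def)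
  have [measurable]: "(\<lambda>\<omega>. \<omega> t) \<in> borel_measurable L" using levy \<open>t > 0\<close> by (simp add: levy_process_def)
  have "distr L borel (\<lambda>\<omega>. \<omega> (s + t) - \<omega> s) = distr L borel (\<lambda>\<omega>. \<omega> t)"
    using levy \<open>s \<ge> 0\<close> \<open>t > 0\<close> by (simp add: levy_process_def)
  also have "\<dots> = relativistic_marginal m t"
  proof (rule char_uniqueness_euclidean)
    show "prob_space (distr L borel (\<lambda>\<omega>. \<omega> t))" by (rule prob_space_distr) measurable
    show "prob_space (relativistic_marginal m t :: 'a measure)"
      by (rule prob_space_relativistic_marginal) fact+
    fix \<xi> :: 'a
    have "(CLINT x|distr L borel (\<lambda>\<omega>. \<omega> t). iexp (\<xi> \<bullet> x)) = (CLINT \<omega>|L. iexp (\<xi> \<bullet> \<omega> t))"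
      by (rule integral_distr) measurable
    also have "\<dots> = complex_of_real (exp (- t * (sqrt ((norm \<xi>)\<^sup>2 + m\<^sup>2) - m)))"
      using L \<open>t > 0\<close> by (simp add: relativistic_levy_law_def)
    also have "\<dots> = (CLINT x|relativistic_marginal m t. iexp (\<xi> \<bullet> x))"
      by (rule char_relativistic_marginal[symmetric]) fact+
    finally show "(CLINT x|distr L borel (\<lambda>\<omega>. \<omega> t). iexp (\<xi> \<bullet> x)) = (CLINT x|relativistic_marginal m t. iexp (\<xi> \<bullet> x))" .
  qed simp_all
  finally show ?thesis .
qed

text \<open>Coordinates are exchanged one at a time, at the cost of a factor \<open>c\<close> each.
  \<open>F\<close> is generalised because the inner integral is the functional for the remaining
  coordinates.\<close>

lemma nn_integral_PiM_domination:
  fixes P Q :: "'a::euclidean_space measure" and F :: "(nat \<Rightarrow> 'a) \<Rightarrow> ennreal"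
  assumes PQ: "prob_space P" "prob_space Q" and sets: "sets P = sets borel" "sets Q = sets borel"
    and dom: "\<And>g. g \<in> borel_measurable borel \<Longrightarrow> (\<integral>\<^sup>+x. g x \<partial>P) \<le> c * (\<integral>\<^sup>+x. g x \<partial>Q)"
    and "F \<in> borel_measurable (PiM {..<K} (\<lambda>_. borel))"
  shows "(\<integral>\<^sup>+x. F x \<partial>PiM {..<K} (\<lambda>_. P)) \<le> c ^ K * (\<integral>\<^sup>+x. F x \<partial>PiM {..<K} (\<lambda>_. Q))"
  using \<open>F \<in> _\<close>
proof (induction K arbitrary: F)
  case 0
  then show ?case by (simp add: nn_integral_empty PiM_empty)
next
  case (Suc K)
  interpret P: prob_space P by fact
  interpret Q: prob_space Q by fact
  interpret PP: product_sigma_finite "\<lambda>_::nat. P" ..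
  interpret QQ: product_sigma_finite "\<lambda>_::nat. Q" ..
  note [measurable_cong] = sets
  have I: "{..<Suc K} = insert K {..<K}" by auto
  have F[measurable]: "F \<in> borel_measurable (PiM (insert K {..<K}) (\<lambda>_. borel))" using Suc.prems unfolding I .
  have add: "(\<lambda>(x, y). x(K := y)) \<in> measurable (PiM {..<K} (\<lambda>_. borel) \<Otimes>\<^sub>M (borel :: 'a measure)) (PiM (insert K {..<K}) (\<lambda>_. borel))"
    by (rule measurable_add_dim)
  have sets_PiM: "sets (PiM J (\<lambda>_. P)) = sets (PiM J (\<lambda>_. borel))"
    "sets (PiM J (\<lambda>_. Q)) = sets (PiM J (\<lambda>_. borel))" for J :: "nat set"
    by (rule sets_PiM_cong; simp add: sets)+
  have FK: "(\<lambda>(x, y). F (x(K := y))) \<in> borel_measurable (PiM {..<K} (\<lambda>_. borel) \<Otimes>\<^sub>M (borel :: 'a measure))"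
    using measurable_compose[OF add F] by (simp add: case_prod_beta')
  have sec: "(\<lambda>y. F (x(K := y))) \<in> borel_measurable borel" if "x \<in> space (PiM {..<K} (\<lambda>_. borel :: 'a measure))" for x
    using measurable_compose[OF measurable_Pair1'[OF that, of borel] FK] by simp
  have inner: "(\<lambda>x. \<integral>\<^sup>+y. F (x(K := y)) \<partial>P) \<in> borel_measurable (PiM {..<K} (\<lambda>_. borel))"
    "(\<lambda>x. \<integral>\<^sup>+y. F (x(K := y)) \<partial>Q) \<in> borel_measurable (PiM {..<K} (\<lambda>_. borel))"
    using FK by (auto intro!: P.borel_measurable_nn_integral Q.borel_measurable_nn_integral simp: sets cong: measurable_cong_sets sets_pair_measure_cong)
  have "(\<integral>\<^sup>+x. F x \<partial>PiM {..<Suc K} (\<lambda>_. P)) = (\<integral>\<^sup>+x. (\<integral>\<^sup>+y. F (x(K := y)) \<partial>P) \<partial>PiM {..<K} (\<lambda>_. P))"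
    unfolding I using F by (intro PP.product_nn_integral_insert) (auto simp: measurable_cong_sets[OF sets_PiM(1) refl])
  also have "\<dots> \<le> c ^ K * (\<integral>\<^sup>+x. (\<integral>\<^sup>+y. F (x(K := y)) \<partial>P) \<partial>PiM {..<K} (\<lambda>_. Q))"
    by (rule Suc.IH[OF inner(1)])
  also have "\<dots> \<le> c ^ K * (\<integral>\<^sup>+x. c * (\<integral>\<^sup>+y. F (x(K := y)) \<partial>Q) \<partial>PiM {..<K} (\<lambda>_. Q))"
    by (intro mult_left_mono nn_integral_mono dom sec) (auto simp: sets_eq_imp_space_eq[OF sets_PiM(2)])
  also have "\<dots> = c ^ Suc K * (\<integral>\<^sup>+x. (\<integral>\<^sup>+y. F (x(K := y)) \<partial>Q) \<partial>PiM {..<K} (\<lambda>_. Q))"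
    using inner(2) by (subst nn_integral_cmult) (auto simp: measurable_cong_sets[OF sets_PiM(2) refl] mult_ac)
  also have "(\<integral>\<^sup>+x. (\<integral>\<^sup>+y. F (x(K := y)) \<partial>Q) \<partial>PiM {..<K} (\<lambda>_. Q)) = (\<integral>\<^sup>+x. F x \<partial>PiM {..<Suc K} (\<lambda>_. Q))"
    unfolding I using F by (intro QQ.product_nn_integral_insert[symmetric]) (auto simp: measurable_cong_sets[OF sets_PiM(2) refl])
  finally show ?case .
qed

text \<open>Grid values are partial sums of independent increments with a common law, so the bound
  for one increment tensorises.\<close>

lemma relativistic_levy_grid_domination:
  fixes L L0 :: "(real \<Rightarrow> 'a::euclidean_space) measure" and F :: "(nat \<Rightarrow> 'a) \<Rightarrow> ennreal"
  assumes L: "relativistic_levy_law m L" and L0: "relativistic_levy_law 0 L0" and "m \<ge> 0" "\<delta> > 0" "K > 0"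
    and F: "F \<in> borel_measurable borel"
  shows "(\<integral>\<^sup>+\<omega>. F (\<lambda>k. if k \<le> K then \<omega> (real k * \<delta>) else 0) \<partial>L)
    \<le> ennreal (exp (m * (real K * \<delta>))) * (\<integral>\<^sup>+\<omega>. F (\<lambda>k. if k \<le> K then \<omega> (real k * \<delta>) else 0) \<partial>L0)"
proof -
  \<comment> \<open>\<open>S\<close> rebuilds the grid values from the increments, using that paths
    start at 0, and pads them by zeros past \<open>K\<close>.\<close>
  define S where "S x = (\<lambda>k. if k \<le> K then \<Sum>i<k. x i else 0)" for x :: "nat \<Rightarrow> 'a"
  have "S \<in> measurable (PiM {..<K} (\<lambda>_. borel)) (PiM UNIV (\<lambda>_. borel))"
  proof (rule measurable_PiM_single')
    fix k
    show "(\<lambda>x. S x k) \<in> borel_measurable (PiM {..<K} (\<lambda>_. borel))"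
      unfolding S_def by (cases "k \<le> K") (auto intro!: borel_measurable_sum measurable_component_singleton)
  qed simp
  then have S: "S \<in> borel_measurable (PiM {..<K} (\<lambda>_. borel))"
    by (simp cong: measurable_cong_sets add: measurable_cong_sets[OF refl sets_PiM_equal_borel])
  have FS: "(\<lambda>x. F (S x)) \<in> borel_measurable (PiM {..<K} (\<lambda>_. borel))"
    by (rule measurable_compose[OF S F])
  have law: "(\<integral>\<^sup>+\<omega>. F (\<lambda>k. if k \<le> K then \<omega> (real k * \<delta>) else 0) \<partial>L')
    = (\<integral>\<^sup>+x. F (S x) \<partial>PiM {..<K} (\<lambda>_. relativistic_marginal m' \<delta>))"
    if L': "relativistic_levy_law m' L'" and m': "m' \<ge> 0" for m' and L' :: "(real \<Rightarrow> 'a) measure"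
  proof -
    have levy: "levy_process L' (\<lambda>t \<omega>. \<omega> t)" and sets: "sets L' = sets skorohod_borel"
      using L' by (simp_all add: relativistic_levy_law_def)
    then interpret prob_space L' by (simp add: levy_process_def)
    define D where "D i \<omega> = \<omega> (real (Suc i) * \<delta>) - \<omega> (real i * \<delta>)" for i and \<omega> :: "real \<Rightarrow> 'a"
    have coord: "(\<lambda>\<omega>. \<omega> t) \<in> borel_measurable L'" if "t \<ge> 0" for t
      using levy that by (simp add: levy_process_def)
    have Dm: "D i \<in> borel_measurable L'" for i
      unfolding D_def using \<open>\<delta> > 0\<close> by (intro borel_measurable_diff coord) auto
    have ind: "indep_vars (\<lambda>_. borel) D {..<K}"
    proof -
      have incr: "independent_increments L' (\<lambda>t \<omega>. \<omega> t)" using levy by (simp add: levy_process_def)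
      have "0 \<le> real 0 * \<delta> \<and> (\<forall>i<K. real i * \<delta> \<le> real (Suc i) * \<delta>)"
        using \<open>\<delta> > 0\<close> by (auto intro!: mult_right_mono)
      then show ?thesis
        unfolding D_def[abs_def]
        by (rule incr[unfolded independent_increments_def, THEN spec[of _ K], THEN spec[of _ "\<lambda>i. real i * \<delta>"], THEN mp])
    qed
    have Dlaw: "distr L' borel (D i) = relativistic_marginal m' \<delta>" for i
    proof -
      have "D i = (\<lambda>\<omega>. \<omega> (real i * \<delta> + \<delta>) - \<omega> (real i * \<delta>))"
        by (auto simp: D_def fun_eq_iff algebra_simps)
      then show ?thesis using relativistic_levy_increment[OF L' m' _ \<open>\<delta> > 0\<close>, of "real i * \<delta>"] \<open>\<delta> > 0\<close> by simp
    qed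
    have "distr L' (PiM {..<K} (\<lambda>_. borel)) (\<lambda>\<omega>. \<lambda>i\<in>{..<K}. D i \<omega>) = PiM {..<K} (\<lambda>i. distr L' borel (D i))"
      using indep_vars_iff_distr_eq_PiM'[of "{..<K}" D "\<lambda>_. borel"] ind Dm \<open>K > 0\<close> by auto
    then have "(\<integral>\<^sup>+x. F (S x) \<partial>PiM {..<K} (\<lambda>_. relativistic_marginal m' \<delta>))
      = (\<integral>\<^sup>+x. F (S x) \<partial>distr L' (PiM {..<K} (\<lambda>_. borel)) (\<lambda>\<omega>. \<lambda>i\<in>{..<K}. D i \<omega>))"
      by (simp add: Dlaw)
    also have "\<dots> = (\<integral>\<^sup>+\<omega>. F (S (\<lambda>i\<in>{..<K}. D i \<omega>)) \<partial>L')"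
      using FS by (intro nn_integral_distr measurable_restrict Dm) auto
    also have "\<dots> = (\<integral>\<^sup>+\<omega>. F (\<lambda>k. if k \<le> K then \<omega> (real k * \<delta>) else 0) \<partial>L')"
    proof (rule nn_integral_cong)
      fix \<omega> assume "\<omega> \<in> space L'"
      then have "\<omega> 0 = 0" using sets_eq_imp_space_eq[OF sets] by (simp add: D0_def)
      have "S (\<lambda>i\<in>{..<K}. D i \<omega>) k = (if k \<le> K then \<omega> (real k * \<delta>) else 0)" for k
      proof (cases "k \<le> K")
        case True
        then have "(\<Sum>i<k. (\<lambda>i\<in>{..<K}. D i \<omega>) i) = (\<Sum>i<k. D i \<omega>)" by (intro sum.cong) auto
        also have "\<dots> = \<omega> (real k * \<delta>)"
          unfolding D_def sum_lessThan_telescope[of "\<lambda>i. \<omega> (real i * \<delta>)"] using \<open>\<omega> 0 = 0\<close> by simp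
        finally show ?thesis using True by (simp add: S_def)
      qed (simp add: S_def)
      then show "F (S (\<lambda>i\<in>{..<K}. D i \<omega>)) = F (\<lambda>k. if k \<le> K then \<omega> (real k * \<delta>) else 0)"
        by (auto intro!: arg_cong[where f = F])
    qed
    finally show ?thesis ..
  qed
  have "(\<integral>\<^sup>+x. F (S x) \<partial>PiM {..<K} (\<lambda>_. relativistic_marginal m \<delta>))
    \<le> ennreal (exp (m * \<delta>)) ^ K * (\<integral>\<^sup>+x. F (S x) \<partial>PiM {..<K} (\<lambda>_. relativistic_marginal 0 \<delta>))"
    by (rule nn_integral_PiM_domination[OF _ _ _ _ relativistic_marginal_domination FS])
      (use \<open>m \<ge> 0\<close> \<open>\<delta> > 0\<close> prob_space_relativistic_marginal in auto)
  moreover have "ennreal (exp (m * \<delta>)) ^ K = ennreal (exp (m * (real K * \<delta>)))"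
    by (simp add: ennreal_power exp_of_nat_mult[symmetric] mult_ac)
  ultimately show ?thesis
    unfolding law[OF L \<open>m \<ge> 0\<close>] law[OF L0 order_refl] by simp
qed

section \<open>Step paths\<close>

text \<open>Index 0 is overridden by 0, so that the path starts at 0 whatever \<open>y\<close> is,
  arbitrary continuations included.\<close>

definition step_path :: "nat \<Rightarrow> (nat \<Rightarrow> 'a::zero) \<Rightarrow> real \<Rightarrow> 'a" where
  "step_path n y = (\<lambda>t\<in>{0..}. if nat \<lfloor>real n * t\<rfloor> = 0 then 0 else y (nat \<lfloor>real n * t\<rfloor>))"

lemma cadlag_step_path:
  fixes y :: "nat \<Rightarrow> 'a::real_normed_vector"
  assumes "n > 0"
  shows "cadlag (step_path n y)"
  unfolding cadlag_def
proof (intro conjI allI impI)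
  fix t :: real assume t: "t \<ge> 0"
  have "eventually (\<lambda>u. u \<in> {t<..<(of_int \<lfloor>real n * t\<rfloor> + 1) / real n}) (at_right t)"
  proof (rule eventually_at_right_real)
    have "real n * t < of_int \<lfloor>real n * t\<rfloor> + 1" by linarith
    then show "t < (of_int \<lfloor>real n * t\<rfloor> + 1) / real n"
      using assms by (simp add: pos_less_divide_eq mult.commute)
  qed
  then have "eventually (\<lambda>u. step_path n y u = step_path n y t) (at_right t)"
  proof eventually_elim
    case (elim u)
    have "real n * t \<le> real n * u" "real n * u < of_int \<lfloor>real n * t\<rfloor> + 1"
      using elim assms by (auto simp: pos_less_divide_eq mult.commute)
    then have "\<lfloor>real n * u\<rfloor> = \<lfloor>real n * t\<rfloor>" by linarith
    moreover have "u \<in> {0..}" "t \<in> {0..}" using elim t by auto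
    ultimately show ?case by (simp only: step_path_def restrict_apply')
  qed
  then show "(step_path n y \<longlongrightarrow> step_path n y t) (at_right t)" by (rule tendsto_eventually)
next
  fix t :: real assume t: "t > 0"
  \<comment> \<open>The largest integer strictly below \<open>real n * t\<close>, hence the
    preceding cell when \<open>t\<close> is itself a grid point.\<close>
  define j where "j = \<lceil>real n * t\<rceil> - 1"
  define l where "l = (if nat j = 0 then 0 else y (nat j))"
  have "eventually (\<lambda>u. u \<in> {max 0 (of_int j / real n)<..<t}) (at_left t)"
  proof (rule eventually_at_left_real)
    have "of_int j < real n * t" unfolding j_def by linarith
    then show "max 0 (of_int j / real n) < t"
      using assms t by (simp add: pos_divide_less_eq mult.commute)
  qed
  then have "eventually (\<lambda>u. step_path n y u = l) (at_left t)"
  proof eventually_elim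
    case (elim u)
    have "real n * u < real n * t" "of_int j < real n * u"
      using elim assms by (auto simp: pos_divide_less_eq mult.commute)
    then have "\<lfloor>real n * u\<rfloor> = j" unfolding j_def by linarith
    moreover have "u \<in> {0..}" using elim by auto
    ultimately show ?case by (simp only: step_path_def restrict_apply' l_def)
  qed
  then show "\<exists>l. (step_path n y \<longlongrightarrow> l) (at_left t)" by (blast intro: tendsto_eventually)
qed

lemma step_path_D0:
  fixes y :: "nat \<Rightarrow> 'a::real_normed_vector"
  shows "n > 0 \<Longrightarrow> step_path n y \<in> D0"
  using cadlag_step_path[of n y] by (simp add: D0_def step_path_def)

text \<open>The criterion is applied with \<open>\<sigma> n t\<close> the first grid point not
  before \<open>t\<close>: between \<open>\<sigma> n s\<close> and \<open>\<sigma> n t\<close> the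
  step path samples \<open>\<omega>\<close> only at grid points in \<open>{s..<t}\<close>.\<close>

lemma step_path_approximates:
  fixes \<omega> :: "real \<Rightarrow> 'a::real_normed_vector"
  assumes \<omega>: "\<omega> \<in> D0" and "\<epsilon> > 0"
  shows "eventually (\<lambda>n. step_path (Suc n) (\<lambda>k. \<omega> (real k * (1 / real (Suc n)))) \<in> skorohod_nbhd \<omega> \<epsilon> M) sequentially"
proof (rule skorohod_nbhd_eventually[OF \<omega> step_path_D0 _ _ _ \<open>\<epsilon> > 0\<close>])
  let ?\<sigma> = "\<lambda>n t. of_int \<lceil>real (Suc n) * t\<rceil> / real (Suc n)"
  show "?\<sigma> n 0 = 0" for n by simp
  show "(\<lambda>n. ?\<sigma> n t) \<longlonglongrightarrow> t" for t
  proof (rule tendsto_sandwich)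
    show "eventually (\<lambda>n. t \<le> ?\<sigma> n t) sequentially"
    proof (intro always_eventually allI)
      fix n
      have "t * real (Suc n) \<le> of_int \<lceil>real (Suc n) * t\<rceil>" by (subst mult.commute) (rule le_of_int_ceiling)
      then show "t \<le> ?\<sigma> n t" by (subst pos_le_divide_eq) simp_all
    qed
    show "eventually (\<lambda>n. ?\<sigma> n t \<le> t + 1 / real (Suc n)) sequentially"
    proof (intro always_eventually allI)
      fix n
      have "of_int \<lceil>real (Suc n) * t\<rceil> \<le> t * real (Suc n) + 1"
        using of_int_ceiling_le_add_one[of "real (Suc n) * t"] by (simp only: mult.commute)
      then have "?\<sigma> n t \<le> (t * real (Suc n) + 1) / real (Suc n)" by (rule divide_right_mono) simp
      then show "?\<sigma> n t \<le> t + 1 / real (Suc n)" by (simp add: add_divide_distrib)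
    qed
    show "(\<lambda>n. t + 1 / real (Suc n)) \<longlonglongrightarrow> t"
      using tendsto_add[OF tendsto_const LIMSEQ_Suc[OF lim_1_over_n], of t] by simp
  qed simp
  fix \<delta> s t :: real
  assume \<delta>: "\<delta> > 0" and st: "0 \<le> s" "s < t"
    and osc: "\<And>u v. u \<in> {s..<t} \<Longrightarrow> v \<in> {s..<t} \<Longrightarrow> dist (\<omega> u) (\<omega> v) < \<delta>"
  show "eventually (\<lambda>n. \<forall>u\<in>{?\<sigma> n s..<?\<sigma> n t}. \<forall>v\<in>{s..<t}.
    dist (step_path (Suc n) (\<lambda>k. \<omega> (real k * (1 / real (Suc n)))) u) (\<omega> v) < 3 * \<delta>) sequentially"
  proof (intro always_eventually allI ballI)
    fix n u v assume u: "u \<in> {?\<sigma> n s..<?\<sigma> n t}" and v: "v \<in> {s..<t}"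
    define N where "N = real (Suc n)"
    have N: "N > 0" by (simp add: N_def)
    have "of_int \<lceil>N * s\<rceil> / N \<le> u" "u < of_int \<lceil>N * t\<rceil> / N"
      using u by (simp_all only: N_def atLeastLessThan_iff)
    then have lo: "of_int \<lceil>N * s\<rceil> \<le> N * u" and hi: "N * u < of_int \<lceil>N * t\<rceil>"
      by (simp_all only: pos_divide_le_eq[OF N] pos_less_divide_eq[OF N] mult.commute)
    have "0 \<le> N * s" using st N by simp
    then have "0 \<le> \<lceil>N * s\<rceil>" by linarith
    then have Nu: "0 \<le> N * u" using lo by linarith
    then have "u \<ge> 0" using N by (simp add: zero_le_mult_iff)
    define k where "k = nat \<lfloor>N * u\<rfloor>"
    have k: "real k = of_int \<lfloor>N * u\<rfloor>" using Nu by (simp add: k_def)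
    have "\<lceil>N * s\<rceil> \<le> \<lfloor>N * u\<rfloor>" using lo by linarith
    then have "N * s \<le> real k" unfolding k by linarith
    moreover have "\<lfloor>N * u\<rfloor> < \<lceil>N * t\<rceil>" using hi by linarith
    then have "real k < N * t" unfolding k by (simp add: less_ceiling_iff)
    ultimately have mem: "real k * (1 / N) \<in> {s..<t}"
      using N by (simp add: pos_le_divide_eq pos_divide_less_eq mult.commute)
    have "u \<in> {0..}" using \<open>u \<ge> 0\<close> by simp
    then have "step_path (Suc n) (\<lambda>k. \<omega> (real k * (1 / real (Suc n)))) u = (if k = 0 then 0 else \<omega> (real k * (1 / N)))"
      by (simp only: step_path_def restrict_apply' N_def k_def)
    also have "\<dots> = \<omega> (real k * (1 / N))" using \<omega> by (simp add: D0_def)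
    finally show "dist (step_path (Suc n) (\<lambda>k. \<omega> (real k * (1 / real (Suc n)))) u) (\<omega> v) < 3 * \<delta>"
      using osc[OF mem v] \<delta> by simp
  qed
qed simp

lemma step_path_nbhd:
  fixes y y' :: "nat \<Rightarrow> 'a::real_normed_vector"
  assumes "n > 0" and close: "\<And>k. real k \<le> real n * M \<Longrightarrow> norm (y' k - y k) < \<epsilon>" and "\<epsilon> > 0"
  shows "step_path n y' \<in> skorohod_nbhd (step_path n y) \<epsilon> M"
proof -
  have "norm (step_path n y' s - step_path n y s) < \<epsilon>" if "s \<in> {0..M}" for s
  proof -
    have "of_int \<lfloor>real n * s\<rfloor> \<le> real n * s" by simp
    also have "\<dots> \<le> real n * M" using that by (intro mult_left_mono) auto
    finally have "real (nat \<lfloor>real n * s\<rfloor>) \<le> real n * M" using that by simp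
    from close[OF this] show ?thesis using that \<open>\<epsilon> > 0\<close> by (simp add: step_path_def)
  qed
  then show ?thesis
    unfolding skorohod_nbhd_def using step_path_D0[OF \<open>n > 0\<close>, of y'] time_change_id \<open>\<epsilon> > 0\<close>
    by (intro CollectI conjI exI[of _ "\<lambda>s. s"]) auto
qed

text \<open>Values past \<open>K\<close> are frozen, so coordinatewise convergence is uniform in the
  index, and the identity serves as time change.\<close>

lemma continuous_on_step_path:
  fixes f :: "(real \<Rightarrow> 'a::euclidean_space) \<Rightarrow> real"
  assumes f: "continuous_map skorohod euclideanreal f" and "n > 0"
  shows "continuous_on UNIV (\<lambda>y. f (step_path n (\<lambda>k. if k \<le> K then y k else x k)))"
  unfolding continuous_on_sequentially comp_def
proof (intro ballI allI impI)
  fix Y :: "nat \<Rightarrow> nat \<Rightarrow> 'a" and y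
  assume "(\<forall>j. Y j \<in> UNIV) \<and> Y \<longlonglongrightarrow> y"
  then have "Y \<longlonglongrightarrow> y" by blast
  then have lim: "(\<lambda>j. Y j k) \<longlonglongrightarrow> y k" for k
    by (rule continuous_on_tendsto_compose[OF continuous_on_product_coordinates[of k]]) auto
  show "(\<lambda>j. f (step_path n (\<lambda>k. if k \<le> K then Y j k else x k))) \<longlonglongrightarrow> f (step_path n (\<lambda>k. if k \<le> K then y k else x k))"
  proof (rule continuous_map_skorohod_tendsto[OF f step_path_D0[OF \<open>n > 0\<close>]])
    fix \<delta> M :: real assume "\<delta> > 0"
    have "eventually (\<lambda>j. \<forall>k\<in>{..K}. dist (Y j k) (y k) < \<delta>) sequentially"
      using tendstoD[OF lim \<open>\<delta> > 0\<close>] by (intro eventually_ball_finite) auto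
    then show "eventually (\<lambda>j. step_path n (\<lambda>k. if k \<le> K then Y j k else x k)
      \<in> skorohod_nbhd (step_path n (\<lambda>k. if k \<le> K then y k else x k)) \<delta> M) sequentially"
      by eventually_elim (rule step_path_nbhd; use \<open>n > 0\<close> \<open>\<delta> > 0\<close> in \<open>auto simp: dist_norm\<close>)
  qed
qed

section \<open>Suprema over continuations\<close>

definition step_sup :: "((real \<Rightarrow> 'a) \<Rightarrow> real) \<Rightarrow> nat \<Rightarrow> nat \<Rightarrow> (nat \<Rightarrow> 'a::real_normed_vector) \<Rightarrow> ennreal" where
  "step_sup f n K y = (SUP x. ennreal (f (step_path n (\<lambda>k. if k \<le> K then y k else x k))))"

lemma borel_measurable_step_sup:
  fixes f :: "(real \<Rightarrow> 'a::euclidean_space) \<Rightarrow> real"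
  assumes f: "continuous_map skorohod euclideanreal f" and "n > 0"
  shows "step_sup f n K \<in> borel_measurable borel"
proof (rule borel_measurableI_greater)
  \<comment> \<open>The supremum is uncountable, but lower semicontinuous.\<close>
  fix c
  have cont: "continuous_on UNIV (\<lambda>y. ennreal (f (step_path n (\<lambda>k. if k \<le> K then y k else x k))))" for x
    by (intro continuous_on_ennreal continuous_on_step_path assms)
  have "{y. c < step_sup f n K y} = (\<Union>x. {y. c < ennreal (f (step_path n (\<lambda>k. if k \<le> K then y k else x k)))})"
    by (auto simp: step_sup_def less_SUP_iff)
  moreover have "open {y. c < ennreal (f (step_path n (\<lambda>k. if k \<le> K then y k else x k)))}" for x
    by (rule open_Collect_less[OF continuous_on_const cont])
  ultimately have "open {y. c < step_sup f n K y}" by (simp add: open_UN)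
  then show "{y \<in> space borel. c < step_sup f n K y} \<in> sets borel" by simp
qed

lemma step_sup_cong: "(\<And>k. k \<le> K \<Longrightarrow> y k = y' k) \<Longrightarrow> step_sup f n K y = step_sup f n K y'"
  unfolding step_sup_def by (intro SUP_cong refl arg_cong[where f = "\<lambda>z. ennreal (f (step_path n z))"]) auto

text \<open>The sampled path is one of its own continuations, and \<open>f\<close> converges along
  the sampled paths.\<close>

lemma liminf_step_sup_ge:
  fixes f :: "(real \<Rightarrow> 'a::euclidean_space) \<Rightarrow> real"
  assumes f: "continuous_map skorohod euclideanreal f" and \<omega>: "\<omega> \<in> D0"
  shows "ennreal (f \<omega>) \<le> liminf (\<lambda>n. step_sup f (Suc n) (Suc n * N) (\<lambda>k. \<omega> (real k * (1 / real (Suc n)))))"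
proof -
  let ?y = "\<lambda>n k. \<omega> (real k * (1 / real (Suc n)))"
  have "(\<lambda>n. f (step_path (Suc n) (?y n))) \<longlonglongrightarrow> f \<omega>"
    by (rule continuous_map_skorohod_tendsto[OF f \<omega> step_path_approximates[OF \<omega>]])
  then have "(\<lambda>n. ennreal (f (step_path (Suc n) (?y n)))) \<longlonglongrightarrow> ennreal (f \<omega>)" by (rule tendsto_ennrealI)
  then have "ennreal (f \<omega>) = liminf (\<lambda>n. ennreal (f (step_path (Suc n) (?y n))))"
    by (simp add: lim_imp_Liminf)
  also have "\<dots> \<le> liminf (\<lambda>n. step_sup f (Suc n) (Suc n * N) (?y n))"
  proof (intro Liminf_mono always_eventually allI)
    fix n
    show "ennreal (f (step_path (Suc n) (?y n))) \<le> step_sup f (Suc n) (Suc n * N) (?y n)"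
      unfolding step_sup_def by (rule SUP_upper2[of "?y n"]) simp_all
  qed
  finally show ?thesis .
qed

text \<open>A Skorohod neighbourhood of \<open>\<omega>\<close> tests paths only at times
  \<open>\<mu> s\<close> with \<open>s \<le> M\<close>, which lie below \<open>M + \<delta>\<close>.
  Once \<open>N\<close> exceeds this bound, a change of the continuation goes unnoticed.\<close>

lemma limsup_step_sup_le:
  fixes f :: "(real \<Rightarrow> 'a::euclidean_space) \<Rightarrow> real"
  assumes f: "continuous_map skorohod euclideanreal f" and \<omega>: "\<omega> \<in> D0" and "e > 0"
  shows "eventually (\<lambda>N. limsup (\<lambda>n. step_sup f (Suc n) (Suc n * N) (\<lambda>k. \<omega> (real k * (1 / real (Suc n)))))
    \<le> ennreal (f \<omega> + e)) sequentially"
proof -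
  let ?y = "\<lambda>n k. \<omega> (real k * (1 / real (Suc n)))"
  obtain \<delta> M where \<delta>: "\<delta> > 0" "\<And>\<eta>. \<eta> \<in> skorohod_nbhd \<omega> \<delta> M \<Longrightarrow> \<bar>f \<eta> - f \<omega>\<bar> < e"
    using continuous_map_skorohodD[OF f \<omega> \<open>e > 0\<close>] by blast
  obtain N0 :: nat where N0: "M + \<delta> \<le> real N0" using real_arch_simple by blast
  have "limsup (\<lambda>n. step_sup f (Suc n) (Suc n * N) (?y n)) \<le> ennreal (f \<omega> + e)" if "N \<ge> N0" for N
  proof (rule Limsup_bounded)
    show "eventually (\<lambda>n. step_sup f (Suc n) (Suc n * N) (?y n) \<le> ennreal (f \<omega> + e)) sequentially"
      using step_path_approximates[OF \<omega> \<delta>(1), of M]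
    proof eventually_elim
      case (elim n)
      then obtain \<mu> where \<mu>: "time_change \<mu>" "\<And>s. s \<ge> 0 \<Longrightarrow> \<bar>\<mu> s - s\<bar> < \<delta>"
        "\<And>s. s \<in> {0..M} \<Longrightarrow> norm (step_path (Suc n) (?y n) (\<mu> s) - \<omega> s) < \<delta>"
        unfolding skorohod_nbhd_def by blast
      show ?case unfolding step_sup_def
      proof (rule SUP_least)
        fix x
        let ?z = "\<lambda>k. if k \<le> Suc n * N then ?y n k else x k"
        have eq: "step_path (Suc n) ?z (\<mu> s) = step_path (Suc n) (?y n) (\<mu> s)" if s: "s \<in> {0..M}" for s
        proof -
          have "\<mu> s \<le> real N" using \<mu>(2)[of s] s N0 \<open>N \<ge> N0\<close> by (auto simp: abs_less_iff)
          then have "real (Suc n) * \<mu> s \<le> real (Suc n) * real N" by (intro mult_left_mono) auto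
          then have "\<lfloor>real (Suc n) * \<mu> s\<rfloor> \<le> int (Suc n * N)"
            by (metis floor_mono floor_of_nat of_nat_mult)
          then have "nat \<lfloor>real (Suc n) * \<mu> s\<rfloor> \<le> Suc n * N" by linarith
          then show ?thesis by (simp only: step_path_def if_True restrict_apply cong: if_cong)
        qed
        have "\<forall>s\<in>{0..M}. norm (step_path (Suc n) ?z (\<mu> s) - \<omega> s) < \<delta>"
        proof
          fix s assume s: "s \<in> {0..M}"
          show "norm (step_path (Suc n) ?z (\<mu> s) - \<omega> s) < \<delta>"
            unfolding eq[OF s] by (rule \<mu>(3)[OF s])
        qed
        then have "step_path (Suc n) ?z \<in> skorohod_nbhd \<omega> \<delta> M"
          unfolding skorohod_nbhd_def using \<mu>(1,2) step_path_D0[OF zero_less_Suc] by blast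
        from \<delta>(2)[OF this] have "f (step_path (Suc n) ?z) \<le> f \<omega> + e" by linarith
        then show "ennreal (f (step_path (Suc n) ?z)) \<le> ennreal (f \<omega> + e)" by (rule ennreal_leI)
      qed
    qed
  qed
  then show ?thesis by (auto simp: eventually_sequentially)
qed

section \<open>Weak convergence of the relativistic laws\<close>

lemma relativistic_levy_coordinate:
  "relativistic_levy_law m L \<Longrightarrow> t \<ge> 0 \<Longrightarrow> (\<lambda>\<omega>. \<omega> t) \<in> borel_measurable L"
  by (simp add: relativistic_levy_law_def levy_process_def)

lemma relativistic_levy_prob_space: "relativistic_levy_law m L \<Longrightarrow> prob_space L"
  by (simp add: relativistic_levy_law_def levy_process_def)

lemma relativistic_levy_sets: "relativistic_levy_law m L \<Longrightarrow> sets L = sets skorohod_borel"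
  by (simp add: relativistic_levy_law_def)

lemma relativistic_levy_space: "relativistic_levy_law m L \<Longrightarrow> space L = D0"
  using sets_eq_imp_space_eq[OF relativistic_levy_sets] by force

lemma relativistic_levy_functional_measurable:
  fixes f :: "(real \<Rightarrow> 'a::euclidean_space) \<Rightarrow> real"
  assumes L: "relativistic_levy_law m L" and f: "continuous_map skorohod euclideanreal f"
  shows "f \<in> borel_measurable L"
  unfolding measurable_cong_sets[OF relativistic_levy_sets[OF L] refl]
  by (rule borel_measurable_skorohod[OF f])

lemma relativistic_levy_step_sup_measurable:
  fixes f :: "(real \<Rightarrow> 'a::euclidean_space) \<Rightarrow> real"
  assumes L: "relativistic_levy_law m L" and f: "continuous_map skorohod euclideanreal f" and "n > 0" "\<delta> \<ge> 0"
  shows "(\<lambda>\<omega>. step_sup f n K (\<lambda>k. \<omega> (real k * \<delta>))) \<in> borel_measurable L"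
proof -
  have "(\<lambda>\<omega> k. \<omega> (real k * \<delta>)) \<in> measurable L (PiM UNIV (\<lambda>_. borel))"
    by (rule measurable_PiM_single') (use \<open>\<delta> \<ge> 0\<close> in \<open>auto intro: relativistic_levy_coordinate[OF L]\<close>)
  then have "(\<lambda>\<omega> k. \<omega> (real k * \<delta>)) \<in> borel_measurable L"
    by (simp add: measurable_cong_sets[OF refl sets_PiM_equal_borel])
  then show ?thesis by (rule measurable_compose[OF _ borel_measurable_step_sup[OF f \<open>n > 0\<close>]])
qed

text \<open>\<open>N\<close> is found from \<open>L0\<close> alone and serves all \<open>m\<close>.
  Under \<open>L0\<close> the reverse Fatou lemma bounds the integrals over fine grids by
  \<open>a\<close>; domination transfers this bound to \<open>L\<close> at each mesh; under
  \<open>L\<close> Fatou's lemma returns from the grids to \<open>f\<close>.\<close>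

lemma relativistic_levy_upper_bound:
  fixes f :: "(real \<Rightarrow> 'a::euclidean_space) \<Rightarrow> real"
  assumes L0: "relativistic_levy_law 0 L0"
    and f: "continuous_map skorohod euclideanreal f" and C: "\<And>\<omega>. \<omega> \<in> D0 \<Longrightarrow> 0 \<le> f \<omega> \<and> f \<omega> \<le> C"
    and a: "(\<integral>\<^sup>+\<omega>. ennreal (f \<omega>) \<partial>L0) < a"
  shows "\<exists>N::nat. \<forall>m\<ge>0. \<forall>L. relativistic_levy_law m L \<longrightarrow>
    (\<integral>\<^sup>+\<omega>. ennreal (f \<omega>) \<partial>L) \<le> ennreal (exp (m * real N)) * a"
proof -
  interpret L0: prob_space L0 by (rule relativistic_levy_prob_space[OF L0])
  define G where "G n N \<omega> = step_sup f (Suc n) (Suc n * N) (\<lambda>k. \<omega> (real k * (1 / real (Suc n))))" for n N \<omega>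
  have G_meas: "G n N \<in> borel_measurable L" if "relativistic_levy_law m L" for n N m L
    unfolding G_def by (rule relativistic_levy_step_sup_measurable[OF that f]) auto
  have G_le: "G n N \<omega> \<le> ennreal C" for n N \<omega>
    unfolding G_def step_sup_def by (intro SUP_least ennreal_leI) (use C step_path_D0[OF zero_less_Suc] in blast)
  have limsup_le: "limsup (\<lambda>n. G n N \<omega>) \<le> ennreal C" for N \<omega>
    by (intro Limsup_bounded always_eventually allI G_le)
  have liminf_ge: "ennreal (f \<omega>) \<le> liminf (\<lambda>n. G n N \<omega>)" if "\<omega> \<in> D0" for N \<omega>
    unfolding G_def by (rule liminf_step_sup_ge[OF f that])
  have limsup_ge: "ennreal (f \<omega>) \<le> limsup (\<lambda>n. G n N \<omega>)" if "\<omega> \<in> D0" for N \<omega>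
    using liminf_ge[OF that, of N] Liminf_le_Limsup[OF sequentially_bot, of "\<lambda>n. G n N \<omega>"] by (rule order_trans)
  have "(\<lambda>N. \<integral>\<^sup>+\<omega>. limsup (\<lambda>n. G n N \<omega>) \<partial>L0) \<longlonglongrightarrow> (\<integral>\<^sup>+\<omega>. ennreal (f \<omega>) \<partial>L0)"
  proof (rule nn_integral_dominated_convergence[where w = "\<lambda>_. ennreal C"])
    show "(\<lambda>\<omega>. limsup (\<lambda>n. G n N \<omega>)) \<in> borel_measurable L0" for N
      using G_meas[OF L0] by (intro borel_measurable_limsup) auto
    show "(\<lambda>\<omega>. ennreal (f \<omega>)) \<in> borel_measurable L0"
      by (intro measurable_compose[OF relativistic_levy_functional_measurable[OF L0 f]]) measurable
    show "(\<integral>\<^sup>+\<omega>. ennreal C \<partial>L0) < \<infinity>" by (simp add: L0.emeasure_space_1)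
    show "AE \<omega> in L0. limsup (\<lambda>n. G n N \<omega>) \<le> ennreal C" for N by (intro AE_I2 limsup_le)
    show "AE \<omega> in L0. (\<lambda>N. limsup (\<lambda>n. G n N \<omega>)) \<longlonglongrightarrow> ennreal (f \<omega>)"
    proof (rule AE_I2)
      fix \<omega> assume "\<omega> \<in> space L0"
      then have \<omega>: "\<omega> \<in> D0" by (simp add: relativistic_levy_space[OF L0])
      show "(\<lambda>N. limsup (\<lambda>n. G n N \<omega>)) \<longlonglongrightarrow> ennreal (f \<omega>)"
      proof (rule order_tendstoI)
        fix b assume "b < ennreal (f \<omega>)"
        then show "eventually (\<lambda>N. b < limsup (\<lambda>n. G n N \<omega>)) sequentially"
          by (intro always_eventually allI less_le_trans[OF _ limsup_ge[OF \<omega>]])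
      next
        fix b assume "ennreal (f \<omega>) < b"
        then obtain c where c: "ennreal (f \<omega>) < c" "c < b" using dense by blast
        then obtain r where r: "c = ennreal r" "r \<ge> 0" by (cases c) auto
        have "f \<omega> < r" using c(1) C[OF \<omega>] unfolding r(1) by (simp add: ennreal_less_iff)
        then have "eventually (\<lambda>N. limsup (\<lambda>n. G n N \<omega>) \<le> ennreal (f \<omega> + (r - f \<omega>))) sequentially"
          unfolding G_def by (intro limsup_step_sup_le[OF f \<omega>]) simp
        then show "eventually (\<lambda>N. limsup (\<lambda>n. G n N \<omega>) < b) sequentially"
          by eventually_elim (use c(2) r(1) in auto)
      qed
    qed
  qed simp
  from order_tendstoD(2)[OF this a] have "eventually (\<lambda>N. (\<integral>\<^sup>+\<omega>. limsup (\<lambda>n. G n N \<omega>) \<partial>L0) < a \<and> N > 0) sequentially"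
    using eventually_gt_at_top[of 0] by (rule eventually_conj)
  then obtain N where N: "(\<integral>\<^sup>+\<omega>. limsup (\<lambda>n. G n N \<omega>) \<partial>L0) < a" "N > 0"
    by (auto simp: eventually_sequentially)
  have "limsup (\<lambda>n. \<integral>\<^sup>+\<omega>. G n N \<omega> \<partial>L0) \<le> (\<integral>\<^sup>+\<omega>. limsup (\<lambda>n. G n N \<omega>) \<partial>L0)"
    by (rule nn_integral_limsup[where w = "\<lambda>_. ennreal C"])
      (use G_meas[OF L0] G_le in \<open>auto simp: L0.emeasure_space_1\<close>)
  then have ev: "eventually (\<lambda>n. (\<integral>\<^sup>+\<omega>. G n N \<omega> \<partial>L0) < a) sequentially"
    using N(1) by (intro Limsup_lessD) (rule le_less_trans)
  have "(\<integral>\<^sup>+\<omega>. ennreal (f \<omega>) \<partial>L) \<le> ennreal (exp (m * real N)) * a"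
    if "m \<ge> 0" and L: "relativistic_levy_law m L" for m L
  proof -
    have dom: "(\<integral>\<^sup>+\<omega>. G n N \<omega> \<partial>L) \<le> ennreal (exp (m * real N)) * (\<integral>\<^sup>+\<omega>. G n N \<omega> \<partial>L0)" for n
    proof -
      have G_eq: "G n N = (\<lambda>\<omega>. step_sup f (Suc n) (Suc n * N)
        (\<lambda>k. if k \<le> Suc n * N then \<omega> (real k * (1 / real (Suc n))) else 0))"
        unfolding G_def by (intro ext step_sup_cong) simp
      have horizon: "real (Suc n * N) * (1 / real (Suc n)) = real N" by (simp del: of_nat_Suc mult_Suc)
      have "0 < 1 / real (Suc n)" "0 < Suc n * N" using \<open>N > 0\<close> by simp_all
      from relativistic_levy_grid_domination[OF L L0 \<open>m \<ge> 0\<close> this borel_measurable_step_sup[OF f zero_less_Suc]]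
      show ?thesis unfolding G_eq horizon .
    qed
    have "(\<integral>\<^sup>+\<omega>. ennreal (f \<omega>) \<partial>L) \<le> (\<integral>\<^sup>+\<omega>. liminf (\<lambda>n. G n N \<omega>) \<partial>L)"
      by (intro nn_integral_mono liminf_ge) (simp add: relativistic_levy_space[OF L])
    also have "\<dots> \<le> liminf (\<lambda>n. \<integral>\<^sup>+\<omega>. G n N \<omega> \<partial>L)"
      by (rule nn_integral_liminf) (rule G_meas[OF L])
    also have "\<dots> \<le> limsup (\<lambda>n. \<integral>\<^sup>+\<omega>. G n N \<omega> \<partial>L)"
      by (rule Liminf_le_Limsup[OF sequentially_bot])
    also have "\<dots> \<le> ennreal (exp (m * real N)) * a"
    proof (rule Limsup_bounded)
      show "eventually (\<lambda>n. (\<integral>\<^sup>+\<omega>. G n N \<omega> \<partial>L) \<le> ennreal (exp (m * real N)) * a) sequentially"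
        using ev by eventually_elim (rule order_trans[OF dom], rule mult_left_mono, auto)
    qed
    finally show ?thesis .
  qed
  then show ?thesis by blast
qed

lemma relativistic_levy_eventually_le:
  fixes f :: "(real \<Rightarrow> 'a::euclidean_space) \<Rightarrow> real"
  assumes lam: "\<And>m. m \<ge> 0 \<Longrightarrow> relativistic_levy_law m (lam m)"
    and f: "continuous_map skorohod euclideanreal f" and C: "\<And>\<omega>. \<omega> \<in> D0 \<Longrightarrow> 0 \<le> f \<omega> \<and> f \<omega> \<le> C"
    and "e > 0"
  shows "eventually (\<lambda>m. (\<integral>\<omega>. f \<omega> \<partial>lam m) < (\<integral>\<omega>. f \<omega> \<partial>lam 0) + e) (at_right 0)"
proof -
  have eq: "(\<integral>\<^sup>+\<omega>. ennreal (f \<omega>) \<partial>lam m) = ennreal (\<integral>\<omega>. f \<omega> \<partial>lam m)" "0 \<le> (\<integral>\<omega>. f \<omega> \<partial>lam m)" if "m \<ge> 0" for m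
  proof -
    interpret prob_space "lam m" by (rule relativistic_levy_prob_space[OF lam[OF that]])
    have D0: "\<omega> \<in> space (lam m) \<Longrightarrow> \<omega> \<in> D0" for \<omega> using relativistic_levy_space[OF lam[OF that]] by simp
    have "f \<in> borel_measurable (lam m)"
      by (rule relativistic_levy_functional_measurable[OF lam[OF that] f])
    then have "integrable (lam m) f"
      using C D0 by (intro integrable_const_bound[where B = C] AE_I2) auto
    then show "(\<integral>\<^sup>+\<omega>. ennreal (f \<omega>) \<partial>lam m) = ennreal (\<integral>\<omega>. f \<omega> \<partial>lam m)"
      using C D0 by (intro nn_integral_eq_integral AE_I2) auto
    show "0 \<le> (\<integral>\<omega>. f \<omega> \<partial>lam m)" using C D0 by (intro integral_nonneg_AE AE_I2) auto
  qed
  \<comment> \<open>Half of \<open>e\<close> makes the bound strict for \<open>m = 0\<close>; the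
    other half absorbs the factor \<open>exp (m * real N)\<close>, which tends to 1 because
    \<open>N\<close> is fixed before \<open>m\<close> decreases.\<close>
  define b where "b = (\<integral>\<omega>. f \<omega> \<partial>lam 0) + e / 2"
  have b: "b > 0" "(\<integral>\<^sup>+\<omega>. ennreal (f \<omega>) \<partial>lam 0) < ennreal b"
    using eq[of 0] \<open>e > 0\<close> by (simp_all add: b_def ennreal_less_iff)
  obtain N :: nat where N: "\<And>m L. m \<ge> 0 \<Longrightarrow> relativistic_levy_law m L \<Longrightarrow>
    (\<integral>\<^sup>+\<omega>. ennreal (f \<omega>) \<partial>L) \<le> ennreal (exp (m * real N)) * ennreal b"
    using relativistic_levy_upper_bound[OF lam[OF order_refl] f C b(2)] by blast
  have "((\<lambda>m. exp (m * real N) * b) \<longlongrightarrow> exp (0 * real N) * b) (at_right 0)"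
    by (intro tendsto_intros)
  then have "eventually (\<lambda>m. exp (m * real N) * b < b + e / 2) (at_right 0)"
    using \<open>e > 0\<close> by (intro order_tendstoD(2)) auto
  then show ?thesis using eventually_at_right_less[of "0::real"]
  proof eventually_elim
    case (elim m)
    have "ennreal (\<integral>\<omega>. f \<omega> \<partial>lam m) \<le> ennreal (exp (m * real N) * b)"
      using N[OF _ lam, of m] eq(1)[of m] elim b by (simp add: ennreal_mult)
    then have "(\<integral>\<omega>. f \<omega> \<partial>lam m) \<le> exp (m * real N) * b" using b by simp
    then show ?case using elim by (simp add: b_def)
  qed
qed

lemma relativistic_levy_weakly_converges:
  fixes lam :: "real \<Rightarrow> (real \<Rightarrow> 'a::euclidean_space) measure"
  assumes lam: "\<And>m. m \<ge> 0 \<Longrightarrow> relativistic_levy_law m (lam m)"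
  shows "weakly_converges skorohod lam (lam 0) (at_right 0)"
  unfolding weakly_converges_def
proof (intro allI impI)
  fix f :: "(real \<Rightarrow> 'a) \<Rightarrow> real"
  assume "continuous_map skorohod euclideanreal f \<and> bounded (f ` topspace skorohod)"
  then have f: "continuous_map skorohod euclideanreal f" and "bounded (f ` D0)"
    by (auto simp: topspace_skorohod)
  then obtain C where C: "\<And>\<omega>. \<omega> \<in> D0 \<Longrightarrow> \<bar>f \<omega>\<bar> \<le> C" by (auto simp: bounded_iff)
  have affine: "(\<integral>\<omega>. C + c * f \<omega> \<partial>lam m) = C + c * (\<integral>\<omega>. f \<omega> \<partial>lam m)" if "m \<ge> 0" for m c
  proof -
    interpret prob_space "lam m" by (rule relativistic_levy_prob_space[OF lam[OF that]])
    have "f \<in> borel_measurable (lam m)"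
      by (rule relativistic_levy_functional_measurable[OF lam[OF that] f])
    then have "integrable (lam m) f"
      using C relativistic_levy_space[OF lam[OF that]] by (intro integrable_const_bound[where B = C] AE_I2) auto
    then show ?thesis by (simp add: prob_space)
  qed
  \<comment> \<open>The constant \<open>C\<close> cancels because all measures have mass one;
    \<open>c = 1\<close> and \<open>c = -1\<close> give the two sides of the limit.\<close>
  have upper: "eventually (\<lambda>m. c * (\<integral>\<omega>. f \<omega> \<partial>lam m) < c * (\<integral>\<omega>. f \<omega> \<partial>lam 0) + e) (at_right 0)"
    if c: "\<bar>c\<bar> = 1" and "e > 0" for c e
  proof -
    have cont: "continuous_map skorohod euclideanreal (\<lambda>\<omega>. C + c * f \<omega>)"
      using continuous_map_compose[OF f, of euclideanreal "\<lambda>x. C + c * x"]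
      by (simp add: comp_def continuous_map_iff_continuous2 continuous_intros)
    have range: "0 \<le> C + c * f \<omega> \<and> C + c * f \<omega> \<le> 2 * C" if "\<omega> \<in> D0" for \<omega>
      using C[OF that] c by (auto simp: abs_if split: if_splits)
    have "eventually (\<lambda>m. (\<integral>\<omega>. C + c * f \<omega> \<partial>lam m) < (\<integral>\<omega>. C + c * f \<omega> \<partial>lam 0) + e) (at_right 0)"
      by (rule relativistic_levy_eventually_le[OF lam cont range \<open>e > 0\<close>])
    then show ?thesis using eventually_at_right_less[of "0::real"]
      by eventually_elim (simp add: affine)
  qed
  show "((\<lambda>m. \<integral>\<omega>. f \<omega> \<partial>lam m) \<longlongrightarrow> (\<integral>\<omega>. f \<omega> \<partial>lam 0)) (at_right 0)"
  proof (rule tendstoI)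
    fix e :: real assume "e > 0"
    show "eventually (\<lambda>m. dist (\<integral>\<omega>. f \<omega> \<partial>lam m) (\<integral>\<omega>. f \<omega> \<partial>lam 0) < e) (at_right 0)"
      using upper[OF abs_one \<open>e > 0\<close>] upper[OF abs_neg_one \<open>e > 0\<close>]
      by eventually_elim (simp add: dist_real_def abs_less_iff)
  qed
qed

theorem theorem1p1:
  fixes lam :: "real \<Rightarrow> (real \<Rightarrow> real ^ 'd) measure"
    and nu :: "real \<Rightarrow> (real \<Rightarrow> real) measure"
    and M :: "'w measure" and B :: "real \<Rightarrow> 'w \<Rightarrow> real"
  shows "((\<forall>m\<ge>0. relativistic_levy_law m (lam m)) \<longrightarrow>
            weakly_converges skorohod lam (lam 0) (at_right 0)) \<and>
         (brownian_motion M B \<and> (\<forall>m\<ge>0. inverse_gaussian_law M B m (nu m)) \<longrightarrow>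
            weakly_converges skorohod nu (nu 0) (at_right 0))"
  using relativistic_levy_weakly_converges[of lam] inverse_gaussian_weakly_converges[of M B nu] by blast

end
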